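(* Let $S$ be a countable inverse semigroup with zero, and let $S^{\mathrm{Iso}}=\{s\in S: ses^*e\neq 0\text{ for every idempotent }e\text{ with }0\neq e\leqslant s^*s\}$. If $I\subseteq C^*_r(\mathcal{G}_{\mathrm{tight}}(S))$ is an ideal, then \[C^*_r(\mathcal{G}_{\mathrm{tight}}(S^{\mathrm{Iso}}))\cap I\subseteq J_{\mathrm{sing}}(\mathcal{G}_{\mathrm{tight}}(S))\iff C^*_r(\mathcal{G}_{\mathrm{tight}}(S))\cap I\subseteq J_{\mathrm{sing}}(\mathcal{G}_{\mathrm{tight}}(S)).\] In particular, the C*-subalgebra of $C^*_r(\mathcal{G}_{\mathrm{tight}}(S))$ generated by $\{T_s\}_{s\in S^{\mathrm{Iso}}}$ is essentially ideal-detecting.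
   Context: Let $E$ be the idempotents of $S$ with order $e\leqslant f$ iff $ef=e$. A filter is a nonempty proper subset $\xi\subsetneq E$ closed under products and upward closed; ultrafilters are maximal filters; the tight spectrum $\hat E_{\mathrm{tight}}$ is the closure of the set of ultrafilters in the space of filters (topology from $\{0,1\}^E$). For $e\in E$ let $D_e=\{\xi\in\hat E_{\mathrm{tight}}:e\in\xi\}$ (compact open). For $s\in S$ and $\xi\in D_{s^*s}$, $\theta_s(\xi)$ is the upward closure of $\{ses^*:e\in\xi\}$. The tight groupoid $\mathcal{G}_{\mathrm{tight}}(S)$ is the set of equivalence classes $[s,\xi]$ of pairs with $\xi\in D_{s^*s}$, where $(s,\xi)\sim(t,\eta)$ iff $\xi=\eta$ and $se=te$ for some $e\in\xi$ with $e\leqslant s^*s,t^*t$; $d([s,\xi])=\xi$, $r([s,\xi])=\theta_s(\xi)$, $[t,\theta_s(\xi)][s,\xi]=[ts,\xi]$, $[s,\xi]^{-1}=[s^*,\theta_s(\xi)]$, with topology generated by $[s,U]=\{[s,\xi]:\xi\in U\}$, $U\subseteq D_{s^*s}$ compact open. It is an ample groupoid. $T_s$ is the characteristic function of $[s,D_{s^*s}]$, an element of $C^*_r(\mathcal{G}_{\mathrm{tight}}(S))$. $S^{\mathrm{Iso}}$ is an inverse subsemigroup containing $E$, and $\mathcal{G}_{\mathrm{tight}}(S^{\mathrm{Iso}})$ is identified with the open subgroupoid $\{[s,\xi]:s\in S^{\mathrm{Iso}}\}$, so $C^*_r(\mathcal{G}_{\mathrm{tight}}(S^{\mathrm{Iso}}))$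 is a C*-subalgebra of $C^*_r(\mathcal{G}_{\mathrm{tight}}(S))$. Reduced C*-algebras and singular ideals: for a locally compact étale groupoid $\mathcal{G}$, $C^*_r(\mathcal{G})$ is the reduced C*-algebra; $E:C^*_r(\mathcal{G})\to\mathrm{Dix}(\mathcal{G}^{(0)})$ (bounded Borel functions modulo those with meagre support) is the local conditional expectation with $E(f)=f|_U$ for $U$ open dense on which $f\in\mathcal{C}(\mathcal{G})$ is continuous; $J_{\mathrm{sing}}(\mathcal{G})=\{a:E(a^*a)=0\}$. A subalgebra $B\subseteq C^*_r(\mathcal{G})$ is essentially ideal-detecting if every $*$-homomorphism $\pi$ from $C^*_r(\mathcal{G})$ to a C*-algebra that is injective on $B$ satisfies $\ker\pi\subseteq J_{\mathrm{sing}}(\mathcal{G})$ (equivalently, every ideal $I$ with $I\cap B=\{0\}$ satisfies $I\subseteq J_{\mathrm{sing}}(\mathcal{G})$). *)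

theory Defs
  imports "HOL-Analysis.Analysis" "HOL-Library.Countable"
begin

definition inverse_semigroup :: "('a \<Rightarrow> 'a \<Rightarrow> 'a) \<Rightarrow> bool" where
  "inverse_semigroup m \<longleftrightarrow> (\<forall>x y z. m (m x y) z = m x (m y z)) \<and>
     (\<forall>s. \<exists>!t. m (m s t) s = s \<and> m (m t s) t = t)"

definition has_zero :: "('a \<Rightarrow> 'a \<Rightarrow> 'a) \<Rightarrow> bool" where
  "has_zero m \<longleftrightarrow> (\<exists>z. \<forall>s. m z s = z \<and> m s z = z)"

definition zero_of :: "('a \<Rightarrow> 'a \<Rightarrow> 'a) \<Rightarrow> 'a" where
  "zero_of m = (THE z. \<forall>s. m z s = z \<and> m s z = z)"

definition star :: "('a \<Rightarrow> 'a \<Rightarrow> 'a) \<Rightarrow> 'a \<Rightarrow> 'a" where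
  "star m s = (THE t. m (m s t) s = s \<and> m (m t s) t = t)"

definition idems :: "('a \<Rightarrow> 'a \<Rightarrow> 'a) \<Rightarrow> 'a set" where
  "idems m = {e. m e e = e}"

definition leq :: "('a \<Rightarrow> 'a \<Rightarrow> 'a) \<Rightarrow> 'a \<Rightarrow> 'a \<Rightarrow> bool" where
  "leq m e f \<longleftrightarrow> m e f = e"

definition iso_part :: "('a \<Rightarrow> 'a \<Rightarrow> 'a) \<Rightarrow> 'a set" where
  "iso_part m = {s. \<forall>e\<in>idems m. e \<noteq> zero_of m \<and> leq m e (m (star m s) s) \<longrightarrow>
                    m (m (m s e) (star m s)) e \<noteq> zero_of m}"

definition is_filter :: "('a \<Rightarrow> 'a \<Rightarrow> 'a) \<Rightarrow> 'a set \<Rightarrow> bool" where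
  "is_filter m \<xi> \<longleftrightarrow> \<xi> \<noteq> {} \<and> \<xi> \<subset> idems m \<and> (\<forall>e\<in>\<xi>. \<forall>f\<in>\<xi>. m e f \<in> \<xi>) \<and>
     (\<forall>e\<in>\<xi>. \<forall>f\<in>idems m. leq m e f \<longrightarrow> f \<in> \<xi>)"

definition is_ultrafilter :: "('a \<Rightarrow> 'a \<Rightarrow> 'a) \<Rightarrow> 'a set \<Rightarrow> bool" where
  "is_ultrafilter m \<xi> \<longleftrightarrow> is_filter m \<xi> \<and> (\<forall>\<eta>. is_filter m \<eta> \<and> \<xi> \<subseteq> \<eta> \<longrightarrow> \<eta> = \<xi>)"

text \<open>Product topology of \<open>{0,1}^E\<close> on subsets, via its standard subbasis.\<close>
definition cube_top :: "'a set topology" where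
  "cube_top = topology_generated_by ({{\<xi>. e \<in> \<xi>} | e. True} \<union> {{\<xi>. e \<notin> \<xi>} | e. True})"

definition tight :: "('a \<Rightarrow> 'a \<Rightarrow> 'a) \<Rightarrow> 'a set set" where
  "tight m = {\<xi>. is_filter m \<xi> \<and> \<xi> \<in> cube_top closure_of {\<eta>. is_ultrafilter m \<eta>}}"

definition tight_top :: "('a \<Rightarrow> 'a \<Rightarrow> 'a) \<Rightarrow> 'a set topology" where
  "tight_top m = subtopology cube_top (tight m)"

definition Dset :: "('a \<Rightarrow> 'a \<Rightarrow> 'a) \<Rightarrow> 'a \<Rightarrow> 'a set set" where
  "Dset m e = {\<xi> \<in> tight m. e \<in> \<xi>}"

definition theta :: "('a \<Rightarrow> 'a \<Rightarrow> 'a) \<Rightarrow> 'a \<Rightarrow> 'a set \<Rightarrow> 'a set" where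
  "theta m s \<xi> = {f \<in> idems m. \<exists>e\<in>\<xi>. leq m (m (m s e) (star m s)) f}"

type_synonym 'a germ = "('a \<times> 'a set) set"

definition germ :: "('a \<Rightarrow> 'a \<Rightarrow> 'a) \<Rightarrow> 'a \<Rightarrow> 'a set \<Rightarrow> 'a germ" where
  "germ m s \<xi> = {(t, \<eta>). \<eta> = \<xi> \<and> \<eta> \<in> Dset m (m (star m t) t) \<and>
      (\<exists>e\<in>\<xi>. leq m e (m (star m s) s) \<and> leq m e (m (star m t) t) \<and> m s e = m t e)}"

definition Gt :: "('a \<Rightarrow> 'a \<Rightarrow> 'a) \<Rightarrow> 'a germ set" where
  "Gt m = {germ m s \<xi> | s \<xi>. \<xi> \<in> Dset m (m (star m s) s)}"

definition gdom :: "('a \<Rightarrow> 'a \<Rightarrow> 'a) \<Rightarrow> 'a germ \<Rightarrow> 'a set" where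
  "gdom m \<gamma> = (THE \<xi>. \<exists>s. \<xi> \<in> Dset m (m (star m s) s) \<and> \<gamma> = germ m s \<xi>)"

definition ginv :: "('a \<Rightarrow> 'a \<Rightarrow> 'a) \<Rightarrow> 'a germ \<Rightarrow> 'a germ" where
  "ginv m \<gamma> = (THE \<delta>. \<exists>s \<xi>. \<xi> \<in> Dset m (m (star m s) s) \<and> \<gamma> = germ m s \<xi> \<and>
                      \<delta> = germ m (star m s) (theta m s \<xi>))"

definition gprod :: "('a \<Rightarrow> 'a \<Rightarrow> 'a) \<Rightarrow> 'a germ \<Rightarrow> 'a germ \<Rightarrow> 'a germ" where
  "gprod m \<gamma> \<delta> = (THE \<epsilon>. \<exists>s t \<xi>. \<xi> \<in> Dset m (m (star m s) s) \<and> \<delta> = germ m s \<xi> \<and>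
       theta m s \<xi> \<in> Dset m (m (star m t) t) \<and> \<gamma> = germ m t (theta m s \<xi>) \<and>
       \<epsilon> = germ m (m t s) \<xi>)"

text \<open>the unit \<open>[e,x]\<close> at \<open>x\<close> (independent of the choice of \<open>e \<in> x\<close>)\<close>
definition gunit :: "('a \<Rightarrow> 'a \<Rightarrow> 'a) \<Rightarrow> 'a set \<Rightarrow> 'a germ" where
  "gunit m x = germ m (SOME e. e \<in> x) x"

definition bis :: "('a \<Rightarrow> 'a \<Rightarrow> 'a) \<Rightarrow> 'a \<Rightarrow> 'a set set \<Rightarrow> 'a germ set" where
  "bis m s U = {germ m s \<xi> | \<xi>. \<xi> \<in> U}"

definition Tgen :: "('a \<Rightarrow> 'a \<Rightarrow> 'a) \<Rightarrow> 'a \<Rightarrow> 'a germ \<Rightarrow> complex" where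
  "Tgen m s = indicator (bis m s (Dset m (m (star m s) s)))"

section \<open>Reduced C*-algebra, realized as functions on the groupoid (via the injective map j)\<close>

text \<open>Steinberg algebra generated by bisections \<open>[s,U]\<close>, \<open>s\<close> satisfying \<open>P\<close>,
  \<open>U \<subseteq> D_{s*s}\<close> compact open; it is dense in the reduced C*-algebra.\<close>
definition steinberg :: "('a \<Rightarrow> 'a \<Rightarrow> 'a) \<Rightarrow> ('a \<Rightarrow> bool) \<Rightarrow> ('a germ \<Rightarrow> complex) set" where
  "steinberg m P = {f. \<exists>(n::nat) c s U. (\<forall>i<n. P (s i) \<and> U i \<subseteq> Dset m (m (star m (s i)) (s i)) \<and>
        openin (tight_top m) (U i) \<and> compactin (tight_top m) (U i)) \<and>
        f = (\<lambda>\<gamma>. \<Sum>i<n. c i * indicator (bis m (s i) (U i)) \<gamma>)}"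

text \<open>squared reduced norm: \<open>sup_x \<parallel>\<lambda>_x(g)\<parallel>^2\<close>, the operator norm on \<open>\<ell>^2(G_x)\<close>
  computed on finitely supported unit vectors, \<open>(\<lambda>_x(g)v)(\<gamma>) = \<Sum>_\<alpha> g(\<gamma>\<alpha>^{-1}) v(\<alpha>)\<close>\<close>
definition rnorm2 :: "('a \<Rightarrow> 'a \<Rightarrow> 'a) \<Rightarrow> ('a germ \<Rightarrow> complex) \<Rightarrow> ennreal" where
  "rnorm2 m g = (SUP (x, v, F) \<in> {(x, v, F). x \<in> tight m \<and> finite F \<and>
        F \<subseteq> {\<alpha> \<in> Gt m. gdom m \<alpha> = x} \<and> (\<Sum>\<alpha>\<in>F. (cmod (v \<alpha>))\<^sup>2) \<le> 1}.
     \<integral>\<^sup>+ \<gamma>. ennreal ((cmod (\<Sum>\<alpha>\<in>F. g (gprod m \<gamma> (ginv m \<alpha>)) * v \<alpha>))\<^sup>2)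
        \<partial>count_space {\<gamma> \<in> Gt m. gdom m \<gamma> = x})"

definition norm_closure :: "('a \<Rightarrow> 'a \<Rightarrow> 'a) \<Rightarrow> ('a germ \<Rightarrow> complex) set \<Rightarrow> ('a germ \<Rightarrow> complex) set" where
  "norm_closure m A = {g. (\<forall>\<gamma>. \<gamma> \<notin> Gt m \<longrightarrow> g \<gamma> = 0) \<and>
      (\<exists>f. (\<forall>n. f n \<in> A) \<and> (\<lambda>n. rnorm2 m (\<lambda>\<gamma>. f n \<gamma> - g \<gamma>)) \<longlonglongrightarrow> 0)}"

text \<open>\<open>C*_r(G_tight(S))\<close> for \<open>P = \<lambda>_. True\<close>; \<open>C*_r(G_tight(S^Iso))\<close> for \<open>P = (\<in> S^Iso)\<close>\<close>
definition Cred :: "('a \<Rightarrow> 'a \<Rightarrow> 'a) \<Rightarrow> ('a \<Rightarrow> bool) \<Rightarrow> ('a germ \<Rightarrow> complex) set" where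
  "Cred m P = norm_closure m (steinberg m P)"

definition conv :: "('a \<Rightarrow> 'a \<Rightarrow> 'a) \<Rightarrow> ('a germ \<Rightarrow> complex) \<Rightarrow> ('a germ \<Rightarrow> complex) \<Rightarrow> 'a germ \<Rightarrow> complex" where
  "conv m f g \<gamma> = (if \<gamma> \<in> Gt m then
      infsum (\<lambda>\<alpha>. f (gprod m \<gamma> (ginv m \<alpha>)) * g \<alpha>) {\<alpha> \<in> Gt m. gdom m \<alpha> = gdom m \<gamma>} else 0)"

definition adj :: "('a \<Rightarrow> 'a \<Rightarrow> 'a) \<Rightarrow> ('a germ \<Rightarrow> complex) \<Rightarrow> 'a germ \<Rightarrow> complex" where
  "adj m f \<gamma> = (if \<gamma> \<in> Gt m then cnj (f (ginv m \<gamma>)) else 0)"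

definition closed_ideal :: "('a \<Rightarrow> 'a \<Rightarrow> 'a) \<Rightarrow> ('a germ \<Rightarrow> complex) set \<Rightarrow> bool" where
  "closed_ideal m I \<longleftrightarrow> I \<subseteq> Cred m (\<lambda>_. True) \<and> (\<lambda>_. 0) \<in> I \<and>
     (\<forall>f\<in>I. \<forall>g\<in>I. (\<lambda>\<gamma>. f \<gamma> + g \<gamma>) \<in> I) \<and>
     (\<forall>c. \<forall>f\<in>I. (\<lambda>\<gamma>. c * f \<gamma>) \<in> I) \<and>
     (\<forall>a\<in>Cred m (\<lambda>_. True). \<forall>f\<in>I. conv m a f \<in> I \<and> conv m f a \<in> I) \<and>
     norm_closure m I \<subseteq> I"

definition gen_cstar :: "('a \<Rightarrow> 'a \<Rightarrow> 'a) \<Rightarrow> ('a germ \<Rightarrow> complex) set \<Rightarrow> ('a germ \<Rightarrow> complex) set" where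
  "gen_cstar m X = \<Inter> {B. X \<subseteq> B \<and> B \<subseteq> Cred m (\<lambda>_. True) \<and>
     (\<forall>f\<in>B. \<forall>g\<in>B. (\<lambda>\<gamma>. f \<gamma> + g \<gamma>) \<in> B \<and> conv m f g \<in> B) \<and>
     (\<forall>c. \<forall>f\<in>B. (\<lambda>\<gamma>. c * f \<gamma>) \<in> B) \<and> (\<forall>f\<in>B. adj m f \<in> B) \<and>
     norm_closure m B \<subseteq> B}"

definition nowhere_dense_in :: "'b topology \<Rightarrow> 'b set \<Rightarrow> bool" where
  "nowhere_dense_in X A \<longleftrightarrow> A \<subseteq> topspace X \<and> X interior_of (X closure_of A) = {}"

definition meagre_in :: "'b topology \<Rightarrow> 'b set \<Rightarrow> bool" where
  "meagre_in X A \<longleftrightarrow> (\<exists>N :: nat \<Rightarrow> 'b set. (\<forall>n. nowhere_dense_in X (N n)) \<and> A \<subseteq> (\<Union>n. N n))"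

text \<open>\<open>E(a^*a) = 0\<close>, with \<open>E(b)\<close> the class of the restriction of \<open>j(b)\<close> to the unit space\<close>
definition Jsing :: "('a \<Rightarrow> 'a \<Rightarrow> 'a) \<Rightarrow> ('a germ \<Rightarrow> complex) set" where
  "Jsing m = {a \<in> Cred m (\<lambda>_. True).
     meagre_in (tight_top m) {x \<in> tight m. conv m (adj m a) a (gunit m x) \<noteq> 0}}"

definition ess_ideal_detecting :: "('a \<Rightarrow> 'a \<Rightarrow> 'a) \<Rightarrow> ('a germ \<Rightarrow> complex) set \<Rightarrow> bool" where
  "ess_ideal_detecting m B \<longleftrightarrow>
     (\<forall>I. closed_ideal m I \<and> I \<inter> B = {\<lambda>_. 0} \<longrightarrow> I \<subseteq> Jsing m)"

end

theory Submission
  imports Defs "HOL-Computational_Algebra.Polynomial"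
begin

text \<open>
  Let \<open>a\<close> be an element of the ideal \<open>I\<close> outside the singular ideal. After a translation by some \<open>T_s\<close>
  (there are countably many) the function \<open>a\<close> is bounded away from zero on a nonmeagre set of units, and this
  set stays nonmeagre in every \<open>D_e\<close> with \<open>e\<close> below some \<open>e0\<close>. Approximate \<open>a\<close> by a finite combination
  \<open>f\<close> of the \<open>T_s\<close>. Every nonzero idempotent has a nonzero \<open>e\<close> below it such that \<open>e s e\<close> lies in
  \<open>S^Iso\<close> for all the finitely many \<open>s\<close> that occur: where \<open>s\<close> fails the defining condition, \<open>e\<close> can be
  chosen with \<open>e s e = 0\<close>. So \<open>b = T_e f T_e\<close> belongs to the algebra of \<open>S^Iso\<close> and is close to \<open>I\<close>.

  It remains to move from \<open>b\<close> to an element of \<open>I\<close> in the smaller algebra. Let \<open>h = b* b\<close>, scaled so that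
  \<open>0 \<le> h \<le> 1\<close>, with distance at most \<open>\<eta>\<close> to \<open>I\<close>, and apply the Bernstein polynomials \<open>B_n\<close> of
  \<open>max 0 (t - 1/K)\<close> to \<open>h\<close>. The operators \<open>h^i (1-h)^j\<close> are positive, and the classical estimate for
  Bernstein polynomials of a Lipschitz function, written as a positive combination of such operators, shows that
  \<open>B_n(h)\<close> is Cauchy in norm. Only powers \<open>h^k\<close> with \<open>k > n/K\<close> occur in \<open>B_n(h)\<close>, so its distance to \<open>I\<close>
  is at most \<open>4^n \<eta>^(n/K)\<close>, which tends to zero for small \<open>\<eta>\<close>. The limit lies in \<open>I\<close> and in the algebra
  of \<open>S^Iso\<close>, and dominates \<open>h - 1/K\<close>, hence does not vanish on a nonmeagre set of units. Only the distance
  to \<open>I\<close> being submultiplicative is used, not that the quotient by \<open>I\<close> is a C*-algebra.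
\<close>

section \<open>Inverse semigroups\<close>

text \<open>The obstacle is that an element of the algebra of S^Iso which is close to I need not lie
  in I, so an element of the intersection has to be manufactured. The positive part of
  \<open>h - 1/K\<close> is the natural candidate, because it vanishes modulo I as soon as
  \<open>h\<close> is small modulo I. Since the algebras are sets of functions on the groupoid,
  positivity is tested fibre by fibre: \<open>h\<close> acts on the finitely supported vectors of a
  fibre, and a polynomial in \<open>h\<close> is positive once it is a nonnegative combination of
  products \<open>h^i (1-h)^j\<close>. This algebraic certificate takes the role of the spectral
  theorem, and it dictates the Bernstein polynomials, whose error estimates are such combinations.
  Associativity of convolution is shown when the two right factors are finitely supported on each
  fibre, so the polynomial calculus is carried out for finite combinations of the
  \<open>T_s\<close>, and a limit is formed only once, at the end. Countability of S enters twice: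
  to fix one translate of \<open>a\<close>, and to fix one idempotent below which the nonmeagre set
  stays nonmeagre.\<close>

locale inverse_semigroup_zero =
  fixes m :: "'a \<Rightarrow> 'a \<Rightarrow> 'a"
  assumes inv: "inverse_semigroup m" and hz: "has_zero m"
begin

abbreviation mult (infixl "\<odot>" 70) where "x \<odot> y \<equiv> m x y"
abbreviation st where "st \<equiv> star m"
abbreviation E where "E \<equiv> idems m"
abbreviation Z where "Z \<equiv> zero_of m"

lemma assoc: "x \<odot> y \<odot> z = x \<odot> (y \<odot> z)"
  using inv unfolding inverse_semigroup_def by blast

lemma star_unique: assumes "s \<odot> t \<odot> s = s" "t \<odot> s \<odot> t = t" shows "st s = t"
proof -
  have "\<exists>!t. s \<odot> t \<odot> s = s \<and> t \<odot> s \<odot> t = t"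
    using inv unfolding inverse_semigroup_def by blast
  then show ?thesis unfolding star_def using assms by (intro the1_equality) auto
qed

lemma star_inv: "s \<odot> st s \<odot> s = s" "st s \<odot> s \<odot> st s = st s"
proof -
  obtain t where "s \<odot> t \<odot> s = s" "t \<odot> s \<odot> t = t"
    using inv unfolding inverse_semigroup_def by metis
  then show "s \<odot> st s \<odot> s = s" "st s \<odot> s \<odot> st s = st s"
    using star_unique by auto
qed

lemma star_inv': "s \<odot> (st s \<odot> s) = s" "st s \<odot> (s \<odot> st s) = st s"
  "s \<odot> (st s \<odot> (s \<odot> y)) = s \<odot> y" "st s \<odot> (s \<odot> (st s \<odot> y)) = st s \<odot> y"
  using star_inv[of s] by (simp_all flip: assoc)

lemma star_star [simp]: "st (st s) = s"
  using star_inv by (intro star_unique) auto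

lemma idem_iff: "e \<in> E \<longleftrightarrow> e \<odot> e = e"
  by (simp add: idems_def)

lemma idem_dup: "e \<in> E \<Longrightarrow> e \<odot> e = e" "e \<in> E \<Longrightarrow> e \<odot> (e \<odot> y) = e \<odot> y"
  by (simp_all add: idem_iff flip: assoc)

lemma star_idem: "e \<in> E \<Longrightarrow> st e = e"
  by (intro star_unique) (auto simp: idem_iff)

text \<open>With \<open>?x = st (e \<odot> f)\<close>, the element
  \<open>f \<odot> (?x \<odot> e)\<close> is also an inverse of \<open>e \<odot> f\<close>, so
  uniqueness forces it to be \<open>?x\<close>. This makes \<open>?x\<close> idempotent, hence its
  own inverse, and \<open>e \<odot> f\<close> is the inverse of \<open>?x\<close>.\<close>

lemma idem_mult: assumes "e \<in> E" "f \<in> E" shows "e \<odot> f \<in> E"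
proof -
  let ?x = "st (e \<odot> f)"
  have ee: "e \<odot> e = e" "f \<odot> f = f" "\<And>y. e \<odot> (e \<odot> y) = e \<odot> y" "\<And>y. f \<odot> (f \<odot> y) = f \<odot> y"
    using assms by (simp_all add: idem_dup)
  have 1: "e \<odot> (f \<odot> (?x \<odot> (e \<odot> f))) = e \<odot> f" "?x \<odot> (e \<odot> (f \<odot> ?x)) = ?x"
    using star_inv[of "e \<odot> f"] by (auto simp: assoc)
  have x: "?x = f \<odot> (?x \<odot> e)"
  proof (rule star_unique)
    show "e \<odot> f \<odot> (f \<odot> (?x \<odot> e)) \<odot> (e \<odot> f) = e \<odot> f" using 1 ee by (simp add: assoc)
    have "f \<odot> (?x \<odot> (e \<odot> (f \<odot> (?x \<odot> e)))) = f \<odot> (?x \<odot> e)" using 1(2) by (metis assoc)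
    then show "f \<odot> (?x \<odot> e) \<odot> (e \<odot> f) \<odot> (f \<odot> (?x \<odot> e)) = f \<odot> (?x \<odot> e)" by (simp add: assoc ee)
  qed
  have "?x \<odot> ?x = ?x"
    using x 1(2) by (metis assoc)
  then have "st ?x = ?x" using star_idem idem_iff by blast
  then have "e \<odot> f = ?x" by (metis star_star)
  then show ?thesis using \<open>?x \<odot> ?x = ?x\<close> by (simp add: idem_iff)
qed

text \<open>Both \<open>f \<odot> e\<close> and the idempotent \<open>e \<odot> f\<close> itself are
  inverses of \<open>e \<odot> f\<close>.\<close>

lemma idem_comm: assumes "e \<in> E" "f \<in> E" shows "e \<odot> f = f \<odot> e"
proof -
  have ee: "e \<odot> e = e" "f \<odot> f = f" "\<And>y. e \<odot> (e \<odot> y) = e \<odot> y" "\<And>y. f \<odot> (f \<odot> y) = f \<odot> y"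
    using assms by (simp_all add: idem_dup)
  have "e \<odot> f \<odot> (e \<odot> f) = e \<odot> f" "f \<odot> e \<odot> (f \<odot> e) = f \<odot> e"
    using idem_mult assms by (auto simp: idem_iff)
  then have "st (e \<odot> f) = f \<odot> e"
    by (intro star_unique) (auto simp: assoc ee)
  moreover have "st (e \<odot> f) = e \<odot> f" using idem_mult assms star_idem by blast
  ultimately show ?thesis by simp
qed

lemma idem_lcomm: "e \<in> E \<Longrightarrow> f \<in> E \<Longrightarrow> e \<odot> (f \<odot> y) = f \<odot> (e \<odot> y)"
  using idem_comm[of e f] assoc[of e f y] assoc[of f e y] by simp

lemma star_mult_idem [simp]: "st s \<odot> s \<in> E" "s \<odot> st s \<in> E"
  by (simp_all add: idem_iff assoc star_inv')

lemma star_mult [simp]: "st (s \<odot> t) = st t \<odot> st s"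
proof (rule star_unique)
  have c: "st s \<odot> s \<odot> (t \<odot> st t) = t \<odot> st t \<odot> (st s \<odot> s)" by (simp add: idem_comm)
  have "s \<odot> (t \<odot> st t \<odot> (st s \<odot> s)) \<odot> t = s \<odot> (st s \<odot> s \<odot> (t \<odot> st t)) \<odot> t" using c by simp
  then show "s \<odot> t \<odot> (st t \<odot> st s) \<odot> (s \<odot> t) = s \<odot> t" by (simp add: assoc star_inv')
  have "st t \<odot> (st s \<odot> s \<odot> (t \<odot> st t)) \<odot> st s = st t \<odot> (t \<odot> st t \<odot> (st s \<odot> s)) \<odot> st s" using c by simp
  then show "st t \<odot> st s \<odot> (s \<odot> t) \<odot> (st t \<odot> st s) = st t \<odot> st s" by (simp add: assoc star_inv')
qed

lemma conj_mult: assumes "e \<in> E" "f \<in> E"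
  shows "s \<odot> e \<odot> st s \<odot> (s \<odot> f \<odot> st s) = s \<odot> (e \<odot> f) \<odot> st s"
proof -
  have "e \<odot> (st s \<odot> s \<odot> f) = st s \<odot> s \<odot> (e \<odot> f)"
    using idem_lcomm[OF assms(1) star_mult_idem(1), of s f] by simp
  then have "s \<odot> (e \<odot> (st s \<odot> s \<odot> f)) \<odot> st s = s \<odot> (st s \<odot> s \<odot> (e \<odot> f)) \<odot> st s" by simp
  then show ?thesis by (simp add: assoc star_inv')
qed

lemma conj_idem [simp]: "e \<in> E \<Longrightarrow> s \<odot> e \<odot> st s \<in> E"
  using conj_mult[of e e s] by (simp add: idem_iff)

lemma conj_idem' [simp]: "e \<in> E \<Longrightarrow> st s \<odot> e \<odot> s \<in> E"
  using conj_idem[of e "st s"] by simp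

lemma conj_mult': assumes "e \<in> E" "f \<in> E"
  shows "st s \<odot> e \<odot> s \<odot> (st s \<odot> f \<odot> s) = st s \<odot> (e \<odot> f) \<odot> s"
  using conj_mult[of e f "st s"] assms by simp

lemma idem_slide: assumes "e \<in> E" shows "s \<odot> e = s \<odot> e \<odot> st s \<odot> s"
proof -
  have "s \<odot> (st s \<odot> s \<odot> e) = s \<odot> (e \<odot> (st s \<odot> s))" using idem_comm[OF assms star_mult_idem(1)] by simp
  then show ?thesis by (simp add: assoc star_inv')
qed

lemma idem_slide': assumes "e \<in> E" shows "e \<odot> s = s \<odot> (st s \<odot> e \<odot> s)"
proof -
  have "s \<odot> st s \<odot> e \<odot> s = e \<odot> (s \<odot> st s) \<odot> s" using idem_comm[OF assms star_mult_idem(2)] by simp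
  then show ?thesis by (simp add: assoc star_inv')
qed

lemma Z_mult [simp]: "Z \<odot> s = Z" "s \<odot> Z = Z"
proof -
  obtain z where z: "\<forall>s. m z s = z \<and> m s z = z" using hz unfolding has_zero_def by blast
  then have "Z = z" unfolding zero_of_def by (intro the_equality) (metis+)
  then show "Z \<odot> s = Z" "s \<odot> Z = Z" using z by auto
qed

lemma Z_idem [simp]: "Z \<in> E" by (simp add: idem_iff)

section \<open>The subsemigroup S^Iso and compression into it\<close>

abbreviation "Iso \<equiv> iso_part m"

lemma isoD: "s \<in> Iso \<Longrightarrow> e \<in> E \<Longrightarrow> e \<noteq> Z \<Longrightarrow> e \<odot> (st s \<odot> s) = e \<Longrightarrow> s \<odot> e \<odot> st s \<odot> e \<noteq> Z"
  by (auto simp: iso_part_def leq_def)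

lemma isoI: "(\<And>e. e \<in> E \<Longrightarrow> e \<noteq> Z \<Longrightarrow> e \<odot> (st s \<odot> s) = e \<Longrightarrow> s \<odot> e \<odot> st s \<odot> e \<noteq> Z) \<Longrightarrow> s \<in> Iso"
  by (auto simp: iso_part_def leq_def)

lemma Z_iso [simp]: "Z \<in> Iso"
  by (rule isoI) auto

text \<open>With \<open>?k = st s \<odot> g \<odot> s\<close>, conjugation by \<open>s\<close> sends
  \<open>?k\<close> back to \<open>g\<close>. The condition for \<open>s\<close> at
  \<open>?k\<close> is therefore \<open>g \<odot> ?k \<noteq> Z\<close>, which is the condition for
  \<open>st s\<close> at \<open>g\<close> up to the order of the factors.\<close>

lemma iso_star: assumes "s \<in> Iso" shows "st s \<in> Iso"
proof (rule isoI)
  fix g assume g: "g \<in> E" "g \<noteq> Z" "g \<odot> (st (st s) \<odot> st s) = g"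
  let ?k = "st s \<odot> g \<odot> s"
  have sk: "s \<odot> ?k \<odot> st s = g"
    using g by (simp add: assoc) (metis assoc idem_comm idem_dup(2) star_mult_idem(2))
  then have k: "?k \<in> E" "?k \<noteq> Z" using g by auto
  have "?k \<odot> (st s \<odot> s) = ?k" by (simp add: assoc star_inv')
  from isoD[OF assms k this] have "g \<odot> ?k \<noteq> Z" using sk by simp
  then show "st s \<odot> g \<odot> st (st s) \<odot> g \<noteq> Z" using idem_comm[OF g(1) k(1)] by simp
qed

text \<open>The condition for \<open>t\<close> at \<open>g\<close> makes
  \<open>?k = ?f \<odot> g\<close> nonzero, where \<open>?f\<close> is the conjugate of
  \<open>g\<close> by \<open>t\<close>, and the condition for \<open>s\<close> applies to
  \<open>?k\<close>. The resulting nonzero product has the factor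
  \<open>s \<odot> ?f \<odot> st s \<odot> g\<close>, which is the expression to be kept away from
  zero.\<close>

lemma iso_mult: assumes s: "s \<in> Iso" and t: "t \<in> Iso" shows "s \<odot> t \<in> Iso"
proof (rule isoI)
  fix g assume g: "g \<in> E" "g \<noteq> Z" "g \<odot> (st (s \<odot> t) \<odot> (s \<odot> t)) = g"
  let ?f = "t \<odot> g \<odot> st t"
  have f: "?f \<in> E" using g by simp
  have g1: "g \<odot> (st t \<odot> t) = g"
    using g(3) by (simp add: assoc) (metis assoc star_inv'(1))
  let ?k = "?f \<odot> g"
  have kn: "?k \<noteq> Z" by (rule isoD[OF t g(1,2) g1])
  have kE: "?k \<in> E" using f g idem_mult by blast
  have "?f \<odot> (st s \<odot> s) = ?f"
  proof -
    have "?f \<odot> (st s \<odot> s) = ?f \<odot> (t \<odot> st t) \<odot> (st s \<odot> s)" by (simp add: assoc star_inv')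
    also have "\<dots> = ?f \<odot> (st s \<odot> s) \<odot> (t \<odot> st t)" by (simp only: assoc[of ?f]) (simp only: idem_comm star_mult_idem)
    also have "\<dots> = t \<odot> (g \<odot> (st (s \<odot> t) \<odot> (s \<odot> t))) \<odot> st t" by (simp add: assoc)
    finally show ?thesis using g(3) by simp
  qed
  then have "?k \<odot> (st s \<odot> s) = ?k"
    by (metis assoc f g(1) idem_comm star_mult_idem(1))
  from isoD[OF s kE kn this] have n: "s \<odot> ?k \<odot> st s \<odot> ?k \<noteq> Z" .
  have "s \<odot> ?k \<odot> st s \<odot> ?k = (s \<odot> ?f \<odot> st s \<odot> g) \<odot> ((s \<odot> g \<odot> st s) \<odot> ?f)"
  proof -
    have "s \<odot> ?k \<odot> st s = s \<odot> ?f \<odot> st s \<odot> (s \<odot> g \<odot> st s)"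
      using conj_mult[OF f g(1)] by simp
    moreover have "(s \<odot> g \<odot> st s) \<odot> (g \<odot> ?f) = g \<odot> ((s \<odot> g \<odot> st s) \<odot> ?f)"
      using g by (intro idem_lcomm) auto
    ultimately show ?thesis by (metis assoc idem_comm[OF f g(1)])
  qed
  then have "s \<odot> ?f \<odot> st s \<odot> g \<noteq> Z" using n by auto
  then show "s \<odot> t \<odot> g \<odot> st (s \<odot> t) \<odot> g \<noteq> Z" by (simp add: assoc)
qed

lemma idem_iso: "e \<in> E \<Longrightarrow> e \<in> Iso"
  by (rule isoI) (metis assoc idem_comm idem_iff star_idem)

text \<open>The condition of \<open>iso_part\<close> is tested on the restriction of
  \<open>s\<close> to \<open>e \<odot> (st s \<odot> s)\<close>, not on \<open>s\<close>, so that an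
  idempotent \<open>f\<close> violating it lies below \<open>e\<close>. For such \<open>f\<close>
  the conjugate of \<open>f\<close> by \<open>s\<close> is orthogonal to \<open>f\<close>, and
  \<open>f \<odot> s \<odot> f\<close> is zero, which belongs to \<open>Iso\<close>.\<close>

lemma ex_compress_iso:
  assumes e: "e \<in> E" "e \<noteq> Z"
  shows "\<exists>f\<in>E. f \<noteq> Z \<and> f \<odot> e = f \<and> f \<odot> s \<odot> f \<in> Iso"
proof (cases "e \<odot> (st s \<odot> s) = Z")
  case True
  then have "s \<odot> e = Z" by (metis Z_mult(2) assoc e(1) idem_comm star_inv'(1) star_mult_idem(1))
  then have "e \<odot> s \<odot> e \<in> Iso" by (simp add: assoc)
  then show ?thesis using e by (auto simp: idem_iff)
next
  case False
  let ?e = "e \<odot> (st s \<odot> s)"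
  have eE: "?e \<in> E" using e idem_mult star_mult_idem(1) by blast
  show ?thesis
  proof (cases "s \<odot> ?e \<in> Iso")
    case True
    then have "?e \<odot> s \<odot> ?e \<in> Iso" using iso_mult[OF idem_iso[OF eE]] by (simp add: assoc)
    moreover have "?e \<odot> e = ?e"
      using idem_comm[OF eE e(1)] idem_dup(2)[OF e(1)] by simp
    ultimately show ?thesis using False eE by blast
  next
    case False
    then obtain f where f: "f \<in> E" "f \<noteq> Z" "f \<odot> (st (s \<odot> ?e) \<odot> (s \<odot> ?e)) = f"
      and z: "s \<odot> ?e \<odot> f \<odot> st (s \<odot> ?e) \<odot> f = Z" using isoI by blast
    have "st (s \<odot> ?e) \<odot> (s \<odot> ?e) = ?e"
    proof -
      have "st (s \<odot> ?e) \<odot> (s \<odot> ?e) = ?e \<odot> (st s \<odot> s) \<odot> ?e"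
        by (simp only: star_mult[of s ?e] star_idem[OF eE] assoc)
      also have "?e \<odot> (st s \<odot> s) = ?e" by (simp add: assoc star_inv')
      finally show ?thesis using idem_dup(1)[OF eE] by simp
    qed
    then have fe: "f \<odot> ?e = f" using f by simp
    have ef: "?e \<odot> f = f" using fe idem_comm eE f by metis
    have fe2: "f \<odot> e = f" 
      using ef idem_dup(2)[OF e(1), of "st s \<odot> s"] idem_comm[OF e(1) f(1)] assoc[of e ?e f] by simp
    have "s \<odot> ?e \<odot> f \<odot> st (s \<odot> ?e) = s \<odot> f \<odot> st s"

    proof -
      have "s \<odot> ?e \<odot> f \<odot> st (s \<odot> ?e) = s \<odot> (?e \<odot> f \<odot> ?e) \<odot> st s"
        by (simp only: star_mult[of s ?e] star_idem[OF eE] assoc)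
      then show ?thesis using ef fe by simp
    qed
    then have "s \<odot> f \<odot> st s \<odot> f = Z" using z by simp
    then have "f \<odot> (s \<odot> f \<odot> st s) = Z" using idem_comm f conj_idem by metis
    then have "f \<odot> s \<odot> f = Z" using idem_slide[OF f(1), of s] assoc[of f s f] assoc[of f "s \<odot> f \<odot> st s" s] by simp
    then show ?thesis using f fe2 by auto
  qed
qed

end

section \<open>Filters and the tight spectrum\<close>

context inverse_semigroup_zero
begin

text \<open>Since \<open>Z\<close> lies below every idempotent, an upward closed set containing it
  is all of \<open>E\<close>; properness thus becomes \<open>Z \<notin> \<xi>\<close>.\<close>

lemma filter_iff: "is_filter m \<xi> \<longleftrightarrow> \<xi> \<noteq> {} \<and> \<xi> \<subseteq> E \<and> Z \<notin> \<xi> \<and> (\<forall>e\<in>\<xi>. \<forall>f\<in>\<xi>. e \<odot> f \<in> \<xi>) \<and>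
   (\<forall>e\<in>\<xi>. \<forall>f\<in>E. e \<odot> f = e \<longrightarrow> f \<in> \<xi>)"
proof -
  have "Z \<in> \<xi> \<Longrightarrow> (\<forall>e\<in>\<xi>. \<forall>f\<in>E. e \<odot> f = e \<longrightarrow> f \<in> \<xi>) \<Longrightarrow> E \<subseteq> \<xi>" by auto
  then show ?thesis unfolding is_filter_def leq_def psubset_eq using Z_idem by blast
qed

lemma filter_idem: "is_filter m \<xi> \<Longrightarrow> e \<in> \<xi> \<Longrightarrow> e \<in> E"
  by (auto simp: filter_iff)

lemma filter_up: "is_filter m \<xi> \<Longrightarrow> e \<in> \<xi> \<Longrightarrow> f \<in> E \<Longrightarrow> e \<odot> f = e \<Longrightarrow> f \<in> \<xi>"
  unfolding filter_iff by blast

lemma filter_mult: "is_filter m \<xi> \<Longrightarrow> e \<in> \<xi> \<Longrightarrow> f \<in> \<xi> \<Longrightarrow> e \<odot> f \<in> \<xi>"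
  unfolding filter_iff by blast

lemma filter_mult_iff:
  assumes "is_filter m \<xi>" "e \<in> E" "f \<in> E"
  shows "e \<odot> f \<in> \<xi> \<longleftrightarrow> e \<in> \<xi> \<and> f \<in> \<xi>"
proof -
  have "e \<odot> f \<odot> f = e \<odot> f" "e \<odot> f \<odot> e = e \<odot> f"
    using assms by (simp_all add: assoc idem_dup idem_comm[of f e])
  then show ?thesis using filter_up[OF assms(1), of "e \<odot> f"] filter_mult[OF assms(1)] assms by metis
qed

lemma filter_Z: "is_filter m \<xi> \<Longrightarrow> Z \<notin> \<xi>"
  by (simp add: filter_iff)

text \<open>Replaces the upward closure in \<open>theta\<close> by a pullback along conjugation.
  Being free of an existential quantifier, this form reduces all later questions about
  \<open>theta\<close> to membership in \<open>\<xi>\<close>.\<close>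

lemma theta_eq:
  assumes \<xi>: "is_filter m \<xi>" and s: "st s \<odot> s \<in> \<xi>"
  shows "theta m s \<xi> = {f \<in> E. st s \<odot> f \<odot> s \<in> \<xi>}"
proof (intro set_eqI iffI)
  fix f assume "f \<in> theta m s \<xi>"
  then obtain e where f: "f \<in> E" "e \<in> \<xi>" "s \<odot> e \<odot> st s \<odot> f = s \<odot> e \<odot> st s"
    by (auto simp: theta_def leq_def)
  have e: "e \<in> E" using filter_idem \<xi> f by blast
  have c: "st s \<odot> (s \<odot> e \<odot> st s) \<odot> s = e \<odot> (st s \<odot> s)"
  proof -
    have "st s \<odot> (s \<odot> e \<odot> st s) \<odot> s = st s \<odot> (s \<odot> e \<odot> st s \<odot> s)" by (simp add: assoc)
    also have "\<dots> = (st s \<odot> s) \<odot> e" using idem_slide[OF e, of s] assoc[of "st s" s e] by simp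
    finally show ?thesis using idem_comm[OF e star_mult_idem(1)[of s]] by simp
  qed
  have "e \<odot> (st s \<odot> s) \<odot> (st s \<odot> f \<odot> s) = st s \<odot> (s \<odot> e \<odot> st s \<odot> f) \<odot> s"
    using conj_mult'[of "s \<odot> e \<odot> st s" f s] c e f by simp
  also have "\<dots> = e \<odot> (st s \<odot> s)" using f(3) c by simp
  finally have "e \<odot> (st s \<odot> s) \<odot> (st s \<odot> f \<odot> s) = e \<odot> (st s \<odot> s)" .
  moreover have "e \<odot> (st s \<odot> s) \<in> \<xi>" using \<xi> s f filter_mult by blast
  ultimately show "f \<in> {f \<in> E. st s \<odot> f \<odot> s \<in> \<xi>}" using f filter_up[OF \<xi>] by simp
next
  fix f assume "f \<in> {f \<in> E. st s \<odot> f \<odot> s \<in> \<xi>}"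
  then have f: "f \<in> E" "st s \<odot> f \<odot> s \<in> \<xi>" by auto
  have "s \<odot> (st s \<odot> f \<odot> s) \<odot> st s = f \<odot> (s \<odot> st s)"
    using idem_slide'[OF f(1), of s] assoc[of f s "st s"] by simp
  moreover have "f \<odot> (s \<odot> st s) \<odot> f = f \<odot> (s \<odot> st s)"
    using idem_comm[OF idem_mult[OF f(1) star_mult_idem(2)[of s]] f(1)] idem_dup(2)[OF f(1)] by simp
  ultimately show "f \<in> theta m s \<xi>" using f by (auto simp: theta_def leq_def intro!: bexI[of _ "st s \<odot> f \<odot> s"])
qed

lemma theta_filter:
  assumes \<xi>: "is_filter m \<xi>" and s: "st s \<odot> s \<in> \<xi>"
  shows "is_filter m (theta m s \<xi>)"
proof -
  have 1: "s \<odot> st s \<in> {f \<in> E. st s \<odot> f \<odot> s \<in> \<xi>}" using s by (simp add: assoc star_inv')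
  have 2: "st s \<odot> e \<odot> s \<odot> (st s \<odot> f \<odot> s) \<in> \<xi>" if "st s \<odot> e \<odot> s \<in> \<xi>" "st s \<odot> f \<odot> s \<in> \<xi>" for e f
    using that \<xi> filter_mult by blast
  have 3: "st s \<odot> f \<odot> s \<in> \<xi>" if "st s \<odot> e \<odot> s \<in> \<xi>" "e \<in> E" "f \<in> E" "e \<odot> f = e" for e f
    using filter_up[OF \<xi> that(1), of "st s \<odot> f \<odot> s"] conj_mult'[OF that(2,3), of s] that by simp
  show ?thesis
    unfolding theta_eq[OF assms] filter_iff
  proof (intro conjI)
    show "{f \<in> E. st s \<odot> f \<odot> s \<in> \<xi>} \<noteq> {}" using 1 by blast
  qed (use 2 3 filter_Z[OF \<xi>] in \<open>auto simp: idem_mult simp flip: conj_mult'\<close>)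
qed

lemma theta_theta:
  assumes \<xi>: "is_filter m \<xi>" and s: "st s \<odot> s \<in> \<xi>" and t: "st t \<odot> t \<in> theta m s \<xi>"
  shows "theta m t (theta m s \<xi>) = theta m (t \<odot> s) \<xi>"
proof -
  have "st (t \<odot> s) \<odot> (t \<odot> s) \<in> \<xi>" using t by (simp add: theta_eq[OF \<xi> s] assoc)
  moreover have "st t \<odot> f \<odot> t \<in> theta m s \<xi> \<longleftrightarrow> st (t \<odot> s) \<odot> f \<odot> (t \<odot> s) \<in> \<xi>" if "f \<in> E" for f
    using conj_idem'[OF that, of t] by (simp add: theta_eq[OF \<xi> s] assoc)
  ultimately show ?thesis
    using theta_eq[OF theta_filter[OF \<xi> s] t] theta_eq[OF \<xi>, of "t \<odot> s"] by auto
qed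

lemma mult_dom:
  assumes \<xi>: "is_filter m \<xi>" and s: "st s \<odot> s \<in> \<xi>" and t: "st t \<odot> t \<in> theta m s \<xi>"
  shows "st (t \<odot> s) \<odot> (t \<odot> s) \<in> \<xi>"
  using t by (simp add: theta_eq[OF \<xi> s] assoc)

lemma theta_dom_iff:
  assumes \<xi>: "is_filter m \<xi>" and s: "st s \<odot> s \<in> \<xi>"
  shows "f \<in> theta m s \<xi> \<longleftrightarrow> f \<in> E \<and> st s \<odot> f \<odot> s \<in> \<xi>"
  using theta_eq[OF assms] by auto

lemma star_dom:
  assumes \<xi>: "is_filter m \<xi>" and s: "st s \<odot> s \<in> \<xi>"
  shows "s \<odot> st s \<in> theta m s \<xi>"
  using s by (simp add: theta_dom_iff[OF assms] assoc star_inv')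

text \<open>For \<open>e \<in> \<xi>\<close>, replacing \<open>u\<close> by
  \<open>u \<odot> e\<close> only multiplies \<open>st u \<odot> f \<odot> u\<close> by
  \<open>e\<close> on both sides, which does not affect membership in \<open>\<xi>\<close>. This
  makes the range of a germ well defined.\<close>

lemma theta_cong:
  assumes \<xi>: "is_filter m \<xi>" and s: "st s \<odot> s \<in> \<xi>" and t: "st t \<odot> t \<in> \<xi>"
    and e: "e \<in> \<xi>" "s \<odot> e = t \<odot> e"
  shows "theta m s \<xi> = theta m t \<xi>"
proof -
  have eE: "e \<in> E" using \<xi> e filter_idem by blast
  have *: "st u \<odot> f \<odot> u \<in> \<xi> \<longleftrightarrow> st (u \<odot> e) \<odot> f \<odot> (u \<odot> e) \<in> \<xi>" if "f \<in> E" for f u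
  proof -
    have "st (u \<odot> e) \<odot> f \<odot> (u \<odot> e) = e \<odot> (st u \<odot> f \<odot> u \<odot> e)" by (simp add: star_idem[OF eE] assoc)
    then show ?thesis using filter_mult_iff[OF \<xi>] eE e that
      by (metis conj_idem' idem_mult)
  qed
  show ?thesis unfolding theta_eq[OF \<xi> s] theta_eq[OF \<xi> t] using *[of _ s] *[of _ t] e(2) by metis
qed

lemma theta_idem:
  assumes \<xi>: "is_filter m \<xi>" and e: "e \<in> \<xi>" shows "theta m e \<xi> = \<xi>"
proof -
  have eE: "e \<in> E" using \<xi> e filter_idem by blast
  then show ?thesis using e filter_mult_iff[OF \<xi>] filter_idem[OF \<xi>] idem_mult
    by (subst theta_eq[OF \<xi>]) (auto simp: star_idem idem_dup)
qed

lemma theta_inverse: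
  assumes \<xi>: "is_filter m \<xi>" and s: "st s \<odot> s \<in> \<xi>"
  shows "theta m (st s) (theta m s \<xi>) = \<xi>"
  using theta_theta[OF assms, of "st s"] star_dom[OF assms] theta_idem[OF assms] by simp

text \<open>\<open>theta m (st s)\<close> is monotone and undoes \<open>theta m s\<close>, so a
  filter above \<open>theta m s \<xi>\<close> is carried to a filter above
  \<open>\<xi>\<close>.\<close>

lemma theta_ultrafilter:
  assumes u: "is_ultrafilter m \<xi>" and s: "st s \<odot> s \<in> \<xi>"
  shows "is_ultrafilter m (theta m s \<xi>)"
proof -
  have \<xi>: "is_filter m \<xi>" using u by (simp add: is_ultrafilter_def)
  have "\<eta> = theta m s \<xi>" if \<eta>: "is_filter m \<eta>" and sub: "theta m s \<xi> \<subseteq> \<eta>" for \<eta>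
  proof -
    have ss: "st (st s) \<odot> st s \<in> \<eta>" using star_dom[OF \<xi> s] sub by auto
    have "\<xi> = theta m (st s) (theta m s \<xi>)" using theta_inverse[OF \<xi> s] by simp
    also have "\<dots> \<subseteq> theta m (st s) \<eta>" using sub by (auto simp: theta_def)
    finally have "theta m (st s) \<eta> = \<xi>"
      using u theta_filter[OF \<eta> ss] unfolding is_ultrafilter_def by blast
    then show ?thesis using theta_inverse[OF \<eta> ss] by simp
  qed
  then show ?thesis using theta_filter[OF \<xi> s] by (auto simp: is_ultrafilter_def)
qed

text \<open>Zorn's lemma among the filters containing \<open>e\<close>, starting from the principal
  one. A maximal member is an ultrafilter because every larger filter contains \<open>e\<close> as
  well.\<close>

lemma ex_ultrafilter:
  assumes e: "e \<in> E" "e \<noteq> Z"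
  shows "\<exists>\<xi>. is_ultrafilter m \<xi> \<and> e \<in> \<xi>"
proof -
  define \<A> where "\<A> = {\<xi>. is_filter m \<xi> \<and> e \<in> \<xi>}"
  have p: "{f \<in> E. e \<odot> f = e} \<in> \<A>"
    unfolding \<A>_def filter_iff using e
    by (auto simp: idem_mult idem_dup) (metis assoc)+
  have "\<exists>M\<in>\<A>. \<forall>X\<in>\<A>. M \<subseteq> X \<longrightarrow> X = M"
  proof (rule subset_Zorn_nonempty)
    show "\<A> \<noteq> {}" using p by auto
    fix \<C> assume C: "\<C> \<noteq> {}" "subset.chain \<A> \<C>"
    then have CA: "\<And>X. X \<in> \<C> \<Longrightarrow> is_filter m X \<and> e \<in> X" by (auto simp: subset.chain_def \<A>_def)
    have tot: "X \<subseteq> Y \<or> Y \<subseteq> X" if "X \<in> \<C>" "Y \<in> \<C>" for X Y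
      using C(2) that unfolding subset_chain_def by blast
    have mu: "a \<odot> b \<in> \<Union>\<C>" if "a \<in> X" "b \<in> Y" "X \<in> \<C>" "Y \<in> \<C>" for a b X Y
    proof (cases "X \<subseteq> Y")
      case True
      then show ?thesis using that CA[of Y] filter_mult[of Y a b] by blast
    next
      case False
      then show ?thesis using tot that CA[of X] filter_mult[of X a b] by blast
    qed
    have "is_filter m (\<Union>\<C>)" unfolding filter_iff
    proof (intro conjI ballI impI)
      obtain X where "X \<in> \<C>" using C(1) by blast
      then show "\<Union>\<C> \<noteq> {}" using CA by blast
      show "\<Union>\<C> \<subseteq> E" using CA filter_idem by blast
      show "Z \<notin> \<Union>\<C>" using CA filter_Z by blast
      show "a \<odot> b \<in> \<Union>\<C>" if "a \<in> \<Union>\<C>" "b \<in> \<Union>\<C>" for a b using mu that by blast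
      show "b \<in> \<Union>\<C>" if "a \<in> \<Union>\<C>" "b \<in> E" "a \<odot> b = a" for a b
        using that CA filter_up[of _ a b] by blast
    qed
    then show "\<Union>\<C> \<in> \<A>" unfolding \<A>_def using C(1) CA by blast
  qed
  then show ?thesis unfolding \<A>_def is_ultrafilter_def by blast
qed

text \<open>If no element of \<open>\<xi>\<close> annihilated \<open>f\<close>, the upward closure
  of the products \<open>e \<odot> f\<close> with \<open>e \<in> \<xi>\<close> would be a filter
  containing \<open>\<xi>\<close> and \<open>f\<close>, against maximality.\<close>

lemma ultrafilter_notin:
  assumes u: "is_ultrafilter m \<xi>" and f: "f \<in> E" "f \<notin> \<xi>"
  shows "\<exists>e\<in>\<xi>. e \<odot> f = Z"
proof (rule ccontr)
  assume "\<not> ?thesis"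
  then have nz: "\<And>e. e \<in> \<xi> \<Longrightarrow> e \<odot> f \<noteq> Z" by auto
  have \<xi>: "is_filter m \<xi>" using u by (simp add: is_ultrafilter_def)
  let ?\<eta> = "{g \<in> E. \<exists>e\<in>\<xi>. e \<odot> f \<odot> g = e \<odot> f}"
  have cl: "a \<odot> b \<in> ?\<eta>" if "a \<in> ?\<eta>" "b \<in> ?\<eta>" for a b
  proof -
    obtain c d where cd: "c \<in> \<xi>" "d \<in> \<xi>" "c \<odot> f \<odot> a = c \<odot> f" "d \<odot> f \<odot> b = d \<odot> f" "a \<in> E" "b \<in> E"
      using \<open>a \<in> ?\<eta>\<close> \<open>b \<in> ?\<eta>\<close> by auto
    have E: "c \<in> E" "d \<in> E" "c \<odot> f \<in> E" "d \<odot> f \<in> E" using cd \<xi> filter_idem f idem_mult by blast+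
    have eq: "c \<odot> d \<odot> f = (c \<odot> f) \<odot> (d \<odot> f)"
      using E f by (simp add: assoc idem_lcomm[of f d f] idem_dup)
    have "(c \<odot> f) \<odot> (d \<odot> f) \<odot> (a \<odot> b) = (c \<odot> f \<odot> a) \<odot> (d \<odot> f \<odot> b)"
      using idem_lcomm[OF E(4) cd(5), of b] by (simp add: assoc)
    then have "c \<odot> d \<odot> f \<odot> (a \<odot> b) = c \<odot> d \<odot> f" using cd eq by simp
    then show ?thesis using cd filter_mult[OF \<xi>] idem_mult by blast
  qed
  have up: "b \<in> ?\<eta>" if "a \<in> ?\<eta>" "b \<in> E" "a \<odot> b = a" for a b
    using that by auto (metis assoc)
  have sub: "\<xi> \<subseteq> ?\<eta>"
  proof
    fix g assume g: "g \<in> \<xi>"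
    then have gE: "g \<in> E" using \<xi> filter_idem by blast
    then have "g \<odot> f \<odot> g = g \<odot> f" using f by (simp add: assoc idem_comm[of f g] idem_dup)
    then show "g \<in> ?\<eta>" using g gE by auto
  qed
  have ne: "\<xi> \<noteq> {}" using \<xi> by (simp add: filter_iff)
  have ff: "f \<in> ?\<eta>" using f ne by (auto simp: assoc idem_dup)
  have "is_filter m ?\<eta>" unfolding filter_iff

  proof (intro conjI ballI impI)
    show "?\<eta> \<noteq> {}" "?\<eta> \<subseteq> E" using sub ne by auto
    show "Z \<notin> ?\<eta>" using nz by auto (metis)
  qed (use cl up in blast)+
  then have "?\<eta> = \<xi>" using u sub unfolding is_ultrafilter_def by blast
  then show False using ff f by blast
qed

section \<open>Cylinder sets and invariance of the tight spectrum under \<open>theta\<close>\<close>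

definition cyl :: "'a set \<Rightarrow> 'a set \<Rightarrow> 'a set set" where
  "cyl A B = {\<eta>. A \<subseteq> \<eta> \<and> B \<inter> \<eta> = {}}"

lemma cube_basis:
  assumes "openin cube_top U" "\<xi> \<in> U"
  shows "\<exists>A B. finite A \<and> finite B \<and> \<xi> \<in> cyl A B \<and> cyl A B \<subseteq> U"
proof -
  let ?S = "{{\<xi>. e \<in> \<xi>} | e. True} \<union> {{\<xi>. e \<notin> \<xi>} | e::'a. True}"
  have "generate_topology_on ?S U"
    using assms(1) unfolding cube_top_def by (rule openin_topology_generated_by)
  then show ?thesis using assms(2)
  proof (induction U)
    case (Int a b)
    then have "\<xi> \<in> a" "\<xi> \<in> b" by auto
    obtain A B where 1: "finite A" "finite B" "\<xi> \<in> cyl A B" "cyl A B \<subseteq> a"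
      using Int.IH(1)[OF \<open>\<xi> \<in> a\<close>] by blast
    obtain A' B' where 2: "finite A'" "finite B'" "\<xi> \<in> cyl A' B'" "cyl A' B' \<subseteq> b"
      using Int.IH(2)[OF \<open>\<xi> \<in> b\<close>] by blast
    have "cyl (A \<union> A') (B \<union> B') = cyl A B \<inter> cyl A' B'" by (auto simp: cyl_def)
    then have "\<xi> \<in> cyl (A \<union> A') (B \<union> B') \<and> cyl (A \<union> A') (B \<union> B') \<subseteq> a \<inter> b"
      using 1 2 by blast
    then show ?case using 1 2 by (meson finite_UnI)
  next
    case (UN K)
    then show ?case by (meson Sup_upper UnionE order_trans)
  next
    case (Basis s)
    from Basis(1) consider e where "s = {\<xi>. e \<in> \<xi>}" | e where "s = {\<xi>. e \<notin> \<xi>}" by blast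
    then show ?case
    proof cases
      case 1
      then have "s = cyl {e} {}" by (simp add: cyl_def)
      then show ?thesis using Basis(2) by blast
    next
      case 2
      then have "s = cyl {} {e}" by (simp add: cyl_def)
      then show ?thesis using Basis(2) by blast
    qed
  qed auto
qed

lemma topspace_cube [simp]: "topspace cube_top = UNIV"
  unfolding cube_top_def topology_generated_by_topspace by auto

lemma open_subbasic: "openin cube_top {\<xi>. (e::'a) \<in> \<xi>}" "openin cube_top {\<xi>. (e::'a) \<notin> \<xi>}"
  unfolding cube_top_def by (auto intro!: topology_generated_by_Basis)

lemma open_cyl: assumes "finite A" "finite B" shows "openin cube_top (cyl A B)"
proof -
  have "cyl A B = \<Inter> (insert UNIV ((\<lambda>e. {\<xi>. e \<in> \<xi>}) ` A \<union> (\<lambda>e. {\<xi>. e \<notin> \<xi>}) ` B))" by (auto simp: cyl_def)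
  moreover have "openin cube_top (\<Inter> (insert UNIV ((\<lambda>e. {\<xi>. e \<in> \<xi>}) ` A \<union> (\<lambda>e. {\<xi>. e \<notin> \<xi>}) ` B)))"
    using assms open_subbasic openin_topspace[of "cube_top :: 'a set topology"] by (intro openin_Inter) auto
  ultimately show ?thesis by simp
qed

lemma cube_closure_iff:
  "\<xi> \<in> cube_top closure_of W \<longleftrightarrow> (\<forall>A B. finite A \<and> finite B \<and> \<xi> \<in> cyl A B \<longrightarrow> (\<exists>\<eta>\<in>W. \<eta> \<in> cyl A B))"
  unfolding in_closure_of using cube_basis open_cyl by (simp) (meson subsetD)

lemma tight_filter: "\<xi> \<in> tight m \<Longrightarrow> is_filter m \<xi>"
  by (simp add: tight_def)

lemma ultrafilter_tight: "is_ultrafilter m \<xi> \<Longrightarrow> \<xi> \<in> tight m"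
  unfolding tight_def using closure_of_subset[of "{\<eta>. is_ultrafilter m \<eta>}" cube_top]
  unfolding is_ultrafilter_def[symmetric] by (auto simp: is_ultrafilter_def[of m \<xi>])

text \<open>By \<open>theta_eq\<close> a basic neighbourhood of \<open>theta m s \<xi>\<close> pulls
  back to a basic neighbourhood of \<open>\<xi>\<close>. It contains an ultrafilter, whose image
  under \<open>theta m s\<close> is again an ultrafilter.\<close>

lemma theta_tight:
  assumes x: "\<xi> \<in> tight m" and s: "st s \<odot> s \<in> \<xi>"
  shows "theta m s \<xi> \<in> tight m"
proof -
  have \<xi>: "is_filter m \<xi>" and cl: "\<xi> \<in> cube_top closure_of {\<eta>. is_ultrafilter m \<eta>}"
    using x by (auto simp: tight_def)
  have "theta m s \<xi> \<in> cube_top closure_of {\<eta>. is_ultrafilter m \<eta>}"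
    unfolding cube_closure_iff
  proof (intro allI impI)
    fix A B assume AB: "finite A \<and> finite B \<and> theta m s \<xi> \<in> cyl A B"
    \<comment> \<open>The added \<open>st s \<odot> s\<close> keeps the approximating ultrafilter in
      the domain of \<open>theta m s\<close>. Elements of \<open>B\<close> outside \<open>E\<close>
      are dropped, as no filter contains them.\<close>
    let ?A = "insert (st s \<odot> s) ((\<lambda>f. st s \<odot> f \<odot> s) ` A)" and ?B = "(\<lambda>f. st s \<odot> f \<odot> s) ` (B \<inter> E)"
    have "finite ?A \<and> finite ?B \<and> \<xi> \<in> cyl ?A ?B"
      using AB s by (auto simp: cyl_def theta_eq[OF \<xi> s])
    then obtain \<eta> where \<eta>: "is_ultrafilter m \<eta>" "\<eta> \<in> cyl ?A ?B"
      using cl unfolding cube_closure_iff by blast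
    then have f: "is_filter m \<eta>" "st s \<odot> s \<in> \<eta>" by (auto simp: is_ultrafilter_def cyl_def)
    have "A \<subseteq> E" using AB by (auto simp: cyl_def theta_eq[OF \<xi> s])
    then have "theta m s \<eta> \<in> cyl A B"
      using \<eta>(2) by (auto simp: cyl_def theta_eq[OF f])
    then show "\<exists>\<eta>\<in>{\<eta>. is_ultrafilter m \<eta>}. \<eta> \<in> cyl A B"
      using theta_ultrafilter[OF \<eta>(1) f(2)] by blast
  qed
  then show ?thesis using theta_filter[OF \<xi> s] by (simp add: tight_def)
qed

end

section \<open>Baire category and compact open sets\<close>

lemma meagre_in_subset: "meagre_in X B \<Longrightarrow> A \<subseteq> B \<Longrightarrow> meagre_in X A"
  unfolding meagre_in_def by (meson order_trans)

lemma meagre_in_UN: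
  assumes "countable I" and "\<And>i. i \<in> I \<Longrightarrow> meagre_in X (A i)"
  shows "meagre_in X (\<Union>i\<in>I. A i)"
proof (cases "I = {}")
  case True
  have "nowhere_dense_in X {}" by (simp add: nowhere_dense_in_def)
  then show ?thesis using True unfolding meagre_in_def by (intro exI[of _ "\<lambda>_. {}"]) auto
next
  case False
  have "\<forall>i\<in>I. \<exists>N :: nat \<Rightarrow> _. (\<forall>n. nowhere_dense_in X (N n)) \<and> A i \<subseteq> (\<Union>n. N n)"
    using assms(2) unfolding meagre_in_def by blast
  then obtain N where N: "\<And>i n. i \<in> I \<Longrightarrow> nowhere_dense_in X (N i n)"
    "\<And>i. i \<in> I \<Longrightarrow> A i \<subseteq> (\<Union>n::nat. N i n)" by metis
  define M where "M k = (case prod_decode k of (i, n) \<Rightarrow> N (from_nat_into I i) n)" for k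
  have "nowhere_dense_in X (M k)" for k
    using N(1) from_nat_into[OF False] by (auto simp: M_def split: prod.split)
  moreover have "(\<Union>i\<in>I. A i) \<subseteq> (\<Union>k. M k)"
  proof
    fix x assume "x \<in> (\<Union>i\<in>I. A i)"
    then obtain i n where "i \<in> I" "x \<in> N i n" using N(2) by blast
    then have "x \<in> M (prod_encode (to_nat_on I i, n))"
      using assms(1) by (simp add: M_def)
    then show "x \<in> (\<Union>k. M k)" by blast
  qed
  ultimately show ?thesis unfolding meagre_in_def by blast
qed

lemma meagre_in_Un: assumes "meagre_in X A" "meagre_in X B" shows "meagre_in X (A \<union> B)"
  using meagre_in_UN[of "UNIV :: bool set" X "\<lambda>b. if b then A else B"] assms
  by (simp add: UNIV_bool Un_commute)

lemma nowhere_dense_meagre: "nowhere_dense_in X A \<Longrightarrow> meagre_in X A"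
  unfolding meagre_in_def by (intro exI[of _ "\<lambda>_. A"]) auto

text \<open>Tychonoff's theorem for a power of the two-point discrete space, transported along the
  map from predicates to sets.\<close>

lemma compact_cube: "compact_space (cube_top :: 'a set topology)"
proof -
  let ?P = "product_topology (\<lambda>_::'a. discrete_topology (UNIV::bool set)) UNIV"
  have P: "compact_space ?P"
    by (simp add: compact_space_product_topology compact_space_discrete_topology)
  have tP: "topspace ?P = UNIV" by simp
  have pr: "openin ?P {f. f e \<in> V}" for e :: 'a and V
    using openin_continuous_map_preimage[OF continuous_map_product_projection[of e UNIV "\<lambda>_. discrete_topology UNIV"], of V]
    by simp
  have op: "openin ?P ((\<lambda>f. {e. f e}) -` U \<inter> topspace ?P)"
    if "U \<in> {{\<xi>. e \<in> \<xi>} | e. True} \<union> {{\<xi>. e \<notin> \<xi>} | e::'a. True}" for U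
  proof -
    from that consider e where "U = {\<xi>. e \<in> \<xi>}" | e where "U = {\<xi>. e \<notin> \<xi>}" by blast
    then show ?thesis
    proof cases
      case 1
      then have "(\<lambda>f. {e. f e}) -` U \<inter> topspace ?P = {f. f e \<in> {True}}" unfolding tP by auto
      then show ?thesis using pr[of e "{True}"] by simp
    next
      case 2
      then have "(\<lambda>f. {e. f e}) -` U \<inter> topspace ?P = {f. f e \<in> {False}}" unfolding tP by auto
      then show ?thesis using pr[of e "{False}"] by simp
    qed
  qed
  have "continuous_map ?P cube_top (\<lambda>f. {e. f e})"
    unfolding cube_top_def by (rule continuous_on_generated_topo[OF op]) auto
  then have "compactin cube_top ((\<lambda>f. {e::'a. f e}) ` topspace ?P)"
    using image_compactin P compact_space_def by blast
  moreover have "(\<lambda>f. {e::'a. f e}) ` topspace ?P = UNIV"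
    unfolding tP by (auto intro!: image_eqI[of _ _ "\<lambda>e. e \<in> _"])
  moreover have "topspace (cube_top :: 'a set topology) = UNIV"
    unfolding cube_top_def topology_generated_by_topspace by auto
  ultimately show ?thesis unfolding compact_space_def by simp
qed

context inverse_semigroup_zero
begin

section \<open>The sets \<open>Dset m e\<close>: compactness, density, localization of
  category\<close>

lemma topspace_tight [simp]: "topspace (tight_top m) = tight m"
  by (simp add: tight_top_def)

lemma open_Dset: "openin (tight_top m) (Dset m e)"
proof -
  have "Dset m e = {\<xi>. e \<in> \<xi>} \<inter> tight m" by (auto simp: Dset_def)
  then show ?thesis unfolding tight_top_def openin_subtopology using open_subbasic(1) by blast
qed

lemma closed_subbasic: "closedin cube_top {\<xi>. (e::'a) \<in> \<xi>}"
proof -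
  have "{\<xi>. e \<in> \<xi>} = topspace cube_top - {\<xi>. e \<notin> \<xi>}" unfolding topspace_cube by blast
  then show ?thesis using closedin_diff[OF closedin_topspace open_subbasic(2)] by metis
qed

text \<open>Apart from nonemptiness, each filter axiom involves only finitely many idempotents and
  therefore passes to the closure. Nonemptiness can be lost in a limit, hence the assumption
  \<open>e \<in> \<xi>\<close>.\<close>

lemma closure_filter:
  assumes \<xi>: "\<xi> \<in> cube_top closure_of {\<eta>. is_ultrafilter m \<eta>}" and e: "e \<in> \<xi>"
  shows "is_filter m \<xi>"
proof -
  have *: "\<exists>\<eta>. is_filter m \<eta> \<and> A \<subseteq> \<eta> \<and> B \<inter> \<eta> = {}" if fin: "finite A" "finite B" "A \<subseteq> \<xi>" "B \<inter> \<xi> = {}" for A B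
  proof -
    have "\<xi> \<in> cyl A B" using fin by (auto simp: cyl_def)
    then obtain \<eta> where "is_ultrafilter m \<eta>" "\<eta> \<in> cyl A B"
      using \<xi> fin(1,2) unfolding cube_closure_iff by blast
    then show ?thesis unfolding cyl_def is_ultrafilter_def by blast
  qed
  show ?thesis unfolding filter_iff
  proof (intro conjI ballI impI subsetI)
    show "\<xi> \<noteq> {}" using e by auto
    show "f \<in> E" if "f \<in> \<xi>" for f
      using *[of "{f}" "{}"] that filter_idem by auto
    show "Z \<notin> \<xi>" using *[of "{Z}" "{}"] filter_Z by auto
    show "a \<odot> b \<in> \<xi>" if "a \<in> \<xi>" "b \<in> \<xi>" for a b
    proof (rule ccontr)
      assume "a \<odot> b \<notin> \<xi>"
      then obtain \<eta> where "is_filter m \<eta>" "{a, b} \<subseteq> \<eta>" "{a \<odot> b} \<inter> \<eta> = {}"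
        using *[of "{a, b}" "{a \<odot> b}"] \<open>a \<in> \<xi>\<close> \<open>b \<in> \<xi>\<close> by auto
      then show False using filter_mult[of \<eta> a b] by auto
    qed
    show "b \<in> \<xi>" if "a \<in> \<xi>" "b \<in> E" "a \<odot> b = a" for a b
    proof (rule ccontr)
      assume "b \<notin> \<xi>"
      then obtain \<eta> where "is_filter m \<eta>" "{a} \<subseteq> \<eta>" "{b} \<inter> \<eta> = {}"
        using *[of "{a}" "{b}"] \<open>a \<in> \<xi>\<close> by auto
      then show False using filter_up[of \<eta> a b] \<open>b \<in> E\<close> \<open>a \<odot> b = a\<close> by auto
    qed
  qed
qed

text \<open>Prescribing \<open>e \<in> \<xi>\<close> excludes the empty limit point, so
  \<open>Dset m e\<close> is closed in the whole cube although the tight spectrum need not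
  be.\<close>

lemma compact_Dset: "compactin (tight_top m) (Dset m e)"
proof -
  have "Dset m e = cube_top closure_of {\<eta>. is_ultrafilter m \<eta>} \<inter> {\<xi>. e \<in> \<xi>}"
    using closure_filter by (auto simp: Dset_def tight_def)
  moreover have "closedin cube_top (cube_top closure_of {\<eta>. is_ultrafilter m \<eta>} \<inter> {\<xi>. e \<in> \<xi>})"
    by (intro closedin_Int closed_subbasic closedin_closure_of)
  ultimately have "compactin cube_top (Dset m e)"
    using closedin_compact_space[OF compact_cube] by simp
  then show ?thesis unfolding tight_top_def compactin_subtopology by (auto simp: Dset_def)
qed

lemma filter_lower_bound:
  assumes "is_filter m \<eta>" "finite A" "A \<subseteq> \<eta>"
  shows "\<exists>e\<in>\<eta>. \<forall>a\<in>A. e \<odot> a = e"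
  using assms(2,3)
proof (induction A rule: finite_induct)
  case empty
  then show ?case using assms(1) by (auto simp: filter_iff)
next
  case (insert a A)
  then obtain e where e: "e \<in> \<eta>" "\<forall>a\<in>A. e \<odot> a = e" by auto
  have aE: "a \<in> E" "e \<in> E" "a \<in> \<eta>" using insert e filter_idem[OF assms(1)] by auto
  have "a \<odot> e \<odot> b = a \<odot> e" if "b \<in> insert a A" for b
    using that e aE by (auto simp: assoc idem_comm[of e a] idem_dup)
  then show ?case using filter_mult[OF assms(1) aE(3) e(1)] by blast
qed

lemma ultrafilter_disjoint_bound:
  assumes u: "is_ultrafilter m \<eta>" and B: "finite B" "B \<subseteq> E" "B \<inter> \<eta> = {}"
  shows "\<exists>e\<in>\<eta>. \<forall>b\<in>B. e \<odot> b = Z"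
  using B
proof (induction B rule: finite_induct)
  case empty
  then show ?case using u by (auto simp: is_ultrafilter_def filter_iff)
next
  case (insert a A)
  have \<eta>: "is_filter m \<eta>" using u by (simp add: is_ultrafilter_def)
  from insert obtain e where e: "e \<in> \<eta>" "\<forall>a\<in>A. e \<odot> a = Z" by auto
  obtain f where f: "f \<in> \<eta>" "f \<odot> a = Z" using ultrafilter_notin[OF u, of a] insert by auto
  have E: "e \<in> E" "f \<in> E" using e f filter_idem[OF \<eta>] by auto
  have "e \<odot> f \<odot> b = Z" if "b \<in> insert a A" for b
  proof (cases "b = a")
    case True then show ?thesis using f by (simp add: assoc)
  next
    case False
    then have "f \<odot> (e \<odot> b) = Z" using that e by simp
    then show ?thesis using idem_lcomm[OF E] by (simp add: assoc)
  qed
  then show ?case using filter_mult[OF \<eta> e(1) f(1)] by blast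
qed

text \<open>Ultrafilters are dense, and around an ultrafilter the negative conditions of a cylinder
  become positive: finitely many excluded idempotents are annihilated by one member
  \<open>b\<close>. A single product \<open>a \<odot> b\<close> then enforces the whole
  cylinder.\<close>

lemma open_contains_Dset:
  assumes "openin (tight_top m) U" "U \<noteq> {}"
  shows "\<exists>e\<in>E. e \<noteq> Z \<and> Dset m e \<subseteq> U"
proof -
  obtain V where V: "openin cube_top V" "U = V \<inter> tight m"
    using assms(1) unfolding tight_top_def openin_subtopology by blast
  obtain \<xi> where \<xi>: "\<xi> \<in> V" "\<xi> \<in> tight m" using assms(2) V by blast
  then have "\<xi> \<in> cube_top closure_of {\<eta>. is_ultrafilter m \<eta>}" by (simp add: tight_def)
  then obtain \<eta> where \<eta>: "is_ultrafilter m \<eta>" "\<eta> \<in> V"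
    using V(1) \<xi>(1) unfolding in_closure_of by blast
  obtain A B where AB: "finite A" "finite B" "\<eta> \<in> cyl A B" "cyl A B \<subseteq> V"
    using cube_basis[OF V(1) \<eta>(2)] by blast
  have f: "is_filter m \<eta>" using \<eta> by (simp add: is_ultrafilter_def)
  obtain a where a: "a \<in> \<eta>" "\<forall>c\<in>A. a \<odot> c = a"
    using filter_lower_bound[OF f AB(1)] AB(3) by (auto simp: cyl_def)
  obtain b where b: "b \<in> \<eta>" "\<forall>c\<in>B \<inter> E. b \<odot> c = Z"
    using ultrafilter_disjoint_bound[OF \<eta>(1), of "B \<inter> E"] AB by (auto simp: cyl_def)
  have E: "a \<in> E" "b \<in> E" using a b filter_idem[OF f] by auto
  have AE: "A \<subseteq> E" using AB(3) filter_idem[OF f] by (auto simp: cyl_def)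
  have "Dset m (a \<odot> b) \<subseteq> U"
  proof
    fix \<zeta> assume "\<zeta> \<in> Dset m (a \<odot> b)"
    then have z: "\<zeta> \<in> tight m" "is_filter m \<zeta>" "a \<in> \<zeta>" "b \<in> \<zeta>"
      using filter_mult_iff[OF _ E] tight_filter by (auto simp: Dset_def)
    have "c \<in> \<zeta>" if "c \<in> A" for c using filter_up[OF z(2,3)] a AE that by blast
    moreover have "c \<notin> \<zeta>" if "c \<in> B" for c
    proof
      assume c: "c \<in> \<zeta>"
      then have "b \<odot> c = Z" using b that filter_idem[OF z(2)] by blast
      then show False using filter_mult[OF z(2,4) c] filter_Z[OF z(2)] by simp
    qed
    ultimately have "\<zeta> \<in> cyl A B" by (auto simp: cyl_def)
    then show "\<zeta> \<in> U" using AB(4) V z by blast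
  qed
  moreover have "a \<odot> b \<noteq> Z" using filter_mult[OF f a(1) b(1)] filter_Z[OF f] by metis
  ultimately show ?thesis using idem_mult[OF E] by blast
qed

lemma Dset_nonempty: "e \<in> E \<Longrightarrow> e \<noteq> Z \<Longrightarrow> Dset m e \<noteq> {}"
  using ex_ultrafilter ultrafilter_tight by (auto simp: Dset_def)

text \<open>Otherwise the idempotents \<open>f\<close> with \<open>A \<inter> Dset m f\<close>
  meagre occur below every nonzero idempotent. The union of their sets \<open>Dset m f\<close> is
  then open and dense, its complement is nowhere dense, and countably many meagre pieces cover the
  rest of \<open>A\<close>.\<close>

lemma nonmeagre_localize:
  assumes cnt: "countable E" and A: "A \<subseteq> tight m" "\<not> meagre_in (tight_top m) A"
  shows "\<exists>e\<in>E. e \<noteq> Z \<and> (\<forall>f\<in>E. f \<noteq> Z \<and> f \<odot> e = f \<longrightarrow> \<not> meagre_in (tight_top m) (A \<inter> Dset m f))"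
proof (rule ccontr)
  assume neg: "\<not> ?thesis"
  define F where "F = {f\<in>E. f \<noteq> Z \<and> meagre_in (tight_top m) (A \<inter> Dset m f)}"
  have dense: "\<exists>f\<in>F. f \<odot> e = f" if "e \<in> E" "e \<noteq> Z" for e
    using neg that unfolding F_def by blast
  let ?U = "\<Union>f\<in>F. Dset m f"
  have "openin (tight_top m) ?U" using open_Dset by blast
  then have cl: "closedin (tight_top m) (tight m - ?U)" by (metis closedin_diff closedin_topspace topspace_tight)
  have "(tight_top m) interior_of (tight m - ?U) = {}"
  proof (rule ccontr)
    assume ne: "(tight_top m) interior_of (tight m - ?U) \<noteq> {}"
    obtain e where e: "e \<in> E" "e \<noteq> Z" "Dset m e \<subseteq> (tight_top m) interior_of (tight m - ?U)"
      using open_contains_Dset[OF openin_interior_of ne] by blast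
    have sub: "Dset m e \<subseteq> tight m - ?U" by (rule order_trans[OF e(3) interior_of_subset])
    obtain f where f: "f \<in> F" "f \<odot> e = f" using dense e by blast
    then have fE: "f \<in> E" "f \<noteq> Z" by (auto simp: F_def)
    then obtain \<xi> where \<xi>: "\<xi> \<in> Dset m f" using Dset_nonempty by blast
    then have "e \<in> \<xi>" using filter_up[OF tight_filter, of \<xi> f e] e(1) f(2) by (auto simp: Dset_def)
    then have "\<xi> \<in> Dset m e" using \<xi> by (simp add: Dset_def)
    then show False using sub \<xi> f(1) by blast
  qed
  then have "meagre_in (tight_top m) (tight m - ?U)"
    using cl by (intro nowhere_dense_meagre) (auto simp: nowhere_dense_in_def closure_of_closedin)
  moreover have "meagre_in (tight_top m) (\<Union>f\<in>F. A \<inter> Dset m f)"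
    using cnt by (intro meagre_in_UN) (auto simp: F_def intro: countable_subset)
  ultimately have "meagre_in (tight_top m) ((tight m - ?U) \<union> (\<Union>f\<in>F. A \<inter> Dset m f))"
    by (rule meagre_in_Un)
  then have "meagre_in (tight_top m) A" by (rule meagre_in_subset) (use A(1) in auto)
  then show False using A(2) by simp
qed

section \<open>Compact open sets and the linear span of the indicators of the sets
  \<open>Dset m e\<close>\<close>

inductive_set dspan :: "('a set \<Rightarrow> complex) set" where
  dspan_0: "(\<lambda>_. 0) \<in> dspan"
| dspan_Cons: "e \<in> E \<Longrightarrow> f \<in> dspan \<Longrightarrow> (\<lambda>\<xi>. c * indicator (Dset m e) \<xi> + f \<xi>) \<in> dspan"

lemma dspan_add: assumes "f \<in> dspan" "g \<in> dspan" shows "(\<lambda>\<xi>. f \<xi> + g \<xi>) \<in> dspan"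
  using assms(1)
proof induction
  case (dspan_Cons e f c)
  then show ?case using dspan.dspan_Cons[of e _ c] by (simp add: add.assoc)
qed (use assms in simp)

lemma dspan_scale: assumes "f \<in> dspan" shows "(\<lambda>\<xi>. c * f \<xi>) \<in> dspan"
  using assms
proof induction
  case (dspan_Cons e f d)
  then show ?case using dspan.dspan_Cons[of e _ "c * d"] by (simp add: algebra_simps)
qed (auto intro: dspan.intros)

lemma indicator_Dset_mult:
  "e \<in> E \<Longrightarrow> f \<in> E \<Longrightarrow> indicator (Dset m e) \<xi> * indicator (Dset m f) \<xi> = (indicator (Dset m (e \<odot> f)) \<xi> :: complex)"
  using filter_mult_iff[OF tight_filter, of \<xi> e f] by (auto simp: indicator_def Dset_def)

lemma dspan_mult_Dset: assumes "f \<in> dspan" "e \<in> E" shows "(\<lambda>\<xi>. indicator (Dset m e) \<xi> * f \<xi>) \<in> dspan"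
  using assms(1)
proof induction
  case (dspan_Cons g f d)
  have "(\<lambda>\<xi>. indicator (Dset m e) \<xi> * (d * indicator (Dset m g) \<xi> + f \<xi>)) =
        (\<lambda>\<xi>. d * indicator (Dset m (e \<odot> g)) \<xi> + indicator (Dset m e) \<xi> * f \<xi>)"
    using dspan_Cons assms(2) by (simp add: algebra_simps flip: indicator_Dset_mult)
  then show ?case using dspan_Cons assms(2) idem_mult by (simp add: dspan.dspan_Cons)
qed (auto intro: dspan.intros)

lemma dspan_mult: assumes "f \<in> dspan" "g \<in> dspan" shows "(\<lambda>\<xi>. f \<xi> * g \<xi>) \<in> dspan"
  using assms(1)
proof induction
  case (dspan_Cons e f d)
  have "(\<lambda>\<xi>. (d * indicator (Dset m e) \<xi> + f \<xi>) * g \<xi>) = (\<lambda>\<xi>. d * (indicator (Dset m e) \<xi> * g \<xi>) + f \<xi> * g \<xi>)"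
    by (simp add: algebra_simps)
  then show ?case using dspan_Cons dspan_add dspan_scale dspan_mult_Dset[OF assms(2)] by simp
qed (auto intro: dspan.intros)

text \<open>Membership is encoded linearly: as \<open>dspan\<close> is closed under products, the
  Boolean operations reduce to polynomial identities between indicators.\<close>

definition dset_ring :: "'a set set set" where "dset_ring = {U. indicator U \<in> dspan}"

lemma dset_ring_Dset: "e \<in> E \<Longrightarrow> Dset m e \<in> dset_ring"
  using dspan_Cons[OF _ dspan_0, of e 1] by (simp add: dset_ring_def)

lemma dset_ring_Int: assumes "U \<in> dset_ring" "V \<in> dset_ring" shows "U \<inter> V \<in> dset_ring"
proof -
  have "(indicator (U \<inter> V) :: _ \<Rightarrow> complex) = (\<lambda>\<xi>. indicator U \<xi> * indicator V \<xi>)"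
    by (auto simp: indicator_def)
  then show ?thesis using assms dspan_mult by (simp add: dset_ring_def)
qed

lemma dset_ring_Diff: assumes "U \<in> dset_ring" "V \<in> dset_ring" shows "U - V \<in> dset_ring"
proof -
  have "(indicator (U - V) :: _ \<Rightarrow> complex) = (\<lambda>\<xi>. indicator U \<xi> + (-1) * (indicator U \<xi> * indicator V \<xi>))"
    by (auto simp: indicator_def)
  then show ?thesis using assms dspan_mult dspan_add dspan_scale by (simp only: dset_ring_def mem_Collect_eq)
qed

lemma dset_ring_Un: assumes "U \<in> dset_ring" "V \<in> dset_ring" shows "U \<union> V \<in> dset_ring"
proof -
  have "(indicator (U \<union> V) :: _ \<Rightarrow> complex) = (\<lambda>\<xi>. indicator U \<xi> + indicator (V - U) \<xi>)"
    by (auto simp: indicator_def)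
  then show ?thesis using assms dset_ring_Diff[of V U] dspan_add by (simp only: dset_ring_def mem_Collect_eq)
qed

lemma dset_ring_Union: assumes "finite F" "F \<subseteq> dset_ring" shows "\<Union>F \<in> dset_ring"
  using assms
proof (induction F rule: finite_induct)
  case empty
  have "(indicator {} :: 'a set \<Rightarrow> complex) = (\<lambda>_. 0)" by auto
  then show ?case using dspan_0 by (simp add: dset_ring_def)
qed (auto simp: dset_ring_Un)

lemma dset_ring_cyl:
  assumes "finite A" "A \<subseteq> E" "finite B" "B \<subseteq> E" "e \<in> E"
  shows "Dset m e \<inter> cyl A B \<in> dset_ring"
  using assms(1,2)
proof (induction A rule: finite_induct)
  case empty
  show ?case using assms(3,4)
  proof (induction B rule: finite_induct)
    case empty
    then show ?case using dset_ring_Dset[OF assms(5)] by (simp add: cyl_def)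
  next
    case (insert b B)
    have "Dset m e \<inter> cyl {} (insert b B) = Dset m e \<inter> cyl {} B - Dset m b"
      by (auto simp: cyl_def Dset_def)
    then show ?case using insert dset_ring_Diff dset_ring_Dset by simp
  qed
next
  case (insert a A)
  have "Dset m e \<inter> cyl (insert a A) B = Dset m e \<inter> cyl A B \<inter> Dset m a"
    by (auto simp: cyl_def Dset_def)
  then show ?case using insert dset_ring_Int dset_ring_Dset by simp
qed

text \<open>Every point of \<open>U\<close> has a neighbourhood inside \<open>U\<close> that belongs
  to the ring, and compactness leaves a finite union. Cylinders are cut down by some
  \<open>Dset m e\<close> with \<open>e \<in> \<xi>\<close>, because the whole spectrum need not be
  in the ring.\<close>

lemma compact_open_dring:
  assumes op: "openin (tight_top m) U" and co: "compactin (tight_top m) U"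
  shows "U \<in> dset_ring"
proof -
  obtain V where V: "openin cube_top V" "U = V \<inter> tight m"
    using op unfolding tight_top_def openin_subtopology by blast
  let ?\<U> = "{W \<in> dset_ring. openin (tight_top m) W \<and> W \<subseteq> U}"
  have "U \<subseteq> \<Union>?\<U>"
  proof
    fix \<xi> assume \<xi>: "\<xi> \<in> U"
    then have f: "is_filter m \<xi>" "\<xi> \<in> tight m" using V tight_filter by auto
    have "\<xi> \<noteq> {}" using f(1) by (simp add: filter_iff)
    then obtain e where e: "e \<in> \<xi>" "e \<in> E" using filter_idem[OF f(1)] by blast
    obtain A B where AB: "finite A" "finite B" "\<xi> \<in> cyl A B" "cyl A B \<subseteq> V"
      using cube_basis[OF V(1)] \<xi> V by blast
    let ?W = "Dset m e \<inter> cyl A (B \<inter> E)"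
    have AE: "A \<subseteq> E" using AB(3) filter_idem[OF f(1)] by (auto simp: cyl_def)
    have d: "?W \<in> dset_ring" using AB AE e by (intro dset_ring_cyl) auto
    have o: "openin (tight_top m) ?W"

    proof -
      have "openin cube_top (cyl (insert e A) (B \<inter> E))" using AB by (intro open_cyl) auto
      moreover have "?W = cyl (insert e A) (B \<inter> E) \<inter> tight m" by (auto simp: cyl_def Dset_def)
      ultimately show ?thesis unfolding tight_top_def openin_subtopology by blast
    qed
    have "?W \<subseteq> U"
    proof
      fix \<zeta> assume z: "\<zeta> \<in> ?W"
      then have "\<zeta> \<in> tight m" by (auto simp: Dset_def)
      then have "\<zeta> \<subseteq> E" using tight_filter filter_idem by blast
      then have "\<zeta> \<in> cyl A B" using z by (auto simp: cyl_def)
      then show "\<zeta> \<in> U" using AB(4) V \<open>\<zeta> \<in> tight m\<close> by blast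
    qed
    moreover have "\<xi> \<in> ?W" using AB(3) e f(2) by (auto simp: cyl_def Dset_def)
    ultimately show "\<xi> \<in> \<Union>?\<U>" using d o by blast
  qed
  then obtain F where F: "finite F" "F \<subseteq> ?\<U>" "U \<subseteq> \<Union>F"
    using co unfolding compactin_def by (metis (no_types, lifting) mem_Collect_eq)
  then have "U = \<Union>F" by blast
  then show ?thesis using dset_ring_Union[OF F(1)] F(2) by auto
qed

end

section \<open>The groupoid of germs\<close>

context inverse_semigroup_zero
begin

text \<open>The order conditions on the witness in \<open>germ\<close> can be arranged afterwards:
  multiply \<open>e\<close> by the two domain idempotents.\<close>

lemma mem_germ:
  assumes "\<xi> \<in> Dset m (st s \<odot> s)"
  shows "(t, \<eta>) \<in> germ m s \<xi> \<longleftrightarrow> \<eta> = \<xi> \<and> st t \<odot> t \<in> \<xi> \<and> (\<exists>e\<in>\<xi>. s \<odot> e = t \<odot> e)"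
proof
  assume "(t, \<eta>) \<in> germ m s \<xi>"
  then show "\<eta> = \<xi> \<and> st t \<odot> t \<in> \<xi> \<and> (\<exists>e\<in>\<xi>. s \<odot> e = t \<odot> e)"
    by (auto simp: germ_def Dset_def)
next
  have \<xi>: "\<xi> \<in> tight m" "is_filter m \<xi>" "st s \<odot> s \<in> \<xi>" using assms tight_filter by (auto simp: Dset_def)
  assume "\<eta> = \<xi> \<and> st t \<odot> t \<in> \<xi> \<and> (\<exists>e\<in>\<xi>. s \<odot> e = t \<odot> e)"
  then obtain e where e: "\<eta> = \<xi>" "st t \<odot> t \<in> \<xi>" "e \<in> \<xi>" "s \<odot> e = t \<odot> e" by blast
  let ?a = "st s \<odot> s" and ?b = "st t \<odot> t"
  let ?f = "e \<odot> (?a \<odot> ?b)"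
  have eE: "e \<in> E" using filter_idem \<xi> e by blast
  have "?f \<in> \<xi>" using filter_mult[OF \<xi>(2)] \<xi>(3) e by blast
  moreover have "?a \<odot> ?b \<odot> ?a = ?a \<odot> ?b" "?a \<odot> ?b \<odot> ?b = ?a \<odot> ?b"
    using idem_comm[of ?b ?a] idem_dup(2)[of ?a ?b] idem_dup(1)[of ?b] assoc[of ?a ?b ?a] assoc[of ?a ?b ?b] by auto
  then have "?f \<odot> ?a = ?f" "?f \<odot> ?b = ?f" by (simp_all only: assoc[of e])
  moreover have "s \<odot> ?f = t \<odot> ?f" using e(4) by (simp flip: assoc)
  ultimately show "(t, \<eta>) \<in> germ m s \<xi>"
    using e \<xi> unfolding germ_def leq_def by (auto simp: Dset_def)
qed

lemma germ_eq_iff: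
  assumes s: "\<xi> \<in> Dset m (st s \<odot> s)" and t: "\<eta> \<in> Dset m (st t \<odot> t)"
  shows "germ m s \<xi> = germ m t \<eta> \<longleftrightarrow> \<xi> = \<eta> \<and> (\<exists>e\<in>\<xi>. s \<odot> e = t \<odot> e)"
proof
  assume eq: "germ m s \<xi> = germ m t \<eta>"
  have \<eta>: "st t \<odot> t \<in> \<eta>" using t by (simp add: Dset_def)
  then have "(t, \<eta>) \<in> germ m t \<eta>" using mem_germ[OF t] by blast
  then show "\<xi> = \<eta> \<and> (\<exists>e\<in>\<xi>. s \<odot> e = t \<odot> e)" using mem_germ[OF s] eq by auto
next
  assume a: "\<xi> = \<eta> \<and> (\<exists>e\<in>\<xi>. s \<odot> e = t \<odot> e)"
  then obtain e where e: "\<xi> = \<eta>" "e \<in> \<xi>" "s \<odot> e = t \<odot> e" by blast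
  have \<xi>: "is_filter m \<xi>" using s tight_filter by (auto simp: Dset_def)
  have "(u, \<zeta>) \<in> germ m s \<xi> \<longleftrightarrow> (u, \<zeta>) \<in> germ m t \<eta>" for u \<zeta>
  proof -
    have *: "\<exists>e\<in>\<xi>. s' \<odot> e = u \<odot> e" if "f \<in> \<xi>" "t' \<odot> f = u \<odot> f" "s' \<odot> e = t' \<odot> e" for f s' t'
    proof
      have E: "e \<in> E" "f \<in> E" using filter_idem \<xi> e that by blast+
      show "e \<odot> f \<in> \<xi>" using filter_mult \<xi> e that by blast
      have "s' \<odot> (e \<odot> f) = t' \<odot> (f \<odot> e)" using that(3) idem_comm[OF E] assoc[of s' e f] assoc[of t' e f] by simp
      also have "\<dots> = u \<odot> (f \<odot> e)" using that(2) assoc[of t' f e] assoc[of u f e] by simp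
      finally show "s' \<odot> (e \<odot> f) = u \<odot> (e \<odot> f)" using idem_comm[OF E] by simp
    qed
    show ?thesis unfolding mem_germ[OF s] mem_germ[OF t] using *[of _ t s] *[of _ s t] e by metis
  qed
  then show "germ m s \<xi> = germ m t \<eta>" by auto
qed

lemma DsetI: "x \<in> tight m \<Longrightarrow> e \<in> x \<Longrightarrow> x \<in> Dset m e"
  by (simp add: Dset_def)

lemma germ_eqI:
  assumes "x \<in> tight m" "st s \<odot> s \<in> x" "st t \<odot> t \<in> x" "e \<in> x" "s \<odot> e = t \<odot> e"
  shows "germ m s x = germ m t x"
  using germ_eq_iff[OF DsetI[OF assms(1,2)] DsetI[OF assms(1,3)]] assms by blast

lemma germ_eqD:
  assumes "x \<in> tight m" "st s \<odot> s \<in> x" "y \<in> tight m" "st t \<odot> t \<in> y" "germ m s x = germ m t y"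
  shows "x = y \<and> (\<exists>e\<in>x. s \<odot> e = t \<odot> e)"
  using germ_eq_iff[OF DsetI[OF assms(1,2)] DsetI[OF assms(3,4)]] assms by blast

lemma GtE:
  assumes "\<gamma> \<in> Gt m"
  obtains s x where "x \<in> tight m" "st s \<odot> s \<in> x" "\<gamma> = germ m s x"
  using assms by (auto simp: Gt_def Dset_def)

lemma germ_Gt: "x \<in> tight m \<Longrightarrow> st s \<odot> s \<in> x \<Longrightarrow> germ m s x \<in> Gt m"
  by (auto simp: Gt_def Dset_def)

lemma gdom_germ: "x \<in> tight m \<Longrightarrow> st s \<odot> s \<in> x \<Longrightarrow> gdom m (germ m s x) = x"
  unfolding gdom_def using germ_eqD by (intro the_equality) (auto simp: Dset_def)

lemma conj_theta: assumes "is_filter m x" "e \<in> x" shows "s \<odot> e \<odot> st s \<in> theta m s x"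
proof -
  have e: "s \<odot> e \<odot> st s \<in> E" using filter_idem[OF assms] by simp
  then have "leq m (s \<odot> e \<odot> st s) (s \<odot> e \<odot> st s)" by (simp add: leq_def idem_dup(1))
  then show ?thesis using e assms(2) unfolding theta_def by blast
qed

text \<open>The description by \<open>THE\<close> is consistent because representatives that agree
  on \<open>e\<close> have inverses that agree on the conjugate
  \<open>s \<odot> e \<odot> st s\<close>, a member of the range filter.\<close>

lemma ginv_germ:
  assumes x: "x \<in> tight m" "st s \<odot> s \<in> x"
  shows "ginv m (germ m s x) = germ m (st s) (theta m s x)"
  unfolding ginv_def
proof (rule the_equality)
  show "\<exists>s' \<xi>. \<xi> \<in> Dset m (st s' \<odot> s') \<and> germ m s x = germ m s' \<xi> \<and> germ m (st s) (theta m s x) = germ m (st s') (theta m s' \<xi>)"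
    using x by (auto simp: Dset_def)
  fix \<delta> assume "\<exists>s' \<xi>. \<xi> \<in> Dset m (st s' \<odot> s') \<and> germ m s x = germ m s' \<xi> \<and> \<delta> = germ m (st s') (theta m s' \<xi>)"
  then obtain t \<xi> where t: "\<xi> \<in> tight m" "st t \<odot> t \<in> \<xi>" "germ m s x = germ m t \<xi>" "\<delta> = germ m (st t) (theta m t \<xi>)"
    by (auto simp: Dset_def)
  obtain e where e: "x = \<xi>" "e \<in> x" "s \<odot> e = t \<odot> e" using germ_eqD[OF x t(1-3)] by blast
  have f: "is_filter m x" using x tight_filter by blast
  have tx: "st t \<odot> t \<in> x" using t e by simp
  have eE: "e \<in> E" using filter_idem f e by blast
  have th: "theta m s x = theta m t x" using theta_cong[OF f x(2) tx e(2,3)] .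
  have es: "e \<odot> st s = e \<odot> st t" using arg_cong[OF e(3), of st] by (simp add: star_idem[OF eE])
  let ?g = "s \<odot> e \<odot> st s"
  have g: "?g = t \<odot> e \<odot> st t" using e(3) es by (simp add: assoc)
  have *: "st u \<odot> (u \<odot> e \<odot> st u) = e \<odot> st u" for u
  proof -
    have "st u \<odot> (u \<odot> e \<odot> st u) = (st u \<odot> u \<odot> e) \<odot> st u" by (simp add: assoc)
    also have "\<dots> = (e \<odot> (st u \<odot> u)) \<odot> st u" using idem_comm[OF eE star_mult_idem(1)[of u]] by simp
    finally show ?thesis by (simp add: assoc star_inv')
  qed
  have "st s \<odot> ?g = st t \<odot> ?g" using *[of s] *[of t] es unfolding g[symmetric] by simp
  moreover have "?g \<in> theta m s x" using conj_theta[OF f e(2)] .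
  ultimately have "germ m (st s) (theta m s x) = germ m (st t) (theta m s x)"
    using theta_tight[OF x] star_dom[OF f x(2)] star_dom[OF f tx] th by (intro germ_eqI[of _ _ _ ?g]) auto
  then show "\<delta> = germ m (st s) (theta m s x)" using t(4) e(1) th by simp
qed

text \<open>Independence of representatives: if \<open>e\<close> equates \<open>s\<close> and
  \<open>s'\<close>, and \<open>f\<close> equates \<open>t\<close> and \<open>t'\<close>, then
  \<open>e\<close> times the pullback of \<open>f\<close> along \<open>s\<close> equates the two
  products.\<close>

lemma gprod_germ:
  assumes x: "x \<in> tight m" "st s \<odot> s \<in> x" and t: "st t \<odot> t \<in> theta m s x"
  shows "gprod m (germ m t (theta m s x)) (germ m s x) = germ m (t \<odot> s) x"
  unfolding gprod_def
proof (rule the_equality)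
  have th: "theta m s x \<in> tight m" using theta_tight[OF x] .
  show "\<exists>s' t' \<xi>. \<xi> \<in> Dset m (st s' \<odot> s') \<and> germ m s x = germ m s' \<xi> \<and> theta m s' \<xi> \<in> Dset m (st t' \<odot> t') \<and>
      germ m t (theta m s x) = germ m t' (theta m s' \<xi>) \<and> germ m (t \<odot> s) x = germ m (t' \<odot> s') \<xi>"
    using x t th by (intro exI[of _ s] exI[of _ t] exI[of _ x]) (auto simp: Dset_def)
  fix \<delta> assume "\<exists>s' t' \<xi>. \<xi> \<in> Dset m (st s' \<odot> s') \<and> germ m s x = germ m s' \<xi> \<and> theta m s' \<xi> \<in> Dset m (st t' \<odot> t') \<and>
      germ m t (theta m s x) = germ m t' (theta m s' \<xi>) \<and> \<delta> = germ m (t' \<odot> s') \<xi>"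
  then obtain s' t' \<xi> where a: "\<xi> \<in> tight m" "st s' \<odot> s' \<in> \<xi>" "germ m s x = germ m s' \<xi>"
      "theta m s' \<xi> \<in> tight m" "st t' \<odot> t' \<in> theta m s' \<xi>"
      "germ m t (theta m s x) = germ m t' (theta m s' \<xi>)" "\<delta> = germ m (t' \<odot> s') \<xi>"
    by (auto simp: Dset_def)
  obtain e where e: "x = \<xi>" "e \<in> x" "s \<odot> e = s' \<odot> e" using germ_eqD[OF x a(1-3)] by blast
  obtain f where f: "theta m s x = theta m s' \<xi>" "f \<in> theta m s x" "t \<odot> f = t' \<odot> f"
    using germ_eqD[OF th t a(4-6)] by blast
  have fx: "is_filter m x" using x tight_filter by blast
  have E: "f \<in> E" "st s \<odot> f \<odot> s \<in> x" using f(2) theta_dom_iff[OF fx x(2)] by auto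
  have eE: "e \<in> E" "st s \<odot> f \<odot> s \<in> E" using filter_idem fx e E by blast+
  let ?g = "e \<odot> (st s \<odot> f \<odot> s)"
  have g: "?g \<in> x" using filter_mult[OF fx e(2) E(2)] .
  have sg: "s \<odot> ?g = f \<odot> (s \<odot> e)"
  proof -
    have "s \<odot> ?g = s \<odot> (st s \<odot> f \<odot> s \<odot> e)" using idem_comm[OF eE] by simp
    also have "\<dots> = (f \<odot> s) \<odot> e" using idem_slide'[OF E(1), of s] assoc[of s "st s \<odot> f \<odot> s" e] by simp
    finally show ?thesis by (simp add: assoc)
  qed
  have sg': "s' \<odot> ?g = s \<odot> ?g" using e(3) by (simp flip: assoc)
  have "t \<odot> s \<odot> ?g = t \<odot> f \<odot> (s \<odot> e)" using sg by (simp add: assoc)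
  also have "\<dots> = t' \<odot> s' \<odot> ?g" using f(3) sg sg' assoc[of t' f "s \<odot> e"] assoc[of t' s' ?g] by simp
  finally have "t \<odot> s \<odot> ?g = t' \<odot> s' \<odot> ?g" .
  moreover have "st (t \<odot> s) \<odot> (t \<odot> s) \<in> x" using mult_dom[OF fx x(2) t] .
  moreover have "st (t' \<odot> s') \<odot> (t' \<odot> s') \<in> x" using mult_dom[of \<xi> s' t'] a fx e(1) by blast
  ultimately have "germ m (t \<odot> s) x = germ m (t' \<odot> s') x" using x(1) g by (intro germ_eqI) auto
  then show "\<delta> = germ m (t \<odot> s) x" using a(7) e(1) by simp
qed

section \<open>Groupoid structure through division inside a source fibre\<close>

definition fibre :: "'a set \<Rightarrow> 'a germ set" where "fibre x = {\<gamma> \<in> Gt m. gdom m \<gamma> = x}"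
text \<open>The quotient \<gamma> \<alpha>^{-1} of two elements with the same source. The matrix of
  the regular representation has the entries \<open>f (gdiv \<gamma> \<alpha>)\<close>, so this
  total binary operation on a fibre serves better than the partial product.\<close>

definition gdiv :: "'a germ \<Rightarrow> 'a germ \<Rightarrow> 'a germ" where "gdiv \<gamma> \<alpha> = gprod m \<gamma> (ginv m \<alpha>)"
definition grange :: "'a germ \<Rightarrow> 'a set" where "grange \<gamma> = gdom m (ginv m \<gamma>)"

lemma fibreE:
  assumes "\<gamma> \<in> fibre x"
  obtains s where "x \<in> tight m" "st s \<odot> s \<in> x" "\<gamma> = germ m s x"
  using assms gdom_germ by (auto simp: fibre_def elim!: GtE)

lemma germ_fibre: "x \<in> tight m \<Longrightarrow> st s \<odot> s \<in> x \<Longrightarrow> germ m s x \<in> fibre x"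
  by (simp add: fibre_def germ_Gt gdom_germ)

lemma Gt_fibre: "\<gamma> \<in> Gt m \<Longrightarrow> \<gamma> \<in> fibre (gdom m \<gamma>)" "\<gamma> \<in> fibre x \<Longrightarrow> \<gamma> \<in> Gt m" "\<gamma> \<in> fibre x \<Longrightarrow> gdom m \<gamma> = x"
  by (simp_all add: fibre_def)

lemma fibre_tight: "\<gamma> \<in> fibre x \<Longrightarrow> x \<in> tight m"
  by (elim fibreE)

lemma star_dom': "x \<in> tight m \<Longrightarrow> st s \<odot> s \<in> x \<Longrightarrow> s \<odot> st s \<in> theta m s x"
  using star_dom tight_filter by blast

lemma grange_germ: "x \<in> tight m \<Longrightarrow> st s \<odot> s \<in> x \<Longrightarrow> grange (germ m s x) = theta m s x"
  unfolding grange_def by (simp add: ginv_germ gdom_germ theta_tight star_dom')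

lemma gdiv_dom:
  assumes "x \<in> tight m" "st s \<odot> s \<in> x" "st t \<odot> t \<in> x"
  shows "st (t \<odot> st s) \<odot> (t \<odot> st s) \<in> theta m s x"
proof -
  have f: "is_filter m x" using assms tight_filter by blast
  have "st t \<odot> t \<in> theta m (st s) (theta m s x)" using theta_inverse[OF f] assms by simp
  then show ?thesis using mult_dom[OF theta_filter[OF f assms(2)], of "st s" t] star_dom[OF f assms(2)] by simp
qed

lemma gdiv_germ:
  assumes "x \<in> tight m" "st s \<odot> s \<in> x" "st t \<odot> t \<in> x"
  shows "gdiv (germ m t x) (germ m s x) = germ m (t \<odot> st s) (theta m s x)"
proof -
  have f: "is_filter m x" using assms tight_filter by blast
  have i: "theta m (st s) (theta m s x) = x" using theta_inverse[OF f assms(2)] .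
  show ?thesis unfolding gdiv_def ginv_germ[OF assms(1,2)]
    using gprod_germ[OF theta_tight[OF assms(1,2)], of "st s" t] star_dom[OF f assms(2)] assms(3) i by simp
qed

lemma gdiv_fibre: assumes "\<gamma> \<in> fibre x" "\<alpha> \<in> fibre x" shows "gdiv \<gamma> \<alpha> \<in> fibre (grange \<alpha>)"
  using assms
  by (auto elim!: fibreE simp: gdiv_germ grange_germ gdiv_dom theta_tight simp del: star_mult intro!: germ_fibre)

lemma theta_mult_idem:
  assumes "is_filter m x" "st s \<odot> s \<in> x" "e \<in> x"
  shows "theta m (s \<odot> e) x = theta m s x"
proof -
  have e: "theta m e x = x" using theta_idem assms by blast
  have eE: "e \<in> E" using filter_idem assms by blast
  then show ?thesis using theta_theta[of x e s] assms e by (simp add: star_idem idem_dup)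
qed

lemma theta_dv:
  assumes "x \<in> tight m" "st s \<odot> s \<in> x" "st t \<odot> t \<in> x"
  shows "theta m (t \<odot> st s) (theta m s x) = theta m t x"
proof -
  have f: "is_filter m x" using assms tight_filter by blast
  have "theta m (t \<odot> st s) (theta m s x) = theta m (t \<odot> (st s \<odot> s)) x"
    using theta_theta[OF f assms(2) gdiv_dom[OF assms]] by (simp add: assoc)
  then show ?thesis using theta_mult_idem[OF f assms(3,2)] by simp
qed

lemma grange_dv: assumes "\<gamma> \<in> fibre x" "\<alpha> \<in> fibre x" shows "grange (gdiv \<gamma> \<alpha>) = grange \<gamma>"
  using assms
  by (auto elim!: fibreE simp: gdiv_germ grange_germ gdiv_dom theta_tight theta_dv simp del: star_mult)

text \<open>Cancellation of the common right factor. It carries the groupoid associativity needed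
  later: bijectivity of right translation and the matrix form of convolution both rest on
  it.\<close>

lemma gdiv_dv:
  assumes "\<gamma> \<in> fibre x" "\<alpha> \<in> fibre x" "\<beta> \<in> fibre x"
  shows "gdiv (gdiv \<gamma> \<beta>) (gdiv \<alpha> \<beta>) = gdiv \<gamma> \<alpha>"
proof -
  obtain t where t: "x \<in> tight m" "st t \<odot> t \<in> x" "\<gamma> = germ m t x" using assms fibreE by metis
  obtain s where s: "st s \<odot> s \<in> x" "\<alpha> = germ m s x" using assms fibreE by metis
  obtain u where u: "st u \<odot> u \<in> x" "\<beta> = germ m u x" using assms fibreE by metis
  have f: "is_filter m x" using t tight_filter by blast
  let ?a = "st u \<odot> u" and ?b = "st s \<odot> s"
  have "gdiv (gdiv \<gamma> \<beta>) (gdiv \<alpha> \<beta>) = germ m (t \<odot> st u \<odot> st (s \<odot> st u)) (theta m (s \<odot> st u) (theta m u x))"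
    using t s u by (simp add: gdiv_germ gdiv_dom theta_tight del: star_mult)
  also have "\<dots> = germ m (t \<odot> st u \<odot> st (s \<odot> st u)) (theta m s x)" using theta_dv t s u by simp
  also have "\<dots> = germ m (t \<odot> st s) (theta m s x)"
  proof (rule germ_eqI)
    show "theta m s x \<in> tight m" using theta_tight t s by blast
    show "st (t \<odot> st s) \<odot> (t \<odot> st s) \<in> theta m s x" using gdiv_dom t s by blast
    have "st (t \<odot> st u \<odot> st (s \<odot> st u)) \<odot> (t \<odot> st u \<odot> st (s \<odot> st u)) \<in> theta m (s \<odot> st u) (theta m u x)"
      using gdiv_dom[OF theta_tight[OF t(1) u(1)] gdiv_dom[OF t(1) u(1) s(1)] gdiv_dom[OF t(1) u(1) t(2)]] .
    then show "st (t \<odot> st u \<odot> st (s \<odot> st u)) \<odot> (t \<odot> st u \<odot> st (s \<odot> st u)) \<in> theta m s x"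
      using theta_dv t s u by simp
    \<comment> \<open>The two representatives agree on this conjugate, because the domain
      idempotents of \<open>u\<close> and \<open>s\<close> commute and absorb each other's
      repetitions.\<close>
    show "s \<odot> ?a \<odot> st s \<in> theta m s x" using conj_theta[OF f u(1)] .
    have ab: "?a \<odot> ?b = ?b \<odot> ?a" by (simp add: idem_comm)
    have "t \<odot> st u \<odot> st (s \<odot> st u) \<odot> (s \<odot> ?a \<odot> st s) = t \<odot> (?a \<odot> ?b) \<odot> ?a \<odot> st s" by (simp add: assoc)
    also have "\<dots> = t \<odot> (?b \<odot> (?a \<odot> ?a)) \<odot> st s" unfolding ab by (simp only: assoc)
    also have "\<dots> = t \<odot> st s \<odot> (s \<odot> ?a \<odot> st s)" by (simp add: idem_dup(1)) (simp add: assoc)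
    finally show "t \<odot> st u \<odot> st (s \<odot> st u) \<odot> (s \<odot> ?a \<odot> st s) = t \<odot> st s \<odot> (s \<odot> ?a \<odot> st s)" .
  qed
  also have "\<dots> = gdiv \<gamma> \<alpha>" using t s gdiv_germ by simp
  finally show ?thesis .
qed

lemma ginv_dv: assumes "\<gamma> \<in> fibre x" "\<alpha> \<in> fibre x" shows "ginv m (gdiv \<gamma> \<alpha>) = gdiv \<alpha> \<gamma>"
proof -
  obtain t where t: "x \<in> tight m" "st t \<odot> t \<in> x" "\<gamma> = germ m t x" using assms fibreE by metis
  obtain s where s: "st s \<odot> s \<in> x" "\<alpha> = germ m s x" using assms fibreE by metis
  have "ginv m (gdiv \<gamma> \<alpha>) = germ m (st (t \<odot> st s)) (theta m (t \<odot> st s) (theta m s x))"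
    using t s gdiv_germ ginv_germ theta_tight gdiv_dom by (simp del: star_mult)
  then show ?thesis using t s theta_dv gdiv_germ by simp
qed

lemma gunit_eq: assumes "x \<in> tight m" "e \<in> x" shows "gunit m x = germ m e x"
proof -
  let ?f = "SOME e. e \<in> x"
  have f: "?f \<in> x" using assms(2) by (rule someI)
  have x: "is_filter m x" using assms tight_filter by blast
  have E: "e \<in> E" "?f \<in> E" using filter_idem[OF x] f assms(2) by blast+
  have "?f \<odot> (e \<odot> ?f) = e \<odot> (e \<odot> ?f)" 
    using idem_lcomm[OF E(2,1), of ?f] idem_dup(1)[OF E(2)] idem_dup(2)[OF E(1)] by simp
  then show ?thesis unfolding gunit_def
    using assms f E filter_mult[OF x assms(2) f] by (intro germ_eqI[of _ _ _ "e \<odot> ?f"]) (auto simp: star_idem idem_dup)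
qed

lemma tight_ex: assumes "x \<in> tight m" obtains e where "e \<in> x" "e \<in> E" "st e \<odot> e \<in> x" "st e = e"
proof -
  have f: "is_filter m x" using assms tight_filter by blast
  then obtain e where e: "e \<in> x" unfolding filter_iff by blast
  then have "e \<in> E" using filter_idem f by blast
  then show ?thesis using that[of e] e by (simp add: star_idem idem_dup)
qed

lemma gunit_fibre: assumes "x \<in> tight m" shows "gunit m x \<in> fibre x"
  using tight_ex[OF assms] gunit_eq germ_fibre assms by metis

lemma grange_gunit: assumes "x \<in> tight m" shows "grange (gunit m x) = x"
  using tight_ex[OF assms] gunit_eq[OF assms] grange_germ[OF assms] theta_idem[OF tight_filter[OF assms]] by metis

lemma gdiv_gunit: assumes "\<gamma> \<in> fibre x" shows "gdiv \<gamma> (gunit m x) = \<gamma>"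
proof -
  obtain t where t: "x \<in> tight m" "st t \<odot> t \<in> x" "\<gamma> = germ m t x" using assms fibreE by metis
  obtain e where e: "e \<in> x" "e \<in> E" "st e \<odot> e \<in> x" "st e = e" using tight_ex[OF t(1)] .
  have f: "is_filter m x" using t tight_filter by blast
  have th: "theta m e x = x" using theta_idem f e by blast
  have "gdiv \<gamma> (gunit m x) = germ m (t \<odot> e) x"
    using gdiv_germ[OF t(1) e(3) t(2)] gunit_eq[OF t(1) e(1)] t e th by simp
  also have "\<dots> = germ m t x"
    using t e gdiv_dom[OF t(1) e(3) t(2)] th by (intro germ_eqI[of _ _ _ e]) (auto simp: assoc idem_dup)
  finally show ?thesis using t by simp
qed

lemma gunit_dv: assumes "\<gamma> \<in> fibre x" shows "gdiv (gunit m x) \<gamma> = ginv m \<gamma>"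
proof -
  have x: "x \<in> tight m" using assms fibre_tight by blast
  show ?thesis using ginv_dv[OF assms gunit_fibre[OF x]] gdiv_gunit[OF assms] by simp
qed

lemma grange_tight: "\<gamma> \<in> fibre x \<Longrightarrow> grange \<gamma> \<in> tight m"
  by (auto elim!: fibreE simp: grange_germ theta_tight)

lemma ginv_fibre: assumes "\<gamma> \<in> fibre x" shows "ginv m \<gamma> \<in> fibre (grange \<gamma>)"
  using gdiv_fibre[OF gunit_fibre[OF fibre_tight[OF assms]] assms] gunit_dv[OF assms] by simp

lemma grange_ginv: assumes "\<gamma> \<in> fibre x" shows "grange (ginv m \<gamma>) = x"
  using grange_dv[OF gunit_fibre[OF fibre_tight[OF assms]] assms] gunit_dv[OF assms] grange_gunit[OF fibre_tight[OF assms]] by simp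

lemma ginv_ginv: assumes "\<gamma> \<in> fibre x" shows "ginv m (ginv m \<gamma>) = \<gamma>"
  using ginv_dv[OF gunit_fibre[OF fibre_tight[OF assms]] assms] gunit_dv[OF assms] gdiv_gunit[OF assms] by simp

text \<open>Right translation by the inverse of \<open>\<beta>\<close>; translation by
  \<open>\<beta>\<close> itself, written as division by \<open>ginv m \<beta>\<close>, is the
  inverse map. It is used to reindex convolution sums from one fibre to another.\<close>

lemma gdiv_bij: assumes "\<beta> \<in> fibre x" shows "bij_betw (\<lambda>\<alpha>. gdiv \<alpha> \<beta>) (fibre x) (fibre (grange \<beta>))"
proof -
  have x: "x \<in> tight m" using assms fibre_tight by blast
  have u: "gunit m x \<in> fibre x" using gunit_fibre[OF x] .
  have "inj_on (\<lambda>\<alpha>. gdiv \<alpha> \<beta>) (fibre x)"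
  proof (rule inj_onI)
    fix \<alpha> \<alpha>' assume a: "\<alpha> \<in> fibre x" "\<alpha>' \<in> fibre x" "gdiv \<alpha> \<beta> = gdiv \<alpha>' \<beta>"
    have "\<alpha> = gdiv (gdiv \<alpha> \<beta>) (gdiv (gunit m x) \<beta>)" using gdiv_dv[OF a(1) u assms] gdiv_gunit[OF a(1)] by simp
    also have "\<dots> = gdiv (gdiv \<alpha>' \<beta>) (gdiv (gunit m x) \<beta>)" by (simp only: a(3))
    also have "\<dots> = \<alpha>'" using gdiv_dv[OF a(2) u assms] gdiv_gunit[OF a(2)] by simp
    finally show "\<alpha> = \<alpha>'" .
  qed
  moreover have "(\<lambda>\<alpha>. gdiv \<alpha> \<beta>) ` fibre x = fibre (grange \<beta>)"
  proof
    show "(\<lambda>\<alpha>. gdiv \<alpha> \<beta>) ` fibre x \<subseteq> fibre (grange \<beta>)" using gdiv_fibre assms by blast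
    show "fibre (grange \<beta>) \<subseteq> (\<lambda>\<alpha>. gdiv \<alpha> \<beta>) ` fibre x"
    proof
      fix \<gamma> assume g: "\<gamma> \<in> fibre (grange \<beta>)"
      have i: "ginv m \<beta> \<in> fibre (grange \<beta>)" "grange (ginv m \<beta>) = x" using ginv_fibre grange_ginv assms by auto
      have v: "gunit m (grange \<beta>) \<in> fibre (grange \<beta>)" using gunit_fibre grange_tight assms by blast
      have "gdiv (gdiv \<gamma> (ginv m \<beta>)) (gdiv (gunit m (grange \<beta>)) (ginv m \<beta>)) = gdiv \<gamma> (gunit m (grange \<beta>))"
        using gdiv_dv[OF g v i(1)] .
      then have "gdiv (gdiv \<gamma> (ginv m \<beta>)) \<beta> = \<gamma>"
        using gunit_dv[OF i(1)] ginv_ginv[OF assms] gdiv_gunit[OF g] by simp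
      moreover have "gdiv \<gamma> (ginv m \<beta>) \<in> fibre x" using gdiv_fibre[OF g i(1)] i(2) by simp
      ultimately show "\<gamma> \<in> (\<lambda>\<alpha>. gdiv \<alpha> \<beta>) ` fibre x" by (metis imageI)
    qed
  qed
  ultimately show ?thesis by (simp add: bij_betw_def)
qed

lemma gdiv_self: assumes "\<gamma> \<in> fibre x" shows "gdiv \<gamma> \<gamma> = gunit m (grange \<gamma>)"
proof -
  obtain t where t: "x \<in> tight m" "st t \<odot> t \<in> x" "\<gamma> = germ m t x" using assms fibreE by metis
  have "gunit m (theta m t x) = germ m (t \<odot> st t) (theta m t x)"
    using gunit_eq[OF theta_tight star_dom'] t by blast
  then show ?thesis using t gdiv_germ grange_germ by simp
qed

lemma gdiv_inj: "\<gamma> \<in> fibre x \<Longrightarrow> \<gamma>' \<in> fibre x \<Longrightarrow> \<beta> \<in> fibre x \<Longrightarrow> gdiv \<gamma> \<beta> = gdiv \<gamma>' \<beta> \<longleftrightarrow> \<gamma> = \<gamma>'"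
  using gdiv_bij unfolding bij_betw_def inj_on_def by blast

end

section \<open>Bounded functions on the groupoid\<close>

text \<open>Together with the next lemma it reduces the integral over the counting measure in
  \<open>rnorm2\<close> to finite partial sums.\<close>

lemma nn_integral_count_space_le:
  fixes f :: "'b \<Rightarrow> real"
  assumes pos: "\<And>x. f x \<ge> 0" and c: "c \<ge> 0"
    and bd: "\<And>F. finite F \<Longrightarrow> F \<subseteq> A \<Longrightarrow> sum f F \<le> c"
  shows "(\<integral>\<^sup>+x. ennreal (f x) \<partial>count_space A) \<le> ennreal c"
proof -
  have sm: "f summable_on A"
    using pos bd by (intro nonneg_bdd_above_summable_on bdd_aboveI[of _ c]) auto
  then have "(\<lambda>x. norm (f x)) summable_on A" using pos by simp
  then have ab: "Infinite_Set_Sum.abs_summable_on f A" using abs_summable_equivalent by blast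
  have "(\<integral>\<^sup>+x. ennreal (f x) \<partial>count_space A) = ennreal (infsetsum f A)"
    using nn_integral_conv_infsetsum[OF ab] pos by simp
  also have "infsetsum f A = infsum f A" using infsetsum_infsum[OF ab] .
  also have "infsum f A \<le> c" using sm bd by (intro infsum_le_finite_sums) auto
  finally show ?thesis by (simp add: ennreal_leI)
qed

lemma sum_le_nn_integral_count_space:
  fixes f :: "'b \<Rightarrow> real"
  assumes pos: "\<And>x. f x \<ge> 0" and F: "finite F" "F \<subseteq> A"
  shows "ennreal (sum f F) \<le> (\<integral>\<^sup>+x. ennreal (f x) \<partial>count_space A)"
proof -
  have "ennreal (sum f F) = (\<Sum>x\<in>F. ennreal (f x) * indicator F x)"
    using pos by (simp flip: sum_ennreal)
  also have "\<dots> = (\<integral>\<^sup>+x. ennreal (f x) * indicator F x \<partial>count_space A)"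
    using F by (intro nn_integral_count_space'[symmetric]) auto
  also have "\<dots> \<le> (\<integral>\<^sup>+x. ennreal (f x) \<partial>count_space A)"
    by (intro nn_integral_mono) (auto simp: indicator_def)
  finally show ?thesis .
qed

section \<open>Norm bounds through matrix coefficients on finite subsets of a fibre\<close>

abbreviation l2 :: "('i \<Rightarrow> complex) \<Rightarrow> 'i set \<Rightarrow> real" where
  "l2 f A \<equiv> L2_set (\<lambda>i. cmod (f i)) A"

lemma L2_set_sq: "(L2_set f A)\<^sup>2 = (\<Sum>i\<in>A. (f i)\<^sup>2)"
  by (simp add: L2_set_def sum_nonneg)

lemma norm_sum_mult_le_L2:
  fixes f g :: "'i \<Rightarrow> complex"
  shows "cmod (\<Sum>i\<in>A. f i * g i) \<le> l2 f A * l2 g A"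
proof -
  have "cmod (\<Sum>i\<in>A. f i * g i) \<le> (\<Sum>i\<in>A. \<bar>cmod (f i)\<bar> * \<bar>cmod (g i)\<bar>)"
    by (rule order_trans[OF norm_sum]) (simp add: norm_mult)
  also have "\<dots> \<le> l2 f A * l2 g A"
    by (rule L2_set_mult_ineq)
  finally show ?thesis .
qed

lemma has_sum_diff_complex:
  fixes f g :: "'i \<Rightarrow> complex"
  assumes "(f has_sum a) A" "(g has_sum b) A"
  shows "((\<lambda>i. f i - g i) has_sum (a - b)) A"
  using has_sum_add[OF assms(1) has_sum_cmult_right[OF assms(2), of "-1"]] by simp

lemma has_sum_sum_complex:
  fixes f :: "'j \<Rightarrow> 'i \<Rightarrow> complex"
  assumes "finite J" "\<And>j. j \<in> J \<Longrightarrow> (f j has_sum a j) A"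
  shows "((\<lambda>i. \<Sum>j\<in>J. f j i) has_sum (\<Sum>j\<in>J. a j)) A"
  using assms by (induction J rule: finite_induct) (auto intro!: has_sum_add)

context inverse_semigroup_zero
begin

abbreviation bform :: "('a germ \<Rightarrow> complex) \<Rightarrow> ('a germ \<Rightarrow> complex) \<Rightarrow> ('a germ \<Rightarrow> complex) \<Rightarrow> 'a germ set \<Rightarrow> 'a germ set \<Rightarrow> complex" where
  "bform f w v A F \<equiv> \<Sum>\<gamma>\<in>A. \<Sum>\<alpha>\<in>F. w \<gamma> * f (gdiv \<gamma> \<alpha>) * v \<alpha>"

text \<open>The bilinear form of the regular representation at \<open>x\<close>, tested on finitely supported vectors.
  Writing the operator bound this way makes sums, adjoints and pointwise limits immediate.\<close>
definition op_bound :: "('a germ \<Rightarrow> complex) \<Rightarrow> real \<Rightarrow> bool" where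
  "op_bound f r \<longleftrightarrow> 0 \<le> r \<and> (\<forall>x A F v w. finite A \<longrightarrow> finite F \<longrightarrow> A \<subseteq> fibre x \<longrightarrow> F \<subseteq> fibre x \<longrightarrow>
     cmod (bform f w v A F)
       \<le> r * l2 w A * l2 v F)"

lemma op_boundI:
  assumes "0 \<le> r" "\<And>x A F v w. finite A \<Longrightarrow> finite F \<Longrightarrow> A \<subseteq> fibre x \<Longrightarrow> F \<subseteq> fibre x \<Longrightarrow>
     cmod (bform f w v A F)
       \<le> r * l2 w A * l2 v F"
  shows "op_bound f r"
  using assms unfolding op_bound_def by blast

lemma op_boundD:
  assumes "op_bound f r" "finite A" "finite F" "A \<subseteq> fibre x" "F \<subseteq> fibre x"
  shows "cmod (bform f w v A F)
       \<le> r * l2 w A * l2 v F"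
  using assms unfolding op_bound_def by blast

lemma op_bound_nonneg: "op_bound f r \<Longrightarrow> 0 \<le> r"
  by (simp add: op_bound_def)

lemma op_bound_mono: assumes "op_bound f r" "r \<le> s" shows "op_bound f s"
proof (rule op_boundI)
  show "0 \<le> s" using op_bound_nonneg assms by force
  fix x A F and v w :: "'a germ \<Rightarrow> complex"
  assume a: "finite A" "finite F" "A \<subseteq> fibre x" "F \<subseteq> fibre x"
  have "r * l2 w A * l2 v F
     \<le> s * l2 w A * l2 v F"
    using assms(2) by (intro mult_right_mono) (auto simp: L2_set_nonneg)
  then show "cmod (bform f w v A F)
       \<le> s * l2 w A * l2 v F"
    using op_boundD[OF assms(1) a] order_trans by blast
qed

lemma op_bound_add: assumes "op_bound f r" "op_bound g s" shows "op_bound (\<lambda>\<gamma>. f \<gamma> + g \<gamma>) (r + s)"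
proof (rule op_boundI)
  show "0 \<le> r + s" using op_bound_nonneg assms by (simp add: add_nonneg_nonneg)
  fix x A F and v w :: "'a germ \<Rightarrow> complex"
  assume a: "finite A" "finite F" "A \<subseteq> fibre x" "F \<subseteq> fibre x"
  have "(\<Sum>\<gamma>\<in>A. \<Sum>\<alpha>\<in>F. w \<gamma> * (f (gdiv \<gamma> \<alpha>) + g (gdiv \<gamma> \<alpha>)) * v \<alpha>) =
     (bform f w v A F) + (bform g w v A F)"
    by (simp add: algebra_simps sum.distrib)
  then show "cmod (\<Sum>\<gamma>\<in>A. \<Sum>\<alpha>\<in>F. w \<gamma> * (f (gdiv \<gamma> \<alpha>) + g (gdiv \<gamma> \<alpha>)) * v \<alpha>)
       \<le> (r + s) * l2 w A * l2 v F"
    using norm_triangle_mono[OF op_boundD[OF assms(1) a, of w v] op_boundD[OF assms(2) a, of w v]] by (simp add: ring_distribs)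
qed

lemma op_bound_scale: assumes "op_bound f r" shows "op_bound (\<lambda>\<gamma>. c * f \<gamma>) (cmod c * r)"
proof (rule op_boundI)
  show "0 \<le> cmod c * r" using op_bound_nonneg assms by simp
  fix x A F and v w :: "'a germ \<Rightarrow> complex"
  assume a: "finite A" "finite F" "A \<subseteq> fibre x" "F \<subseteq> fibre x"
  have "(\<Sum>\<gamma>\<in>A. \<Sum>\<alpha>\<in>F. w \<gamma> * (c * f (gdiv \<gamma> \<alpha>)) * v \<alpha>) =
     c * (bform f w v A F)"
    by (simp add: sum_distrib_left mult_ac)
  then show "cmod (\<Sum>\<gamma>\<in>A. \<Sum>\<alpha>\<in>F. w \<gamma> * (c * f (gdiv \<gamma> \<alpha>)) * v \<alpha>)
       \<le> (cmod c * r) * l2 w A * l2 v F"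
    using mult_left_mono[OF op_boundD[OF assms a, of w v], of "cmod c"] by (simp add: norm_mult mult.assoc)
qed

lemma op_bound_diff: assumes "op_bound f r" "op_bound g s" shows "op_bound (\<lambda>\<gamma>. f \<gamma> - g \<gamma>) (r + s)"
  using op_bound_add[OF assms(1) op_bound_scale[OF assms(2), of "-1"]] by simp

lemma op_bound_0: "op_bound (\<lambda>_. 0) 0"
  by (rule op_boundI) auto

text \<open>\<open>f \<gamma>\<close> is the matrix entry between \<open>\<gamma>\<close> and the
  unit of its fibre. Hence convergence in norm implies pointwise convergence on the
  groupoid.\<close>

lemma op_bound_point: assumes "op_bound f r" "\<gamma> \<in> Gt m" shows "cmod (f \<gamma>) \<le> r"
proof -
  let ?x = "gdom m \<gamma>"
  have g: "\<gamma> \<in> fibre ?x" using Gt_fibre assms by blast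
  have u: "gunit m ?x \<in> fibre ?x" using gunit_fibre fibre_tight g by blast
  show ?thesis using op_boundD[OF assms(1), of "{\<gamma>}" "{gunit m ?x}" ?x "\<lambda>_. 1" "\<lambda>_. 1"] g u gdiv_gunit[OF g] by simp
qed

lemma L2_le_of_sq:
  assumes "a\<^sup>2 \<le> r * a * b" "0 \<le> a" "0 \<le> r" "0 \<le> b" shows "a \<le> r * (b::real)"
proof (cases "a = 0")
  case False
  then have "a * a \<le> (r * b) * a" "0 < a" using assms by (auto simp: power2_eq_square mult_ac)
  then show ?thesis by (simp add: mult_le_cancel_right)
qed (use assms in simp)

text \<open>Duality: testing the form against the conjugate of the image vector turns the bound on
  the form into a bound on the norm of each finite piece of the image.\<close>

lemma op_bound_col:
  assumes "op_bound f r" "finite A" "finite F" "A \<subseteq> fibre x" "F \<subseteq> fibre x"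
  shows "L2_set (\<lambda>\<gamma>. cmod (\<Sum>\<alpha>\<in>F. f (gdiv \<gamma> \<alpha>) * v \<alpha>)) A \<le> r * l2 v F"
proof -
  let ?u = "\<lambda>\<gamma>. \<Sum>\<alpha>\<in>F. f (gdiv \<gamma> \<alpha>) * v \<alpha>"
  have "(\<Sum>\<gamma>\<in>A. \<Sum>\<alpha>\<in>F. cnj (?u \<gamma>) * f (gdiv \<gamma> \<alpha>) * v \<alpha>) = (\<Sum>\<gamma>\<in>A. cnj (?u \<gamma>) * ?u \<gamma>)"
    by (simp add: sum_distrib_left mult.assoc)
  also have "\<dots> = complex_of_real ((l2 ?u A)\<^sup>2)"
    unfolding L2_set_sq of_real_sum by (intro sum.cong refl) (simp only: complex_norm_square mult.commute)
  finally have e: "cmod (\<Sum>\<gamma>\<in>A. \<Sum>\<alpha>\<in>F. cnj (?u \<gamma>) * f (gdiv \<gamma> \<alpha>) * v \<alpha>) = (l2 ?u A)\<^sup>2"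
    by (simp only: norm_of_real abs_power2)
  have "(l2 ?u A)\<^sup>2 \<le> r * L2_set (\<lambda>\<gamma>. cmod (cnj (?u \<gamma>))) A * l2 v F"
    using op_boundD[OF assms, of "\<lambda>\<gamma>. cnj (?u \<gamma>)" v] unfolding e .
  then show ?thesis unfolding complex_mod_cnj
    by (rule L2_le_of_sq[OF _ L2_set_nonneg op_bound_nonneg[OF assms(1)] L2_set_nonneg])
qed

lemma op_bound_row:
  assumes "op_bound f r" "finite A" "finite F" "A \<subseteq> fibre x" "F \<subseteq> fibre x"
  shows "L2_set (\<lambda>\<alpha>. cmod (\<Sum>\<gamma>\<in>A. w \<gamma> * f (gdiv \<gamma> \<alpha>))) F \<le> r * l2 w A"
proof -
  let ?u = "\<lambda>\<alpha>. \<Sum>\<gamma>\<in>A. w \<gamma> * f (gdiv \<gamma> \<alpha>)"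
  have "(\<Sum>\<gamma>\<in>A. \<Sum>\<alpha>\<in>F. w \<gamma> * f (gdiv \<gamma> \<alpha>) * cnj (?u \<alpha>)) = (\<Sum>\<alpha>\<in>F. ?u \<alpha> * cnj (?u \<alpha>))"
    by (subst sum.swap) (simp add: sum_distrib_right)
  also have "\<dots> = complex_of_real ((l2 ?u F)\<^sup>2)"
    unfolding L2_set_sq of_real_sum by (intro sum.cong refl) (simp only: complex_norm_square)
  finally have e: "cmod (\<Sum>\<gamma>\<in>A. \<Sum>\<alpha>\<in>F. w \<gamma> * f (gdiv \<gamma> \<alpha>) * cnj (?u \<alpha>)) = (l2 ?u F)\<^sup>2"
    by (simp only: norm_of_real abs_power2)
  have "(l2 ?u F)\<^sup>2 \<le> r * l2 w A * L2_set (\<lambda>\<alpha>. cmod (cnj (?u \<alpha>))) F"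
    using op_boundD[OF assms, of w "\<lambda>\<gamma>. cnj (?u \<gamma>)"] unfolding e .
  then have "(l2 ?u F)\<^sup>2 \<le> r * l2 ?u F * l2 w A"
    unfolding complex_mod_cnj by (simp only: mult.assoc mult.commute[of "l2 w A"])
  then show ?thesis
    by (rule L2_le_of_sq[OF _ L2_set_nonneg op_bound_nonneg[OF assms(1)] L2_set_nonneg])
qed

lemma op_bound_lim:
  assumes "\<And>n. op_bound (f n) (r n)" "r \<longlonglongrightarrow> s" "\<And>\<gamma>. \<gamma> \<in> Gt m \<Longrightarrow> (\<lambda>n. f n \<gamma>) \<longlonglongrightarrow> g \<gamma>"
  shows "op_bound g s"
proof (rule op_boundI)
  show "0 \<le> s" using assms(1,2) op_bound_nonneg by (intro LIMSEQ_le_const[OF assms(2)]) auto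
  fix x A F and v w :: "'a germ \<Rightarrow> complex"
  assume a: "finite A" "finite F" "A \<subseteq> fibre x" "F \<subseteq> fibre x"
  have g: "gdiv \<gamma> \<alpha> \<in> Gt m" if "\<gamma> \<in> A" "\<alpha> \<in> F" for \<gamma> \<alpha>
    using gdiv_fibre[of \<gamma> x \<alpha>] a that Gt_fibre by blast
  have "(\<lambda>n. cmod (bform (f n) w v A F)) \<longlonglongrightarrow> cmod (bform g w v A F)"
    by (intro tendsto_intros assms(3) g)
  moreover have "(\<lambda>n. r n * l2 w A * l2 v F)
      \<longlonglongrightarrow> s * l2 w A * l2 v F"
    by (intro tendsto_intros assms(2))
  ultimately show "cmod (bform g w v A F)
       \<le> s * l2 w A * l2 v F"
    by (rule LIMSEQ_le) (use op_boundD[OF assms(1) a] in blast)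
qed

text \<open>With \<open>op_bound_of_rnorm2\<close> this shows that, for nonnegative
  \<open>r\<close>, \<open>op_bound f r\<close> says exactly that the squared reduced norm of
  \<open>f\<close> is at most the square of \<open>r\<close>.\<close>

lemma rnorm2_le: assumes "op_bound f r" shows "rnorm2 m f \<le> ennreal (r\<^sup>2)"
  unfolding rnorm2_def fibre_def[symmetric] gdiv_def[symmetric]
proof (rule SUP_least, clarify)
  fix x v F assume F: "finite F" "F \<subseteq> fibre x" "(\<Sum>\<alpha>\<in>F. (cmod (v \<alpha>))\<^sup>2) \<le> 1"
  have v: "l2 v F \<le> 1" using F(3) by (simp add: L2_set_def sum_nonneg)
  show "(\<integral>\<^sup>+ \<gamma>. ennreal ((cmod (\<Sum>\<alpha>\<in>F. f (gdiv \<gamma> \<alpha>) * v \<alpha>))\<^sup>2) \<partial>count_space (fibre x)) \<le> ennreal (r\<^sup>2)"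
  proof (rule nn_integral_count_space_le)
    fix A assume A: "finite A" "A \<subseteq> fibre x"
    have "L2_set (\<lambda>\<gamma>. cmod (\<Sum>\<alpha>\<in>F. f (gdiv \<gamma> \<alpha>) * v \<alpha>)) A \<le> r * l2 v F"
      using op_bound_col[OF assms A(1) F(1) A(2) F(2)] .
    also have "\<dots> \<le> r * 1" using v op_bound_nonneg[OF assms] by (intro mult_left_mono)
    finally have "(L2_set (\<lambda>\<gamma>. cmod (\<Sum>\<alpha>\<in>F. f (gdiv \<gamma> \<alpha>) * v \<alpha>)) A)\<^sup>2 \<le> r\<^sup>2"
      by (intro power_mono) (simp_all add: L2_set_nonneg)
    then show "(\<Sum>\<gamma>\<in>A. (cmod (\<Sum>\<alpha>\<in>F. f (gdiv \<gamma> \<alpha>) * v \<alpha>))\<^sup>2) \<le> r\<^sup>2" by (simp add: L2_set_sq)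
  qed auto
qed

lemma op_bound_of_rnorm2: assumes f: "rnorm2 m f \<le> ennreal (r\<^sup>2)" and r: "0 \<le> r" shows "op_bound f r"
proof (rule op_boundI)
  show "0 \<le> r" using r .
  fix x A F and v w :: "'a germ \<Rightarrow> complex"
  assume a: "finite A" "finite F" "A \<subseteq> fibre x" "F \<subseteq> fibre x"
  let ?u = "\<lambda>v \<gamma>. \<Sum>\<alpha>\<in>F. f (gdiv \<gamma> \<alpha>) * v \<alpha>"
  let ?N = "l2 v F"
  have unit: "L2_set (\<lambda>\<gamma>. cmod (?u v \<gamma>)) A \<le> r" if v: "(\<Sum>\<alpha>\<in>F. (cmod (v \<alpha>))\<^sup>2) \<le> 1" and x: "x \<in> tight m" for v
  proof -
    have "ennreal (\<Sum>\<gamma>\<in>A. (cmod (?u v \<gamma>))\<^sup>2) \<le> (\<integral>\<^sup>+ \<gamma>. ennreal ((cmod (?u v \<gamma>))\<^sup>2) \<partial>count_space (fibre x))"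
      using a by (intro sum_le_nn_integral_count_space) auto
    also have "\<dots> \<le> rnorm2 m f"
      unfolding rnorm2_def fibre_def[symmetric] gdiv_def[symmetric]
      by (rule SUP_upper2[of "(x, v, F)"]) (use a v x in auto)
    also note f
    finally have "ennreal (\<Sum>\<gamma>\<in>A. (cmod (?u v \<gamma>))\<^sup>2) \<le> ennreal (r\<^sup>2)" .
    then have "(\<Sum>\<gamma>\<in>A. (cmod (?u v \<gamma>))\<^sup>2) \<le> r\<^sup>2" by (simp add: ennreal_le_iff)
    then show ?thesis unfolding L2_set_def using r real_le_lsqrt sum_nonneg by (metis (no_types, lifting) zero_le_power2)
  qed
  have col: "L2_set (\<lambda>\<gamma>. cmod (?u v \<gamma>)) A \<le> r * ?N"
  proof (cases "?N = 0 \<or> F = {}")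
    case True
    then have "v \<alpha> = 0" if "\<alpha> \<in> F" for \<alpha> using that a by (auto simp: L2_set_eq_0_iff)
    then have "?u v \<gamma> = 0" for \<gamma> by simp
    then show ?thesis using r by (simp add: L2_set_0')
  next
    case False
    then have N: "?N > 0" using L2_set_nonneg by (metis less_eq_real_def)
    obtain \<alpha> where "\<alpha> \<in> F" using False by blast
    then have x: "x \<in> tight m" using a fibre_tight by blast
    let ?v = "\<lambda>\<alpha>. v \<alpha> / of_real ?N"
    have "(\<Sum>\<alpha>\<in>F. (cmod (?v \<alpha>))\<^sup>2) = ?N\<^sup>2 / ?N\<^sup>2"
      unfolding L2_set_sq[of _ F, symmetric] using N
      by (simp add: norm_divide power_divide L2_set_sq flip: sum_divide_distrib)
    then have "L2_set (\<lambda>\<gamma>. cmod (?u ?v \<gamma>)) A \<le> r" using N by (intro unit x) simp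
    moreover have eqn: "cmod (?u ?v \<gamma>) = (1 / ?N) * cmod (?u v \<gamma>)" for \<gamma>
      using N by (simp add: norm_divide flip: sum_divide_distrib)
    have "L2_set (\<lambda>\<gamma>. cmod (?u ?v \<gamma>)) A = (1 / ?N) * L2_set (\<lambda>\<gamma>. cmod (?u v \<gamma>)) A"
      unfolding eqn using N by (intro L2_set_right_distrib[symmetric]) simp
    ultimately have "L2_set (\<lambda>\<gamma>. cmod (?u v \<gamma>)) A / ?N \<le> r" by simp
    then show ?thesis using pos_divide_le_eq[OF N] by blast
  qed
  have "(bform f w v A F) = (\<Sum>\<gamma>\<in>A. w \<gamma> * ?u v \<gamma>)"
    by (simp add: sum_distrib_left mult.assoc)
  then have "cmod (bform f w v A F) \<le> l2 w A * L2_set (\<lambda>\<gamma>. cmod (?u v \<gamma>)) A"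
    using norm_sum_mult_le_L2 by simp
  also have "\<dots> \<le> l2 w A * (r * ?N)"
    using col by (intro mult_left_mono) (auto simp: L2_set_nonneg)
  finally show "cmod (bform f w v A F) \<le> r * l2 w A * ?N"
    by (simp add: mult_ac)
qed

section \<open>Convolution and adjoint of bounded functions\<close>

lemma conv_off: "\<gamma> \<notin> Gt m \<Longrightarrow> conv m f g \<gamma> = 0"
  by (simp add: conv_def)

text \<open>Right translation by \<open>\<beta>\<close> moves the sum back to the fibre over
  \<open>x\<close>, where convolution becomes multiplication of matrices.\<close>

lemma conv_dv_infsum:
  assumes g: "\<gamma> \<in> fibre x" and b: "\<beta> \<in> fibre x"
  shows "conv m f g (gdiv \<gamma> \<beta>) = infsum (\<lambda>\<alpha>. f (gdiv \<gamma> \<alpha>) * g (gdiv \<alpha> \<beta>)) (fibre x)"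
proof -
  have d: "gdiv \<gamma> \<beta> \<in> fibre (grange \<beta>)" using gdiv_fibre g b by blast
  have "conv m f g (gdiv \<gamma> \<beta>) = infsum (\<lambda>\<alpha>. f (gdiv (gdiv \<gamma> \<beta>) \<alpha>) * g \<alpha>) (fibre (grange \<beta>))"
    using Gt_fibre(2,3)[OF d] unfolding conv_def fibre_def[symmetric] gdiv_def[symmetric] by simp
  also have "\<dots> = infsum (\<lambda>\<alpha>. f (gdiv (gdiv \<gamma> \<beta>) (gdiv \<alpha> \<beta>)) * g (gdiv \<alpha> \<beta>)) (fibre x)"
    by (rule infsum_reindex_bij_betw[OF gdiv_bij[OF b], symmetric])
  also have "\<dots> = infsum (\<lambda>\<alpha>. f (gdiv \<gamma> \<alpha>) * g (gdiv \<alpha> \<beta>)) (fibre x)"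
    using gdiv_dv[OF g _ b] by (intro infsum_cong) simp
  finally show ?thesis .
qed

text \<open>Absolute summability by Cauchy-Schwarz: a row of the matrix of \<open>f\<close> has l2
  norm at most \<open>r\<close>, a column of the matrix of \<open>g\<close> at most
  \<open>s\<close>.\<close>

lemma conv_has_sum:
  assumes f: "op_bound f r" and g: "op_bound g s" and \<gamma>: "\<gamma> \<in> fibre x" and \<beta>: "\<beta> \<in> fibre x"
  shows "((\<lambda>\<alpha>. f (gdiv \<gamma> \<alpha>) * g (gdiv \<alpha> \<beta>)) has_sum conv m f g (gdiv \<gamma> \<beta>)) (fibre x)"
proof -
  have "(\<lambda>\<alpha>. cmod (f (gdiv \<gamma> \<alpha>) * g (gdiv \<alpha> \<beta>))) summable_on (fibre x)"
  proof (rule nonneg_bdd_above_summable_on)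
    show "bdd_above (sum (\<lambda>\<alpha>. cmod (f (gdiv \<gamma> \<alpha>) * g (gdiv \<alpha> \<beta>))) ` {F. F \<subseteq> fibre x \<and> finite F})"
    proof (rule bdd_aboveI[of _ "r * s"], clarify)
      fix F assume F: "F \<subseteq> fibre x" "finite F"
      have "(\<Sum>\<alpha>\<in>F. cmod (f (gdiv \<gamma> \<alpha>) * g (gdiv \<alpha> \<beta>))) \<le> L2_set (\<lambda>\<alpha>. cmod (f (gdiv \<gamma> \<alpha>))) F * L2_set (\<lambda>\<alpha>. cmod (g (gdiv \<alpha> \<beta>))) F"
        using L2_set_mult_ineq[of "\<lambda>\<alpha>. cmod (f (gdiv \<gamma> \<alpha>))" "\<lambda>\<alpha>. cmod (g (gdiv \<alpha> \<beta>))" F] by (simp add: norm_mult)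
      also have "\<dots> \<le> r * s"
      proof (rule mult_mono)
        show "L2_set (\<lambda>\<alpha>. cmod (f (gdiv \<gamma> \<alpha>))) F \<le> r"
          using op_bound_row[OF f, of "{\<gamma>}" F x "\<lambda>_. 1"] F \<gamma> by simp
        show "L2_set (\<lambda>\<alpha>. cmod (g (gdiv \<alpha> \<beta>))) F \<le> s"
          using op_bound_col[OF g, of F "{\<beta>}" x "\<lambda>_. 1"] F \<beta> by simp
      qed (use op_bound_nonneg[OF f] L2_set_nonneg in auto)
      finally show "(\<Sum>\<alpha>\<in>F. cmod (f (gdiv \<gamma> \<alpha>) * g (gdiv \<alpha> \<beta>))) \<le> r * s" .
    qed
  qed simp
  then have "(\<lambda>\<alpha>. f (gdiv \<gamma> \<alpha>) * g (gdiv \<alpha> \<beta>)) summable_on (fibre x)"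
    by (rule abs_summable_summable)
  then show ?thesis unfolding conv_dv_infsum[OF \<gamma> \<beta>] by (rule has_sum_infsum)
qed

lemma conv_has_sum':
  assumes f: "op_bound f r" and g: "op_bound g s" and \<gamma>: "\<gamma> \<in> fibre x"
  shows "((\<lambda>\<alpha>. f (gdiv \<gamma> \<alpha>) * g \<alpha>) has_sum conv m f g \<gamma>) (fibre x)"
proof -
  have u: "gunit m x \<in> fibre x" using gunit_fibre fibre_tight \<gamma> by blast
  have "((\<lambda>\<alpha>. f (gdiv \<gamma> \<alpha>) * g (gdiv \<alpha> (gunit m x))) has_sum conv m f g \<gamma>) (fibre x)"
    using conv_has_sum[OF f g \<gamma> u] gdiv_gunit[OF \<gamma>] by simp
  also have "?this \<longleftrightarrow> ?thesis" by (rule has_sum_cong) (simp add: gdiv_gunit)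
  finally show ?thesis .
qed

text \<open>The form of the product is a sum over the middle index \<open>\<alpha>\<close> of
  \<open>?p \<alpha> * ?q \<alpha>\<close>. On every finite set of indices Cauchy-Schwarz combines
  the row bound for \<open>f\<close> with the column bound for \<open>g\<close>; the bound survives
  the limit over finite sets.\<close>

lemma op_bound_conv: assumes f: "op_bound f r" and g: "op_bound g s" shows "op_bound (conv m f g) (r * s)"
proof (rule op_boundI)
  have r: "0 \<le> r" "0 \<le> s" using f g op_bound_nonneg by auto
  then show "0 \<le> r * s" by simp
  fix x A F and v w :: "'a germ \<Rightarrow> complex"
  assume a: "finite A" "finite F" "A \<subseteq> fibre x" "F \<subseteq> fibre x"
  let ?p = "\<lambda>\<alpha>. \<Sum>\<gamma>\<in>A. w \<gamma> * f (gdiv \<gamma> \<alpha>)" and ?q = "\<lambda>\<alpha>. \<Sum>\<beta>\<in>F. g (gdiv \<alpha> \<beta>) * v \<beta>"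
  let ?K = "r * s * l2 w A * l2 v F"
  have "((\<lambda>\<alpha>. \<Sum>\<gamma>\<in>A. \<Sum>\<beta>\<in>F. w \<gamma> * (f (gdiv \<gamma> \<alpha>) * g (gdiv \<alpha> \<beta>)) * v \<beta>) has_sum
      (bform (conv m f g) w v A F)) (fibre x)"
    using a by (intro has_sum_sum_complex has_sum_cmult_left has_sum_cmult_right conv_has_sum[OF f g]) auto
  moreover have "(\<lambda>\<alpha>. \<Sum>\<gamma>\<in>A. \<Sum>\<beta>\<in>F. w \<gamma> * (f (gdiv \<gamma> \<alpha>) * g (gdiv \<alpha> \<beta>)) * v \<beta>) = (\<lambda>\<alpha>. ?p \<alpha> * ?q \<alpha>)"
    unfolding sum_product by (intro ext sum.cong refl) (simp only: mult_ac)
  ultimately have hs: "((\<lambda>\<alpha>. ?p \<alpha> * ?q \<alpha>) has_sum (bform (conv m f g) w v A F)) (fibre x)"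
    by simp
  have bd: "cmod (\<Sum>\<alpha>\<in>B. ?p \<alpha> * ?q \<alpha>) \<le> ?K" if B: "finite B" "B \<subseteq> fibre x" for B
  proof -
    have "cmod (\<Sum>\<alpha>\<in>B. ?p \<alpha> * ?q \<alpha>) \<le> l2 ?p B * l2 ?q B"
      by (rule norm_sum_mult_le_L2)
    also have "\<dots> \<le> (r * l2 w A) * (s * l2 v F)"
      using op_bound_row[OF f a(1) B(1) a(3) B(2)] op_bound_col[OF g B(1) a(2) B(2) a(4)] r
      by (intro mult_mono) (auto simp: L2_set_nonneg)
    finally show ?thesis by (simp add: mult_ac)
  qed
  have "((\<lambda>B. cmod (sum (\<lambda>\<alpha>. ?p \<alpha> * ?q \<alpha>) B)) \<longlongrightarrow> cmod (bform (conv m f g) w v A F)) (finite_subsets_at_top (fibre x))"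
    using hs unfolding has_sum_def by (rule tendsto_norm)
  then show "cmod (bform (conv m f g) w v A F) \<le> ?K"
    by (rule tendsto_upperbound)
      (use bd in \<open>auto intro!: eventually_finite_subsets_at_top_weakI\<close>)
qed

lemma conv_diff_left:
  assumes "op_bound f r" "op_bound f' r'" "op_bound g s"
  shows "conv m (\<lambda>\<gamma>. f \<gamma> - f' \<gamma>) g = (\<lambda>\<gamma>. conv m f g \<gamma> - conv m f' g \<gamma>)"
proof
  fix \<gamma> show "conv m (\<lambda>\<gamma>. f \<gamma> - f' \<gamma>) g \<gamma> = conv m f g \<gamma> - conv m f' g \<gamma>"
  proof (cases "\<gamma> \<in> Gt m")
    case True
    then have \<gamma>: "\<gamma> \<in> fibre (gdom m \<gamma>)" using Gt_fibre by blast
    show ?thesis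
      using has_sum_diff_complex[OF conv_has_sum'[OF assms(1,3) \<gamma>] conv_has_sum'[OF assms(2,3) \<gamma>]]
        conv_has_sum'[OF op_bound_diff[OF assms(1,2)] assms(3) \<gamma>]
      by (simp add: left_diff_distrib has_sum_unique)
  qed (simp add: conv_off)
qed

lemma conv_diff_right:
  assumes "op_bound f r" "op_bound g s" "op_bound g' s'"
  shows "conv m f (\<lambda>\<gamma>. g \<gamma> - g' \<gamma>) = (\<lambda>\<gamma>. conv m f g \<gamma> - conv m f g' \<gamma>)"
proof
  fix \<gamma> show "conv m f (\<lambda>\<gamma>. g \<gamma> - g' \<gamma>) \<gamma> = conv m f g \<gamma> - conv m f g' \<gamma>"
  proof (cases "\<gamma> \<in> Gt m")
    case True
    then have \<gamma>: "\<gamma> \<in> fibre (gdom m \<gamma>)" using Gt_fibre by blast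
    show ?thesis
      using has_sum_diff_complex[OF conv_has_sum'[OF assms(1,2) \<gamma>] conv_has_sum'[OF assms(1,3) \<gamma>]]
        conv_has_sum'[OF assms(1) op_bound_diff[OF assms(2,3)] \<gamma>]
      by (simp add: right_diff_distrib has_sum_unique)
  qed (simp add: conv_off)
qed

lemma conv_scale_left: assumes "op_bound f r" "op_bound g s" shows "conv m (\<lambda>\<gamma>. c * f \<gamma>) g = (\<lambda>\<gamma>. c * conv m f g \<gamma>)"
proof
  fix \<gamma> show "conv m (\<lambda>\<gamma>. c * f \<gamma>) g \<gamma> = c * conv m f g \<gamma>"
  proof (cases "\<gamma> \<in> Gt m")
    case True
    then have \<gamma>: "\<gamma> \<in> fibre (gdom m \<gamma>)" using Gt_fibre by blast
    show ?thesis
      using has_sum_unique[OF conv_has_sum'[OF op_bound_scale[OF assms(1), of c] assms(2) \<gamma>, unfolded mult.assoc]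
        has_sum_cmult_right[OF conv_has_sum'[OF assms \<gamma>], of c]] .
  qed (simp add: conv_off)
qed

lemma conv_scale_right: assumes "op_bound f r" "op_bound g s" shows "conv m f (\<lambda>\<gamma>. c * g \<gamma>) = (\<lambda>\<gamma>. c * conv m f g \<gamma>)"
proof
  fix \<gamma> show "conv m f (\<lambda>\<gamma>. c * g \<gamma>) \<gamma> = c * conv m f g \<gamma>"
  proof (cases "\<gamma> \<in> Gt m")
    case True
    then have \<gamma>: "\<gamma> \<in> fibre (gdom m \<gamma>)" using Gt_fibre by blast
    show ?thesis
      using has_sum_unique[OF conv_has_sum'[OF assms(1) op_bound_scale[OF assms(2), of c] \<gamma>, unfolded mult.left_commute[of _ c]]
        has_sum_cmult_right[OF conv_has_sum'[OF assms \<gamma>], of c]] .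
  qed (simp add: conv_off)
qed

lemma conv_add_left:
  assumes "op_bound f r" "op_bound f' r'" "op_bound g s"
  shows "conv m (\<lambda>\<gamma>. f \<gamma> + f' \<gamma>) g = (\<lambda>\<gamma>. conv m f g \<gamma> + conv m f' g \<gamma>)"
  using conv_diff_left[OF assms(1) op_bound_scale[OF assms(2), of "-1"] assms(3)] conv_scale_left[OF assms(2,3), of "-1"] by simp

lemma conv_add_right:
  assumes "op_bound f r" "op_bound g s" "op_bound g' s'"
  shows "conv m f (\<lambda>\<gamma>. g \<gamma> + g' \<gamma>) = (\<lambda>\<gamma>. conv m f g \<gamma> + conv m f g' \<gamma>)"
  using conv_diff_right[OF assms(1,2) op_bound_scale[OF assms(3), of "-1"]] conv_scale_right[OF assms(1,3), of "-1"] by simp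

lemma adj_dv: assumes "\<gamma> \<in> fibre x" "\<alpha> \<in> fibre x" shows "adj m f (gdiv \<gamma> \<alpha>) = cnj (f (gdiv \<alpha> \<gamma>))"
  using Gt_fibre(2)[OF gdiv_fibre[OF assms]] ginv_dv[OF assms] by (simp add: adj_def)

lemma op_bound_adj: assumes f: "op_bound f r" shows "op_bound (adj m f) r"
proof (rule op_boundI)
  show "0 \<le> r" using f op_bound_nonneg by auto
  fix x A F and v w :: "'a germ \<Rightarrow> complex"
  assume a: "finite A" "finite F" "A \<subseteq> fibre x" "F \<subseteq> fibre x"
  have "(bform (adj m f) w v A F) = (\<Sum>\<gamma>\<in>A. \<Sum>\<alpha>\<in>F. w \<gamma> * cnj (f (gdiv \<alpha> \<gamma>)) * v \<alpha>)"
    using a by (intro sum.cong refl) (auto simp: adj_dv subsetD)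
  also have "\<dots> = cnj (\<Sum>\<alpha>\<in>F. \<Sum>\<gamma>\<in>A. cnj (v \<alpha>) * f (gdiv \<alpha> \<gamma>) * cnj (w \<gamma>))"
    by (subst sum.swap) (simp add: mult_ac)
  finally have "cmod (bform (adj m f) w v A F) = cmod (\<Sum>\<alpha>\<in>F. \<Sum>\<gamma>\<in>A. cnj (v \<alpha>) * f (gdiv \<alpha> \<gamma>) * cnj (w \<gamma>))"
    by (simp only: complex_mod_cnj)
  then show "cmod (bform (adj m f) w v A F)
       \<le> r * l2 w A * l2 v F"
    using op_boundD[OF f a(2,1,4,3), of "\<lambda>\<alpha>. cnj (v \<alpha>)" "\<lambda>\<alpha>. cnj (w \<alpha>)"] by (simp add: mult_ac)
qed

text \<open>The value at the unit is the sum of the squared moduli of \<open>a\<close> over the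
  fibre. Membership in \<open>Jsing\<close> thus means that \<open>a\<close> vanishes on the fibres
  over all units outside a meagre set.\<close>

lemma conv_adj_self_nonzero:
  assumes a: "op_bound a r" and x: "x \<in> tight m"
  shows "conv m (adj m a) a (gunit m x) \<noteq> 0 \<longleftrightarrow> (\<exists>\<alpha>\<in>fibre x. a \<alpha> \<noteq> 0)"
proof -
  have u: "gunit m x \<in> fibre x" using gunit_fibre x by blast
  have hs0: "((\<lambda>\<alpha>. adj m a (gdiv (gunit m x) \<alpha>) * a \<alpha>) has_sum conv m (adj m a) a (gunit m x)) (fibre x)"
    using conv_has_sum'[OF op_bound_adj[OF a] a u] .
  have eq: "adj m a (gdiv (gunit m x) \<alpha>) * a \<alpha> = of_real ((cmod (a \<alpha>))\<^sup>2)" if "\<alpha> \<in> fibre x" for \<alpha>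
    unfolding adj_dv[OF u that] gdiv_gunit[OF that] by (simp only: complex_norm_square mult.commute)
  have hs: "((\<lambda>\<alpha>. complex_of_real ((cmod (a \<alpha>))\<^sup>2)) has_sum conv m (adj m a) a (gunit m x)) (fibre x)"
    using hs0 by (subst has_sum_cong[OF eq[symmetric]])
  have re: "((\<lambda>\<alpha>. (cmod (a \<alpha>))\<^sup>2) has_sum Re (conv m (adj m a) a (gunit m x))) (fibre x)"
    using has_sum_Re[OF hs] by simp
  show ?thesis
  proof
    assume n: "conv m (adj m a) a (gunit m x) \<noteq> 0"
    show "\<exists>\<alpha>\<in>fibre x. a \<alpha> \<noteq> 0"
    proof (rule ccontr)
      assume "\<not> (\<exists>\<alpha>\<in>fibre x. a \<alpha> \<noteq> 0)"
      then have "((\<lambda>\<alpha>. complex_of_real ((cmod (a \<alpha>))\<^sup>2)) has_sum 0) (fibre x)" by (intro has_sum_0) auto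
      then show False using has_sum_unique[OF hs] n by blast
    qed
  next
    assume "\<exists>\<alpha>\<in>fibre x. a \<alpha> \<noteq> 0"
    then obtain \<alpha> where \<alpha>: "\<alpha> \<in> fibre x" "a \<alpha> \<noteq> 0" by blast
    have "(\<Sum>\<alpha>\<in>{\<alpha>}. (cmod (a \<alpha>))\<^sup>2) \<le> Re (conv m (adj m a) a (gunit m x))"
      using \<alpha> by (intro has_sum_mono_neutral[OF has_sum_finite re]) auto
    then have "0 < Re (conv m (adj m a) a (gunit m x))" using \<alpha> by (simp add: less_le_trans[of 0 "(cmod (a \<alpha>))\<^sup>2"])
    then show "conv m (adj m a) a (gunit m x) \<noteq> 0" by auto
  qed
qed

end

section \<open>The span of the functions \<open>T_s\<close>\<close>

context inverse_semigroup_zero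
begin

abbreviation T where "T \<equiv> Tgen m"

lemma T_fibre: assumes "\<gamma> \<in> fibre x"
  shows "T s \<gamma> = (if st s \<odot> s \<in> x \<and> \<gamma> = germ m s x then 1 else 0)"
proof -
  obtain u where u: "x \<in> tight m" "st u \<odot> u \<in> x" "\<gamma> = germ m u x" using assms fibreE by metis
  have "\<gamma> \<in> bis m s (Dset m (st s \<odot> s)) \<longleftrightarrow> st s \<odot> s \<in> x \<and> \<gamma> = germ m s x"
  proof
    assume "\<gamma> \<in> bis m s (Dset m (st s \<odot> s))"
    then obtain y where y: "y \<in> tight m" "st s \<odot> s \<in> y" "\<gamma> = germ m s y" by (auto simp: bis_def Dset_def)
    then have "x = y" using gdom_germ u by metis
    then show "st s \<odot> s \<in> x \<and> \<gamma> = germ m s x" using y by simp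
  next
    assume "st s \<odot> s \<in> x \<and> \<gamma> = germ m s x"
    then show "\<gamma> \<in> bis m s (Dset m (st s \<odot> s))" using u(1) by (auto simp: bis_def Dset_def)
  qed
  then show ?thesis by (simp add: Tgen_def indicator_def)
qed

lemma T_off: "\<gamma> \<notin> Gt m \<Longrightarrow> T s \<gamma> = 0"
  using germ_Gt by (auto simp: Tgen_def indicator_def bis_def Dset_def)

lemma germ_mult_idem:
  assumes "y \<in> tight m" "st a \<odot> a \<in> y" "e \<in> y" shows "germ m (a \<odot> e) y = germ m a y"
proof -
  have f: "is_filter m y" using assms tight_filter by blast
  have eE: "e \<in> E" using filter_idem f assms by blast
  have "st (a \<odot> e) \<odot> (a \<odot> e) = e \<odot> (st a \<odot> a) \<odot> e" by (simp add: star_idem[OF eE] assoc)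
  then have "st (a \<odot> e) \<odot> (a \<odot> e) \<in> y" using filter_mult[OF f] assms by simp
  then show ?thesis using assms eE by (intro germ_eqI[of _ _ _ e]) (auto simp: assoc idem_dup)
qed

lemma T_ginv: assumes "\<gamma> \<in> fibre x" shows "T s (ginv m \<gamma>) = T (st s) \<gamma>"
proof -
  have *: "T (st s) \<gamma> = 1" if g: "\<gamma> \<in> fibre x" and "T s (ginv m \<gamma>) = 1" for \<gamma> x s
  proof -
    have i: "ginv m \<gamma> \<in> fibre (grange \<gamma>)" using ginv_fibre g by blast
    then have y: "grange \<gamma> \<in> tight m" "st s \<odot> s \<in> grange \<gamma>" "ginv m \<gamma> = germ m s (grange \<gamma>)"
      using that(2) T_fibre[OF i] fibre_tight[OF i] by (auto split: if_splits)
    have "\<gamma> = germ m (st s) (theta m s (grange \<gamma>))"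
      using ginv_ginv[OF g] y(3) ginv_germ[OF y(1,2)] by simp
    moreover have "x = theta m s (grange \<gamma>)"
      using grange_ginv[OF g] grange_germ[OF y(1,2)] y(3) by simp
    ultimately show ?thesis using T_fibre[OF g] star_dom'[OF y(1,2)] by simp
  qed
  have v: "T s \<gamma> = 0 \<or> T s \<gamma> = 1" for s \<gamma> by (auto simp: Tgen_def indicator_def)
  have "T s (ginv m \<gamma>) = 1 \<longleftrightarrow> T (st s) \<gamma> = 1"
    using *[OF assms, of s] *[OF ginv_fibre[OF assms], of "st s"] ginv_ginv[OF assms] by auto
  then show ?thesis using v by metis
qed

lemma T_dv_swap: "\<gamma> \<in> fibre x \<Longrightarrow> \<alpha> \<in> fibre x \<Longrightarrow> T s (gdiv \<gamma> \<alpha>) = T (st s) (gdiv \<alpha> \<gamma>)"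
  using T_ginv[OF gdiv_fibre, of \<alpha> x \<gamma> s] ginv_dv[of \<alpha> x \<gamma>] by simp

text \<open>\<open>T s\<close> is supported on a bisection, so every column of its matrix has at
  most one nonzero entry.\<close>

lemma T_dv_unique:
  assumes "\<gamma> \<in> fibre x" "\<gamma>' \<in> fibre x" "\<alpha> \<in> fibre x" "T s (gdiv \<gamma> \<alpha>) \<noteq> 0" "T s (gdiv \<gamma>' \<alpha>) \<noteq> 0"
  shows "\<gamma> = \<gamma>'"
proof -
  have "gdiv \<gamma> \<alpha> = germ m s (grange \<alpha>)" "gdiv \<gamma>' \<alpha> = germ m s (grange \<alpha>)"
    using assms(4,5) T_fibre[OF gdiv_fibre[OF assms(1,3)]] T_fibre[OF gdiv_fibre[OF assms(2,3)]] by (auto split: if_splits)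
  then show ?thesis using gdiv_inj[OF assms(1-3)] by simp
qed

lemma conv_T_right: assumes g: "\<gamma> \<in> fibre x"
  shows "conv m f (T t) \<gamma> = (if st t \<odot> t \<in> x then f (gdiv \<gamma> (germ m t x)) else 0)"
proof -
  have x: "x \<in> tight m" using fibre_tight g by blast
  have c: "conv m f (T t) \<gamma> = infsum (\<lambda>\<alpha>. f (gdiv \<gamma> \<alpha>) * T t \<alpha>) (fibre x)"
    using Gt_fibre(2,3)[OF g] unfolding conv_def fibre_def[symmetric] gdiv_def[symmetric] by simp
  show ?thesis
  proof (cases "st t \<odot> t \<in> x")
    case True
    have t: "germ m t x \<in> fibre x" using germ_fibre[OF x True] .
    have "((\<lambda>\<alpha>. f (gdiv \<gamma> \<alpha>) * T t \<alpha>) has_sum f (gdiv \<gamma> (germ m t x))) (fibre x)"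
      by (rule has_sum_finite_neutralI[of "{germ m t x}"]) (use t True in \<open>simp_all add: T_fibre[of _ x]\<close>)
    then show ?thesis unfolding c using True infsumI by simp
  next
    case False
    have "infsum (\<lambda>\<alpha>. f (gdiv \<gamma> \<alpha>) * T t \<alpha>) (fibre x) = 0"
      by (rule infsum_0) (use False in \<open>simp add: T_fibre[of _ x]\<close>)
    then show ?thesis unfolding c using False by simp
  qed
qed

lemma gdiv_star_germ:
  assumes x: "x \<in> tight m" "st u \<odot> u \<in> x" and s: "s \<odot> st s \<in> theta m u x"
  shows "st (st s \<odot> u) \<odot> (st s \<odot> u) \<in> x" "gdiv (germ m (st s \<odot> u) x) (germ m u x) = germ m (st s) (theta m u x)"
proof -
  have f: "is_filter m x" using x tight_filter by blast
  show d: "st (st s \<odot> u) \<odot> (st s \<odot> u) \<in> x" using mult_dom[OF f x(2), of "st s"] s by simp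
  have "gdiv (germ m (st s \<odot> u) x) (germ m u x) = germ m (st s \<odot> (u \<odot> st u)) (theta m u x)"
    using gdiv_germ[OF x d] by (simp add: assoc)
  also have "\<dots> = germ m (st s) (theta m u x)"
    using s by (intro germ_mult_idem theta_tight[OF x] star_dom'[OF x]) simp
  finally show "gdiv (germ m (st s \<odot> u) x) (germ m u x) = germ m (st s) (theta m u x)" .
qed

lemma conv_T_left: assumes x: "x \<in> tight m" "st u \<odot> u \<in> x"
  shows "conv m (T s) f (germ m u x) = (if s \<odot> st s \<in> theta m u x then f (germ m (st s \<odot> u) x) else 0)"
proof -
  have g: "germ m u x \<in> fibre x" using germ_fibre[OF x] .
  have c: "conv m (T s) f (germ m u x) = infsum (\<lambda>\<alpha>. T s (gdiv (germ m u x) \<alpha>) * f \<alpha>) (fibre x)"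
    using Gt_fibre(2,3)[OF g] unfolding conv_def fibre_def[symmetric] gdiv_def[symmetric] by simp
  have e: "T s (gdiv (germ m u x) \<alpha>) = (if s \<odot> st s \<in> theta m u x \<and> \<alpha> = germ m (st s \<odot> u) x then 1 else 0)"
    if a: "\<alpha> \<in> fibre x" for \<alpha>
  proof -
    have "T s (gdiv (germ m u x) \<alpha>) = (if s \<odot> st s \<in> theta m u x \<and> gdiv \<alpha> (germ m u x) = germ m (st s) (theta m u x) then 1 else 0)"
      using T_dv_swap[OF g a] T_fibre[OF gdiv_fibre[OF a g], of "st s"] grange_germ[OF x] by simp
    moreover have "gdiv \<alpha> (germ m u x) = germ m (st s) (theta m u x) \<longleftrightarrow> \<alpha> = germ m (st s \<odot> u) x"
      if s: "s \<odot> st s \<in> theta m u x"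
      using gdiv_star_germ[OF x s] gdiv_inj[OF a germ_fibre[OF x(1) gdiv_star_germ(1)[OF x s]] g] by simp
    ultimately show ?thesis by auto
  qed
  show ?thesis
  proof (cases "s \<odot> st s \<in> theta m u x")
    case True
    have t: "germ m (st s \<odot> u) x \<in> fibre x" using germ_fibre[OF x(1) gdiv_star_germ(1)[OF x True]] .
    have "((\<lambda>\<alpha>. T s (gdiv (germ m u x) \<alpha>) * f \<alpha>) has_sum f (germ m (st s \<odot> u) x)) (fibre x)"
      by (rule has_sum_finite_neutralI[of "{germ m (st s \<odot> u) x}"]) (use t True e in simp_all)
    then show ?thesis unfolding c using True infsumI by simp
  next
    case False
    have "infsum (\<lambda>\<alpha>. T s (gdiv (germ m u x) \<alpha>) * f \<alpha>) (fibre x) = 0"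
      by (rule infsum_0) (use False e in simp)
    then show ?thesis unfolding c using False by simp
  qed
qed

lemma conv_T_T: "conv m (T s) (T t) = T (s \<odot> t)"
proof
  fix \<gamma> show "conv m (T s) (T t) \<gamma> = T (s \<odot> t) \<gamma>"
  proof (cases "\<gamma> \<in> Gt m")
    case True
    let ?x = "gdom m \<gamma>"
    have g: "\<gamma> \<in> fibre ?x" using Gt_fibre True by blast
    have x: "?x \<in> tight m" using fibre_tight g by blast
    have f: "is_filter m ?x" using x tight_filter by blast
    have dom: "st (s \<odot> t) \<odot> (s \<odot> t) \<in> ?x \<longleftrightarrow> st t \<odot> t \<in> ?x \<and> st s \<odot> s \<in> theta m t ?x"
    proof
      assume a: "st (s \<odot> t) \<odot> (s \<odot> t) \<in> ?x"
      have "st (s \<odot> t) \<odot> (s \<odot> t) \<odot> (st t \<odot> t) = st (s \<odot> t) \<odot> (s \<odot> t)" by (simp add: assoc star_inv')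
      then have t: "st t \<odot> t \<in> ?x" using filter_up[OF f a, of "st t \<odot> t"] by simp
      then show "st t \<odot> t \<in> ?x \<and> st s \<odot> s \<in> theta m t ?x"
        using a theta_dom_iff[OF f t] by (simp add: assoc)
    qed (use mult_dom[OF f] in blast)
    show ?thesis
    proof (cases "st (s \<odot> t) \<odot> (s \<odot> t) \<in> ?x")
      case c: True
      then have t: "st t \<odot> t \<in> ?x" and s: "st s \<odot> s \<in> theta m t ?x" using dom by auto
      have tg: "germ m t ?x \<in> fibre ?x" using germ_fibre[OF x t] .
      have "gdiv (germ m (s \<odot> t) ?x) (germ m t ?x) = germ m (s \<odot> (t \<odot> st t)) (theta m t ?x)"
        using gdiv_germ[OF x t c] by (simp add: assoc)
      also have "\<dots> = germ m s (theta m t ?x)"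
        using s by (intro germ_mult_idem theta_tight[OF x t] star_dom'[OF x t])
      finally have "gdiv \<gamma> (germ m t ?x) = germ m s (theta m t ?x) \<longleftrightarrow> \<gamma> = germ m (s \<odot> t) ?x"
        using gdiv_inj[OF g germ_fibre[OF x c] tg] by simp
      then show ?thesis
        using conv_T_right[OF g, of "T s" t] t s c T_fibre[OF gdiv_fibre[OF g tg], of s] grange_germ[OF x t] T_fibre[OF g, of "s \<odot> t"]
        by simp
    next
      case False
      then have "conv m (T s) (T t) \<gamma> = 0"
        using conv_T_right[OF g, of "T s" t] dom T_fibre[OF gdiv_fibre[OF g germ_fibre[OF x]], of t s] grange_germ[OF x] by auto
      then show ?thesis using False T_fibre[OF g, of "s \<odot> t"] by simp
    qed
  qed (simp add: conv_off T_off)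
qed

text \<open>The matrix of \<open>T s\<close> is a partial permutation matrix: on the set
  \<open>?R\<close> of nonzero entries both projections are injective, and Cauchy-Schwarz over
  \<open>?R\<close> gives the bound.\<close>

lemma op_bound_T: "op_bound (T s) 1"
proof (rule op_boundI)
  fix x A F and v w :: "'a germ \<Rightarrow> complex"
  assume a: "finite A" "finite F" "A \<subseteq> fibre x" "F \<subseteq> fibre x"
  let ?R = "{p \<in> A \<times> F. T s (gdiv (fst p) (snd p)) \<noteq> 0}"
  have fin: "finite ?R" using a by simp
  have one: "T s \<gamma> \<noteq> 0 \<Longrightarrow> T s \<gamma> = 1" for \<gamma> by (auto simp: Tgen_def indicator_def)
  have "(bform (T s) w v A F) = (\<Sum>p\<in>A \<times> F. w (fst p) * T s (gdiv (fst p) (snd p)) * v (snd p))"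
    by (simp add: sum.cartesian_product case_prod_beta)
  also have "\<dots> = (\<Sum>p\<in>?R. w (fst p) * v (snd p))"
    using a one by (intro sum.mono_neutral_cong_right) auto
  finally have "cmod (bform (T s) w v A F)
      \<le> L2_set (\<lambda>p. cmod (w (fst p))) ?R * L2_set (\<lambda>p. cmod (v (snd p))) ?R"
    using norm_sum_mult_le_L2[of "\<lambda>p. w (fst p)" "\<lambda>p. v (snd p)" ?R] by simp
  also have "\<dots> \<le> l2 w A * l2 v F"
  proof (rule mult_mono)
    have i1: "inj_on fst ?R"
    proof (rule inj_onI)
      fix p q assume p: "p \<in> ?R" "q \<in> ?R" "fst p = fst q"
      then have m: "fst p \<in> fibre x" "snd p \<in> fibre x" "snd q \<in> fibre x" using a by auto
      have "snd p = snd q"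
        using p T_dv_unique[OF m(2,3,1), of "st s"] T_dv_swap[OF m(1,2), of s] T_dv_swap[OF m(1,3), of s] by simp
      then show "p = q" using p(3) prod_eqI by blast
    qed
    have i2: "inj_on snd ?R"
    proof (rule inj_onI)
      fix p q assume p: "p \<in> ?R" "q \<in> ?R" "snd p = snd q"
      then have m: "fst p \<in> fibre x" "fst q \<in> fibre x" "snd q \<in> fibre x" using a by auto
      have "fst p = fst q" using p T_dv_unique[OF m, of s] by simp
      then show "p = q" using p(3) prod_eqI by blast
    qed
    have "(\<Sum>p\<in>?R. (cmod (w (fst p)))\<^sup>2) = (\<Sum>\<gamma>\<in>fst ` ?R. (cmod (w \<gamma>))\<^sup>2)"
      using sum.reindex[OF i1, of "\<lambda>\<gamma>. (cmod (w \<gamma>))\<^sup>2"] by simp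
    also have "\<dots> \<le> (\<Sum>\<gamma>\<in>A. (cmod (w \<gamma>))\<^sup>2)" using a by (intro sum_mono2) auto
    finally show "L2_set (\<lambda>p. cmod (w (fst p))) ?R \<le> l2 w A" by (simp add: L2_set_def)
    have "(\<Sum>p\<in>?R. (cmod (v (snd p)))\<^sup>2) = (\<Sum>\<gamma>\<in>snd ` ?R. (cmod (v \<gamma>))\<^sup>2)"
      using sum.reindex[OF i2, of "\<lambda>\<gamma>. (cmod (v \<gamma>))\<^sup>2"] by simp
    also have "\<dots> \<le> (\<Sum>\<gamma>\<in>F. (cmod (v \<gamma>))\<^sup>2)" using a by (intro sum_mono2) auto
    finally show "L2_set (\<lambda>p. cmod (v (snd p))) ?R \<le> l2 v F" by (simp add: L2_set_def)
  qed (simp_all add: L2_set_nonneg)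
  finally show "cmod (bform (T s) w v A F)
      \<le> 1 * l2 w A * l2 v F" by simp
qed simp

section \<open>Linear spans of the \<open>T s\<close> and the dense subalgebras\<close>

inductive_set tspan :: "'a set \<Rightarrow> ('a germ \<Rightarrow> complex) set" for P where
  tspan_0: "(\<lambda>_. 0) \<in> tspan P"
| tspan_Cons: "s \<in> P \<Longrightarrow> f \<in> tspan P \<Longrightarrow> (\<lambda>\<gamma>. c * T s \<gamma> + f \<gamma>) \<in> tspan P"

lemma tspan_T: "s \<in> P \<Longrightarrow> T s \<in> tspan P"
  using tspan_Cons[OF _ tspan_0, of s P 1] by simp

lemma tspan_add: assumes "f \<in> tspan P" "g \<in> tspan P" shows "(\<lambda>\<gamma>. f \<gamma> + g \<gamma>) \<in> tspan P"
  using assms(1)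
proof induction
  case (tspan_Cons s f c)
  then show ?case using tspan.tspan_Cons[of s P _ c] by (simp add: add.assoc)
qed (use assms in simp)

lemma tspan_scale: assumes "f \<in> tspan P" shows "(\<lambda>\<gamma>. c * f \<gamma>) \<in> tspan P"
  using assms
proof induction
  case (tspan_Cons s f d)
  then show ?case using tspan.tspan_Cons[of s P _ "c * d"] by (simp add: algebra_simps)
qed (auto intro: tspan.intros)

lemma tspan_mono: assumes "f \<in> tspan P" "P \<subseteq> Q" shows "f \<in> tspan Q"
  using assms by induction (auto intro: tspan.intros)

lemma tspan_opb: assumes "f \<in> tspan P" shows "\<exists>r. op_bound f r"
  using assms
proof induction
  case tspan_0
  then show ?case using op_bound_0 by blast
next
  case (tspan_Cons s f c)
  then show ?case using op_bound_add[OF op_bound_scale[OF op_bound_T]] by blast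
qed

lemma tspan_off: assumes "f \<in> tspan P" "\<gamma> \<notin> Gt m" shows "f \<gamma> = 0"
  using assms by induction (auto simp: T_off)

lemma tspan_conv_T: assumes "f \<in> tspan P" "\<And>s. s \<in> P \<Longrightarrow> s \<odot> t \<in> Q" shows "conv m f (T t) \<in> tspan Q"
  using assms(1)
proof induction
  case tspan_0
  have "conv m (\<lambda>_. 0) (T t) = (\<lambda>_. 0)" by (auto simp: conv_def)
  then show ?case using tspan.tspan_0 by simp
next
  case (tspan_Cons s f c)
  obtain r where r: "op_bound f r" using tspan_Cons tspan_opb by blast
  have "conv m (\<lambda>\<gamma>. c * T s \<gamma> + f \<gamma>) (T t) = (\<lambda>\<gamma>. c * T (s \<odot> t) \<gamma> + conv m f (T t) \<gamma>)"
    using conv_add_left[OF op_bound_scale[OF op_bound_T] r op_bound_T, of c s t] conv_scale_left[OF op_bound_T op_bound_T, of c s t] by (simp add: conv_T_T)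
  then show ?case using tspan_Cons assms(2) by (simp add: tspan.tspan_Cons)
qed

lemma tspan_conv: assumes f: "f \<in> tspan P" and g: "g \<in> tspan Q" and PQ: "\<And>s t. s \<in> P \<Longrightarrow> t \<in> Q \<Longrightarrow> s \<odot> t \<in> R"
  shows "conv m f g \<in> tspan R"
  using g
proof induction
  case tspan_0
  have "conv m f (\<lambda>_. 0) = (\<lambda>_. 0)" by (auto simp: conv_def)
  then show ?case using tspan.tspan_0 by simp
next
  case (tspan_Cons t g c)
  obtain r s where r: "op_bound f r" "op_bound g s" using tspan_Cons tspan_opb f by blast
  have "conv m f (\<lambda>\<gamma>. c * T t \<gamma> + g \<gamma>) = (\<lambda>\<gamma>. c * conv m f (T t) \<gamma> + conv m f g \<gamma>)"
    using conv_add_right[OF r(1) op_bound_scale[OF op_bound_T] r(2), of c t] conv_scale_right[OF r(1) op_bound_T, of c t] by simp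
  then show ?case using tspan_Cons tspan_conv_T[OF f, of t R] PQ tspan_add tspan_scale by simp
qed

lemma adj_T: "adj m (T s) = T (st s)"
proof
  fix \<gamma> show "adj m (T s) \<gamma> = T (st s) \<gamma>"
  proof (cases "\<gamma> \<in> Gt m")
    case True
    have "cnj (T s (ginv m \<gamma>)) = T s (ginv m \<gamma>)" by (simp add: Tgen_def indicator_def)
    then show ?thesis using T_ginv[OF Gt_fibre(1)[OF True]] True by (simp add: adj_def)
  qed (simp add: adj_def T_off)
qed

lemma tspan_adj: assumes "f \<in> tspan P" "\<And>s. s \<in> P \<Longrightarrow> st s \<in> P" shows "adj m f \<in> tspan P"
  using assms(1)
proof induction
  case tspan_0
  have "adj m (\<lambda>_. 0) = (\<lambda>_. 0)" by (auto simp: adj_def)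
  then show ?case using tspan.tspan_0 by simp
next
  case (tspan_Cons s f c)
  have "adj m (\<lambda>\<gamma>. c * T s \<gamma> + f \<gamma>) = (\<lambda>\<gamma>. cnj c * adj m (T s) \<gamma> + adj m f \<gamma>)" by (auto simp: adj_def)
  then show ?case using tspan_Cons assms(2) by (simp add: adj_T tspan.tspan_Cons)
qed

lemma T_mult_idem: assumes "e \<in> E" shows "T (s \<odot> e) \<gamma> = T s \<gamma> * indicator (Dset m e) (gdom m \<gamma>)"
proof (cases "\<gamma> \<in> Gt m")
  case True
  let ?x = "gdom m \<gamma>"
  have g: "\<gamma> \<in> fibre ?x" using Gt_fibre True by blast
  have x: "?x \<in> tight m" "is_filter m ?x" using fibre_tight g tight_filter by blast+
  have "st (s \<odot> e) \<odot> (s \<odot> e) = e \<odot> (st s \<odot> s) \<odot> e" by (simp add: star_idem[OF assms] assoc)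
  then have "st (s \<odot> e) \<odot> (s \<odot> e) = e \<odot> (st s \<odot> s)"
    using idem_comm[OF idem_mult[OF assms star_mult_idem(1)[of s]] assms] idem_dup(2)[OF assms] by simp
  then have "st (s \<odot> e) \<odot> (s \<odot> e) \<in> ?x \<longleftrightarrow> e \<in> ?x \<and> st s \<odot> s \<in> ?x"
    using filter_mult_iff[OF x(2) assms] by simp
  then show ?thesis using germ_mult_idem[OF x(1)] T_fibre[OF g] x(1) by (auto simp: Dset_def indicator_def)
qed (simp add: T_off)

lemma indicator_bis:
  assumes "U \<subseteq> Dset m (st s \<odot> s)"
  shows "indicator (bis m s U) \<gamma> = T s \<gamma> * (indicator U (gdom m \<gamma>) :: complex)"
proof -
  have d: "gdom m (germ m s \<xi>) = \<xi>" if "\<xi> \<in> Dset m (st s \<odot> s)" for \<xi> using gdom_germ that by (simp add: Dset_def)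
  have "\<gamma> \<in> bis m s U \<longleftrightarrow> \<gamma> \<in> bis m s (Dset m (st s \<odot> s)) \<and> gdom m \<gamma> \<in> U"
  proof
    assume "\<gamma> \<in> bis m s U"
    then obtain \<xi> where "\<gamma> = germ m s \<xi>" "\<xi> \<in> U" by (auto simp: bis_def)
    then show "\<gamma> \<in> bis m s (Dset m (st s \<odot> s)) \<and> gdom m \<gamma> \<in> U" using d assms by (auto simp: bis_def)
  next
    assume "\<gamma> \<in> bis m s (Dset m (st s \<odot> s)) \<and> gdom m \<gamma> \<in> U"
    then obtain \<xi> where "\<gamma> = germ m s \<xi>" "\<xi> \<in> Dset m (st s \<odot> s)" "gdom m \<gamma> \<in> U" by (auto simp: bis_def)
    then show "\<gamma> \<in> bis m s U" using d by (auto simp: bis_def)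
  qed
  then show ?thesis by (auto simp: Tgen_def indicator_def)
qed

lemma dspan_tspan:
  assumes "g \<in> dspan" "s \<in> P" "\<And>s e. s \<in> P \<Longrightarrow> e \<in> E \<Longrightarrow> s \<odot> e \<in> P"
  shows "(\<lambda>\<gamma>. T s \<gamma> * g (gdom m \<gamma>)) \<in> tspan P"
  using assms(1)
proof induction
  case (dspan_Cons e f c)
  have "(\<lambda>\<gamma>. T s \<gamma> * (c * indicator (Dset m e) (gdom m \<gamma>) + f (gdom m \<gamma>))) =
    (\<lambda>\<gamma>. c * T (s \<odot> e) \<gamma> + T s \<gamma> * f (gdom m \<gamma>))"
    using dspan_Cons by (simp add: T_mult_idem algebra_simps)
  then show ?case using dspan_Cons assms(2,3) by (simp add: tspan.tspan_Cons)
qed (auto intro: tspan.intros)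

lemma sum_tspan: "finite J \<Longrightarrow> (\<And>j. j \<in> J \<Longrightarrow> f j \<in> tspan P) \<Longrightarrow> (\<lambda>\<gamma>. \<Sum>j\<in>J. f j \<gamma>) \<in> tspan P"
  by (induction J rule: finite_induct) (auto intro: tspan_add tspan.intros)

text \<open>The indicator of a compact open set is a combination of indicators of sets
  \<open>Dset m e\<close>, and cutting \<open>T s\<close> down to \<open>Dset m e\<close> gives
  \<open>T (s \<odot> e)\<close>; this is where closure of \<open>P\<close> under right
  multiplication by idempotents is used.\<close>

lemma steinberg_eq:
  assumes P: "\<And>s e. s \<in> P \<Longrightarrow> e \<in> E \<Longrightarrow> s \<odot> e \<in> P"
  shows "steinberg m (\<lambda>s. s \<in> P) = tspan P"
proof (intro set_eqI iffI)
  fix f assume "f \<in> steinberg m (\<lambda>s. s \<in> P)"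
  then obtain n :: nat and c s U where U: "\<And>i. i < n \<Longrightarrow> s i \<in> P \<and> U i \<subseteq> Dset m (st (s i) \<odot> s i) \<and>
        openin (tight_top m) (U i) \<and> compactin (tight_top m) (U i)"
    and f: "f = (\<lambda>\<gamma>. \<Sum>i<n. c i * indicator (bis m (s i) (U i)) \<gamma>)"
    unfolding steinberg_def by blast
  have "(\<lambda>\<gamma>. c i * indicator (bis m (s i) (U i)) \<gamma>) \<in> tspan P" if "i < n" for i
  proof -
    have "indicator (U i) \<in> dspan" using compact_open_dring U[OF that] by (simp add: dset_ring_def)
    then have "(\<lambda>\<gamma>. T (s i) \<gamma> * indicator (U i) (gdom m \<gamma>)) \<in> tspan P"
      using dspan_tspan P U[OF that] by blast
    then show ?thesis using tspan_scale indicator_bis U[OF that] by simp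
  qed
  then show "f \<in> tspan P" unfolding f by (intro sum_tspan) auto
next
  fix f assume "f \<in> tspan P"
  then show "f \<in> steinberg m (\<lambda>s. s \<in> P)"
  proof induction
    case tspan_0
    show ?case unfolding steinberg_def by (intro CollectI exI[of _ 0]) auto
  next
    case (tspan_Cons t f d)
    then obtain n :: nat and c s U where U: "\<And>i. i < n \<Longrightarrow> s i \<in> P \<and> U i \<subseteq> Dset m (st (s i) \<odot> s i) \<and>
        openin (tight_top m) (U i) \<and> compactin (tight_top m) (U i)"
      and f: "f = (\<lambda>\<gamma>. \<Sum>i<n. c i * indicator (bis m (s i) (U i)) \<gamma>)"
      unfolding steinberg_def by blast
    let ?D = "Dset m (st t \<odot> t)"
    show ?case unfolding steinberg_def
    proof (intro CollectI exI conjI)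
      show "\<forall>i<Suc n. (s(n := t)) i \<in> P \<and> (U(n := ?D)) i \<subseteq> Dset m (st ((s(n := t)) i) \<odot> (s(n := t)) i) \<and>
        openin (tight_top m) ((U(n := ?D)) i) \<and> compactin (tight_top m) ((U(n := ?D)) i)"
        using U tspan_Cons(1) open_Dset compact_Dset by (auto simp: less_Suc_eq)
      show "(\<lambda>\<gamma>. d * T t \<gamma> + f \<gamma>) = (\<lambda>\<gamma>. \<Sum>i<Suc n. (c(n := d)) i * indicator (bis m ((s(n := t)) i) ((U(n := ?D)) i)) \<gamma>)"
        unfolding f by (simp add: Tgen_def add.commute)
    qed
  qed
qed

lemma norm_closureI:
  assumes "\<And>\<gamma>. \<gamma> \<notin> Gt m \<Longrightarrow> g \<gamma> = 0" "\<And>n. f n \<in> A" "\<And>n. op_bound (\<lambda>\<gamma>. f n \<gamma> - g \<gamma>) (r n)" "r \<longlonglongrightarrow> 0"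
  shows "g \<in> norm_closure m A"
proof -
  have "(\<lambda>n. ennreal ((r n)\<^sup>2)) \<longlonglongrightarrow> ennreal (0\<^sup>2)"
    by (intro tendsto_intros assms(4))
  then have z: "(\<lambda>n. ennreal ((r n)\<^sup>2)) \<longlonglongrightarrow> 0" by simp
  have "(\<lambda>n. rnorm2 m (\<lambda>\<gamma>. f n \<gamma> - g \<gamma>)) \<longlonglongrightarrow> 0"
    by (rule tendsto_sandwich[OF _ _ tendsto_const z]) (use rnorm2_le[OF assms(3)] in simp_all)
  then show ?thesis using assms(1,2) unfolding norm_closure_def by blast
qed

lemma norm_closureD:
  assumes "g \<in> norm_closure m A" "0 < \<epsilon>"
  shows "\<exists>f\<in>A. op_bound (\<lambda>\<gamma>. f \<gamma> - g \<gamma>) \<epsilon>"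
proof -
  obtain f where f: "\<And>n. f n \<in> A" "(\<lambda>n. rnorm2 m (\<lambda>\<gamma>. f n \<gamma> - g \<gamma>)) \<longlonglongrightarrow> 0"
    using assms(1) unfolding norm_closure_def by blast
  have "eventually (\<lambda>n. rnorm2 m (\<lambda>\<gamma>. f n \<gamma> - g \<gamma>) < ennreal (\<epsilon>\<^sup>2)) sequentially"
    using order_tendstoD(2)[OF f(2), of "ennreal (\<epsilon>\<^sup>2)"] assms(2) by simp
  then obtain n where "rnorm2 m (\<lambda>\<gamma>. f n \<gamma> - g \<gamma>) < ennreal (\<epsilon>\<^sup>2)"
    unfolding eventually_sequentially by blast
  then have "op_bound (\<lambda>\<gamma>. f n \<gamma> - g \<gamma>) \<epsilon>" using assms(2) by (intro op_bound_of_rnorm2) auto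
  then show ?thesis using f(1) by blast
qed

lemma norm_closure_mono: "A \<subseteq> B \<Longrightarrow> norm_closure m A \<subseteq> norm_closure m B"
  unfolding norm_closure_def by blast

lemma Cred_UNIV: "Cred m (\<lambda>_. True) = norm_closure m (tspan UNIV)"
  using steinberg_eq[of UNIV] by (simp add: Cred_def)

lemma Cred_Iso: "Cred m (\<lambda>s. s \<in> Iso) = norm_closure m (tspan Iso)"
  using steinberg_eq[of Iso] iso_mult idem_iso by (simp add: Cred_def)

lemma norm_closure_superset: assumes "f \<in> tspan P" shows "f \<in> norm_closure m (tspan P)"
  using assms op_bound_0 by (intro norm_closureI[of _ "\<lambda>_. f" _ "\<lambda>_. 0"]) (auto simp: tspan_off)

lemma Cred_opb: assumes "g \<in> Cred m (\<lambda>_. True)" shows "\<exists>r. op_bound g r"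
proof -
  obtain f where f: "f \<in> tspan UNIV" "op_bound (\<lambda>\<gamma>. f \<gamma> - g \<gamma>) 1"
    using norm_closureD[of g _ 1] assms unfolding Cred_UNIV by auto
  obtain r where "op_bound f r" using tspan_opb f by blast
  then have "op_bound g (r + 1)" using op_bound_diff[OF _ f(2)] by fastforce
  then show ?thesis by blast
qed

end

section \<open>Bernstein polynomials\<close>

definition bmon :: "nat \<Rightarrow> nat \<Rightarrow> real poly" where
  "bmon i j = [:0, 1:] ^ i * [:1, -1:] ^ j"

lemma poly_bmon [simp]: "poly (bmon i j) x = x ^ i * (1 - x) ^ j"
  by (simp add: bmon_def)

text \<open>Certificates of nonnegativity on the unit interval that survive the substitution of an
  operator between 0 and 1, since each generator \<open>bmon i j\<close> becomes a positive
  operator.\<close>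

inductive_set cone :: "real poly set" where
  cone_0: "0 \<in> cone"
| cone_Cons: "c \<ge> 0 \<Longrightarrow> p \<in> cone \<Longrightarrow> smult c (bmon i j) + p \<in> cone"

lemma cone_bmon: "c \<ge> 0 \<Longrightarrow> smult c (bmon i j) \<in> cone"
  using cone_Cons[OF _ cone_0, of c i j] by simp

lemma cone_add: assumes "p \<in> cone" "q \<in> cone" shows "p + q \<in> cone"
  using assms(1) by induction (use assms(2) in \<open>auto simp: add.assoc intro: cone.intros\<close>)

lemma cone_sum: "finite J \<Longrightarrow> (\<And>j. j \<in> J \<Longrightarrow> f j \<in> cone) \<Longrightarrow> sum f J \<in> cone"
  by (induction J rule: finite_induct) (auto intro: cone_0 cone_add)

lemma cone_smult: assumes "p \<in> cone" "c \<ge> 0" shows "smult c p \<in> cone"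
  using assms(1) by induction (use assms(2) in \<open>auto simp: smult_add_right intro: cone.intros\<close>)

lemma cone_mult_bmon: assumes "p \<in> cone" shows "bmon i j * p \<in> cone"
  using assms
proof induction
  case (cone_Cons c p k l)
  have "bmon i j * (smult c (bmon k l) + p) = smult c (bmon (i + k) (j + l)) + bmon i j * p"
    by (simp add: bmon_def power_add algebra_simps)
  then show ?case using cone_Cons cone.cone_Cons by simp
qed (auto intro: cone_0)

lemma cone_mult: assumes "p \<in> cone" "q \<in> cone" shows "p * q \<in> cone"
  using assms(1)
proof induction
  case (cone_Cons c p k l)
  have "(smult c (bmon k l) + p) * q = smult c (bmon k l * q) + p * q" by (simp add: algebra_simps)
  then show ?case using cone_Cons cone_add cone_smult cone_mult_bmon[OF assms(2)] by simp
qed (auto intro: cone_0)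

text \<open>Factor the difference of squares. A two-sided bound on \<open>p\<close> becomes a bound
  on its square, which for a selfadjoint operator is a norm bound.\<close>

lemma cone_square_bound:
  assumes "[:C:] - p \<in> cone" "[:C:] + p \<in> cone"
  shows "[:C\<^sup>2:] - p * p \<in> cone"
proof -
  have "[:C\<^sup>2:] - p * p = ([:C:] - p) * ([:C:] + p)"
    by (subst poly_eq_poly_eq_iff[symmetric]) (simp add: fun_eq_iff algebra_simps power2_eq_square)
  then show ?thesis using cone_mult assms by metis
qed

definition bern :: "nat \<Rightarrow> nat \<Rightarrow> real poly" where
  "bern n k = smult (real (n choose k)) (bmon k (n - k))"

lemma poly_bern: "poly (bern n k) x = Bernstein n k x"
  by (simp add: bern_def Bernstein_def)

definition bernp :: "(real \<Rightarrow> real) \<Rightarrow> nat \<Rightarrow> real poly" where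
  "bernp f n = (\<Sum>k\<le>n. smult (f (real k / real n)) (bern n k))"

lemma poly_bernp: "poly (bernp f n) x = (\<Sum>k\<le>n. f (real k / real n) * Bernstein n k x)"
  by (simp add: bernp_def poly_sum poly_bern)

lemma bern_cone: "bern n k \<in> cone"
  unfolding bern_def by (intro cone_bmon) simp

lemma sum_lin_Bernstein:
  assumes "n > 0" shows "(\<Sum>k\<le>n. real k / real n * Bernstein n k x) = x"
proof -
  have "(\<Sum>k\<le>n. real k / real n * Bernstein n k x) = (\<Sum>k\<le>n. real k * Bernstein n k x) / real n"
    unfolding sum_divide_distrib by (intro sum.cong refl) simp
  then show ?thesis using assms by simp
qed

text \<open>Bernstein polynomials reproduce affine functions, so the difference is the combination
  of the \<open>bern n k\<close> with the nonnegative values of \<open>f t - (t - c)\<close> as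
  coefficients.\<close>

lemma bernp_ge_linear:
  assumes n: "n > 0" and f: "\<And>t. f t \<ge> t - c"
  shows "bernp f n - [:-c, 1:] \<in> cone"
proof -
  have "poly (bernp f n - [:-c, 1:]) x = poly (\<Sum>k\<le>n. smult (f (real k / real n) - (real k / real n - c)) (bern n k)) x" for x
  proof -
    have 1: "(\<Sum>k\<le>n. real k / real n * Bernstein n k x) = x" using sum_lin_Bernstein[OF n] .
    have 2: "(\<Sum>k\<le>n. c * Bernstein n k x) = c" by (simp flip: sum_distrib_left)
    show ?thesis using 1 2
      by (simp add: poly_bernp poly_sum poly_bern left_diff_distrib sum_subtractf)
  qed
  then have "bernp f n - [:-c, 1:] = (\<Sum>k\<le>n. smult (f (real k / real n) - (real k / real n - c)) (bern n k))"
    by (subst poly_eq_poly_eq_iff[symmetric]) (rule ext)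
  moreover have "\<dots> \<in> cone" using f bern_cone by (intro cone_sum cone_smult) (auto simp: algebra_simps)
  ultimately show ?thesis by simp
qed

text \<open>The second moment of the binomial distribution with parameters \<open>n\<close> and
  \<open>x\<close>, rescaled by \<open>n\<close>; the variance is the second summand.\<close>

lemma sum_sq_Bernstein:
  assumes n: "n > 0"
  shows "(\<Sum>k\<le>n. (real k / real n)\<^sup>2 * Bernstein n k x) = x\<^sup>2 + x * (1 - x) / real n"
proof -
  have "(\<Sum>k\<le>n. (real k / real n)\<^sup>2 * Bernstein n k x) =
     ((\<Sum>k\<le>n. real k * (real k - 1) * Bernstein n k x) + (\<Sum>k\<le>n. real k * Bernstein n k x)) / (real n)\<^sup>2"
    unfolding sum.distrib[symmetric] sum_divide_distrib
    by (intro sum.cong refl) (simp add: power2_eq_square field_simps)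
  also have "\<dots> = (real n * (real n - 1) * x\<^sup>2 + real n * x) / (real n)\<^sup>2" by simp
  also have "\<dots> = x\<^sup>2 + x * (1 - x) / real n" using n by (simp add: power2_eq_square field_simps)
  finally show ?thesis .
qed

text \<open>For two independent rescaled binomial variables with the same mean \<open>x\<close>, the
  mean square of the difference is the sum of the variances.\<close>

lemma sum_Bernstein_double:
  assumes "n > 0" "m > 0"
  shows "(\<Sum>k\<le>n. \<Sum>l\<le>m. (real k / real n - real l / real m)\<^sup>2 * (Bernstein n k x * Bernstein m l x))
    = x * (1 - x) * (1 / real n + 1 / real m)"
proof -
  let ?B = "Bernstein n" and ?C = "Bernstein m"
  have "(\<Sum>k\<le>n. \<Sum>l\<le>m. (real k / real n - real l / real m)\<^sup>2 * (?B k x * ?C l x))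
    = (\<Sum>k\<le>n. \<Sum>l\<le>m. ((real k / real n)\<^sup>2 * ?B k x) * ?C l x) + (\<Sum>k\<le>n. \<Sum>l\<le>m. ?B k x * ((real l / real m)\<^sup>2 * ?C l x))
      - 2 * (\<Sum>k\<le>n. \<Sum>l\<le>m. (real k / real n * ?B k x) * (real l / real m * ?C l x))"
    unfolding sum_distrib_left sum.distrib[symmetric] sum_subtractf[symmetric]
    by (intro sum.cong refl) (simp add: power2_diff algebra_simps)
  also have "\<dots> = (x\<^sup>2 + x * (1 - x) / real n) + (x\<^sup>2 + x * (1 - x) / real m) - 2 * (x * x)"
    unfolding sum_product[symmetric] sum_sq_Bernstein[OF assms(1)] sum_sq_Bernstein[OF assms(2)] sum_lin_Bernstein[OF assms(1)] sum_lin_Bernstein[OF assms(2)] sum_Bernstein by simp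
  also have "\<dots> = x * (1 - x) * (1 / real n + 1 / real m)"
    by (simp add: power2_eq_square algebra_simps diff_divide_distrib)
  finally show ?thesis .
qed

text \<open>For a 1-Lipschitz \<open>f\<close> the difference \<open>f s - f t\<close> is at most
  \<open>\<bar>s - t\<bar>\<close>, hence at most \<open>\<theta> + (s - t)^2 / \<theta>\<close>.
  Averaging this over the product of the two Bernstein weights keeps all coefficients
  \<open>?a k l\<close> nonnegative, and the averaged square is small by
  \<open>sum_Bernstein_double\<close>.\<close>

lemma bernp_Cauchy:
  assumes nm: "n > 0" "m > 0" and \<theta>: "\<theta> > 0" and f: "\<And>s t. \<bar>f s - f t\<bar> \<le> \<bar>s - t\<bar>"
  shows "[:\<theta> + (1 / real n + 1 / real m) / \<theta>:] - (bernp f n - bernp f m) \<in> cone"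
proof -
  let ?a = "\<lambda>k l. \<theta> + (real k / real n - real l / real m)\<^sup>2 / \<theta> - (f (real k / real n) - f (real l / real m))"
  let ?e = "(1 / real n + 1 / real m) / \<theta>"
  let ?q = "(\<Sum>k\<le>n. \<Sum>l\<le>m. smult (?a k l) (bern n k * bern m l)) + smult ?e (bmon 0 1 + bmon 2 0)"
  have a: "?a k l \<ge> 0" for k l
  proof -
    let ?d = "real k / real n - real l / real m"
    have "f (real k / real n) - f (real l / real m) \<le> \<bar>?d\<bar>" using f[of "real k / real n" "real l / real m"] by linarith
    also have "\<bar>?d\<bar> \<le> \<theta> + ?d\<^sup>2 / \<theta>"
    proof (cases "\<bar>?d\<bar> \<le> \<theta>")
      case True
      have "?d\<^sup>2 / \<theta> \<ge> 0" using \<theta> by simp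
      then show ?thesis using True by linarith
    next
      case False
      then have "\<bar>?d\<bar> * \<theta> \<le> ?d\<^sup>2" using mult_left_mono[of \<theta> "\<bar>?d\<bar>" "\<bar>?d\<bar>"] by (simp add: power2_eq_square abs_mult_self_eq)
      then have "\<bar>?d\<bar> \<le> ?d\<^sup>2 / \<theta>" using \<theta> by (simp add: pos_le_divide_eq)
      then show ?thesis using \<theta> by linarith
    qed
    finally show ?thesis by linarith
  qed
  have "poly ([:\<theta> + ?e:] - (bernp f n - bernp f m)) x = poly ?q x" for x
  proof -
    have 1: "(\<Sum>k\<le>n. \<Sum>l\<le>m. \<theta> * (Bernstein n k x * Bernstein m l x)) = \<theta>"
      unfolding sum_distrib_left[symmetric] sum_product[symmetric] sum_Bernstein by simp
    have 2: "(\<Sum>k\<le>n. \<Sum>l\<le>m. f (real k / real n) * (Bernstein n k x * Bernstein m l x)) = poly (bernp f n) x"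
      unfolding mult.assoc[symmetric] sum_product[symmetric] sum_Bernstein poly_bernp by simp
    have 3: "(\<Sum>k\<le>n. \<Sum>l\<le>m. f (real l / real m) * (Bernstein n k x * Bernstein m l x)) = poly (bernp f m) x"
      unfolding mult.left_commute[of "f _"] sum_product[symmetric] sum_Bernstein poly_bernp by simp
    have 4: "(\<Sum>k\<le>n. \<Sum>l\<le>m. (real k / real n - real l / real m)\<^sup>2 / \<theta> * (Bernstein n k x * Bernstein m l x))
       = x * (1 - x) * (1 / real n + 1 / real m) / \<theta>"
      unfolding sum_Bernstein_double[OF nm, symmetric] sum_divide_distrib by simp
    have "(\<Sum>k\<le>n. \<Sum>l\<le>m. ?a k l * (Bernstein n k x * Bernstein m l x)) =
        (\<Sum>k\<le>n. \<Sum>l\<le>m. \<theta> * (Bernstein n k x * Bernstein m l x))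
      + (\<Sum>k\<le>n. \<Sum>l\<le>m. (real k / real n - real l / real m)\<^sup>2 / \<theta> * (Bernstein n k x * Bernstein m l x))
      - ((\<Sum>k\<le>n. \<Sum>l\<le>m. f (real k / real n) * (Bernstein n k x * Bernstein m l x))
        - (\<Sum>k\<le>n. \<Sum>l\<le>m. f (real l / real m) * (Bernstein n k x * Bernstein m l x)))"
      unfolding sum.distrib[symmetric] sum_subtractf[symmetric]
      by (intro sum.cong refl) (simp only: left_diff_distrib distrib_right)
    then have A: "(\<Sum>k\<le>n. \<Sum>l\<le>m. ?a k l * (Bernstein n k x * Bernstein m l x)) =
      \<theta> + x * (1 - x) * (1 / real n + 1 / real m) / \<theta> - (poly (bernp f n) x - poly (bernp f m) x)"
      unfolding 1 2 3 4 .
    \<comment> \<open>The average only produces \<open>?e\<close> times \<open>x * (1 - x)\<close>.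
      The missing part of the constant \<open>?e\<close> is itself a cone element, because
      \<open>x(1-x) + (1-x) + x^2 = 1\<close>.\<close>
    have B: "?e = x * (1 - x) * (1 / real n + 1 / real m) / \<theta> + ?e * ((1 - x) + x\<^sup>2)"
    proof -
      have "e = x * (1 - x) * e + e * ((1 - x) + x\<^sup>2)" for e :: real
        by (simp add: power2_eq_square algebra_simps)
      from this[of ?e] show ?thesis by (simp only: times_divide_eq_right)
    qed
    have "poly ?q x = (\<Sum>k\<le>n. \<Sum>l\<le>m. ?a k l * (Bernstein n k x * Bernstein m l x)) + ?e * ((1 - x) + x\<^sup>2)"
      by (simp only: poly_add poly_sum poly_smult poly_mult poly_bern poly_bmon power_0 power_one_right mult_1_left mult_1_right)
    also have "\<dots> = \<theta> + ?e - (poly (bernp f n) x - poly (bernp f m) x)" using A B by linarith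
    finally show ?thesis by (simp only: poly_diff poly_pCons poly_0 mult_zero_right add_0_right)
  qed
  then have "[:\<theta> + ?e:] - (bernp f n - bernp f m) = ?q"
    by (subst poly_eq_poly_eq_iff[symmetric]) (rule ext)
  moreover have "?q \<in> cone"
    using a \<theta> cone_bmon[of 1] by (intro cone_add cone_sum cone_smult cone_mult bern_cone) auto
  ultimately show ?thesis by simp
qed

section \<open>Fibrewise finitely supported functions\<close>

context inverse_semigroup_zero
begin

text \<open>A class that contains the span of the \<open>T s\<close>, the function
  \<open>one\<close> and the finitely supported vectors. Operators and vectors can therefore be
  treated alike, and convolution with a right factor from it is a finite sum.\<close>

definition fin_fibres :: "('a germ \<Rightarrow> complex) \<Rightarrow> bool" where
  "fin_fibres g \<longleftrightarrow> (\<forall>\<gamma>. \<gamma> \<notin> Gt m \<longrightarrow> g \<gamma> = 0) \<and> (\<forall>x. finite {\<gamma> \<in> fibre x. g \<gamma> \<noteq> 0})"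

lemma fin_fibres_off: "fin_fibres g \<Longrightarrow> \<gamma> \<notin> Gt m \<Longrightarrow> g \<gamma> = 0"
  and fin_fibres_fin: "fin_fibres g \<Longrightarrow> finite {\<gamma> \<in> fibre x. g \<gamma> \<noteq> 0}"
  by (simp_all add: fin_fibres_def)

lemma fin_fibresI: "(\<And>\<gamma>. \<gamma> \<notin> Gt m \<Longrightarrow> g \<gamma> = 0) \<Longrightarrow> (\<And>x. finite {\<gamma> \<in> fibre x. g \<gamma> \<noteq> 0}) \<Longrightarrow> fin_fibres g"
  by (simp add: fin_fibres_def)

lemma fin_fibres_0: "fin_fibres (\<lambda>_. 0)"
  by (rule fin_fibresI) simp_all

lemma fin_fibres_add: assumes "fin_fibres f" "fin_fibres g" shows "fin_fibres (\<lambda>\<gamma>. f \<gamma> + g \<gamma>)"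
proof (rule fin_fibresI)
  fix x
  have "{\<gamma> \<in> fibre x. f \<gamma> + g \<gamma> \<noteq> 0} \<subseteq> {\<gamma> \<in> fibre x. f \<gamma> \<noteq> 0} \<union> {\<gamma> \<in> fibre x. g \<gamma> \<noteq> 0}" by auto
  then show "finite {\<gamma> \<in> fibre x. f \<gamma> + g \<gamma> \<noteq> 0}"
    by (rule finite_subset) (intro finite_UnI fin_fibres_fin assms)
qed (simp add: fin_fibres_off[OF assms(1)] fin_fibres_off[OF assms(2)])

lemma fin_fibres_scale: assumes "fin_fibres f" shows "fin_fibres (\<lambda>\<gamma>. c * f \<gamma>)"
proof (rule fin_fibresI)
  fix x
  have "{\<gamma> \<in> fibre x. c * f \<gamma> \<noteq> 0} \<subseteq> {\<gamma> \<in> fibre x. f \<gamma> \<noteq> 0}" by auto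
  then show "finite {\<gamma> \<in> fibre x. c * f \<gamma> \<noteq> 0}"
    by (rule finite_subset) (intro fin_fibres_fin assms)
qed (simp add: fin_fibres_off[OF assms])

lemma fin_fibres_T: "fin_fibres (T s)"
proof (rule fin_fibresI)
  fix x
  have "{\<gamma> \<in> fibre x. T s \<gamma> \<noteq> 0} \<subseteq> {germ m s x}" using T_fibre[of _ x s] by (auto split: if_splits)
  then show "finite {\<gamma> \<in> fibre x. T s \<gamma> \<noteq> 0}" by (rule finite_subset) simp
qed (simp add: T_off)

lemma fin_fibres_tspan: assumes "f \<in> tspan P" shows "fin_fibres f"
  using assms by induction (simp_all add: fin_fibres_0 fin_fibres_add fin_fibres_scale fin_fibres_T)

lemma fin_fibres_fin_dv: assumes "fin_fibres g" "\<beta> \<in> fibre x" shows "finite {\<alpha> \<in> fibre x. g (gdiv \<alpha> \<beta>) \<noteq> 0}"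
proof (rule finite_imageD[of "\<lambda>\<alpha>. gdiv \<alpha> \<beta>"])
  have "(\<lambda>\<alpha>. gdiv \<alpha> \<beta>) ` {\<alpha> \<in> fibre x. g (gdiv \<alpha> \<beta>) \<noteq> 0} \<subseteq> {\<gamma> \<in> fibre (grange \<beta>). g \<gamma> \<noteq> 0}"
    using gdiv_fibre[OF _ assms(2)] by auto
  then show "finite ((\<lambda>\<alpha>. gdiv \<alpha> \<beta>) ` {\<alpha> \<in> fibre x. g (gdiv \<alpha> \<beta>) \<noteq> 0})"
    by (rule finite_subset) (intro fin_fibres_fin assms)
  show "inj_on (\<lambda>\<alpha>. gdiv \<alpha> \<beta>) {\<alpha> \<in> fibre x. g (gdiv \<alpha> \<beta>) \<noteq> 0}"
    using gdiv_inj[OF _ _ assms(2)] by (auto intro!: inj_onI)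
qed

lemma conv_dv_sum:
  assumes "\<gamma> \<in> fibre x" "\<beta> \<in> fibre x" "finite S" "S \<subseteq> fibre x" "\<And>\<alpha>. \<alpha> \<in> fibre x \<Longrightarrow> \<alpha> \<notin> S \<Longrightarrow> g (gdiv \<alpha> \<beta>) = 0"
  shows "conv m f g (gdiv \<gamma> \<beta>) = (\<Sum>\<alpha>\<in>S. f (gdiv \<gamma> \<alpha>) * g (gdiv \<alpha> \<beta>))"
proof -
  have "((\<lambda>\<alpha>. f (gdiv \<gamma> \<alpha>) * g (gdiv \<alpha> \<beta>)) has_sum (\<Sum>\<alpha>\<in>S. f (gdiv \<gamma> \<alpha>) * g (gdiv \<alpha> \<beta>))) (fibre x)"
    by (rule has_sum_finite_neutralI[OF assms(3,4)]) (use assms(5) in simp_all)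
  then show ?thesis unfolding conv_dv_infsum[OF assms(1,2)] by (rule infsumI)
qed

lemma conv_sum:
  assumes "\<gamma> \<in> fibre x" "finite S" "S \<subseteq> fibre x" "\<And>\<alpha>. \<alpha> \<in> fibre x \<Longrightarrow> \<alpha> \<notin> S \<Longrightarrow> g \<alpha> = 0"
  shows "conv m f g \<gamma> = (\<Sum>\<alpha>\<in>S. f (gdiv \<gamma> \<alpha>) * g \<alpha>)"
proof -
  have u: "gunit m x \<in> fibre x" using gunit_fibre fibre_tight assms(1) by blast
  have "conv m f g (gdiv \<gamma> (gunit m x)) = (\<Sum>\<alpha>\<in>S. f (gdiv \<gamma> \<alpha>) * g (gdiv \<alpha> (gunit m x)))"
    using assms by (intro conv_dv_sum[OF assms(1) u assms(2,3)]) (simp add: gdiv_gunit)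
  also have "\<dots> = (\<Sum>\<alpha>\<in>S. f (gdiv \<gamma> \<alpha>) * g \<alpha>)" using assms(3) by (intro sum.cong refl) (auto simp: gdiv_gunit subset_iff)
  finally show ?thesis using gdiv_gunit[OF assms(1)] by simp
qed

lemma conv_fs_sum: "fin_fibres g \<Longrightarrow> \<gamma> \<in> fibre x \<Longrightarrow> conv m f g \<gamma> = (\<Sum>\<alpha>\<in>{\<alpha> \<in> fibre x. g \<alpha> \<noteq> 0}. f (gdiv \<gamma> \<alpha>) * g \<alpha>)"
  using fin_fibres_fin by (intro conv_sum) auto

lemma fin_fibres_conv: assumes "fin_fibres f" "fin_fibres g" shows "fin_fibres (conv m f g)"
proof (rule fin_fibresI)
  fix x
  let ?S = "\<Union>\<alpha>\<in>{\<alpha> \<in> fibre x. g \<alpha> \<noteq> 0}. {\<gamma> \<in> fibre x. f (gdiv \<gamma> \<alpha>) \<noteq> 0}"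
  have "{\<gamma> \<in> fibre x. conv m f g \<gamma> \<noteq> 0} \<subseteq> ?S"
  proof
    fix \<gamma> assume "\<gamma> \<in> {\<gamma> \<in> fibre x. conv m f g \<gamma> \<noteq> 0}"
    then have g: "\<gamma> \<in> fibre x" "(\<Sum>\<alpha>\<in>{\<alpha> \<in> fibre x. g \<alpha> \<noteq> 0}. f (gdiv \<gamma> \<alpha>) * g \<alpha>) \<noteq> 0"
      using conv_fs_sum[OF assms(2)] by auto
    obtain \<alpha> where "\<alpha> \<in> {\<alpha> \<in> fibre x. g \<alpha> \<noteq> 0}" "f (gdiv \<gamma> \<alpha>) * g \<alpha> \<noteq> 0"
      using sum.not_neutral_contains_not_neutral[OF g(2)] by blast
    then show "\<gamma> \<in> ?S" using g(1) by auto
  qed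
  moreover have "finite ?S" using fin_fibres_fin[OF assms(2)] fin_fibres_fin_dv[OF assms(1)] by blast
  ultimately show "finite {\<gamma> \<in> fibre x. conv m f g \<gamma> \<noteq> 0}" using finite_subset by blast
qed (simp add: conv_off)

text \<open>Both sides are the same finite double sum once the middle index is confined to the
  finite set \<open>S\<close>. The left factor \<open>f\<close> may be arbitrary.\<close>

lemma conv_assoc: assumes g: "fin_fibres g" and k: "fin_fibres k" shows "conv m (conv m f g) k = conv m f (conv m g k)"
proof
  fix \<gamma> show "conv m (conv m f g) k \<gamma> = conv m f (conv m g k) \<gamma>"
  proof (cases "\<gamma> \<in> Gt m")
    case True
    let ?x = "gdom m \<gamma>"
    have \<gamma>: "\<gamma> \<in> fibre ?x" using Gt_fibre True by blast
    let ?K = "{\<alpha> \<in> fibre ?x. k \<alpha> \<noteq> 0}"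
    define S where "S = (\<Union>\<alpha>\<in>?K. {\<beta> \<in> fibre ?x. g (gdiv \<beta> \<alpha>) \<noteq> 0})"
    have K: "finite ?K" using fin_fibres_fin[OF k] .
    have S: "finite S" "S \<subseteq> fibre ?x" using K fin_fibres_fin_dv[OF g] by (auto simp: S_def)
    have gk: "conv m g k \<beta> = (\<Sum>\<alpha>\<in>?K. g (gdiv \<beta> \<alpha>) * k \<alpha>)" if "\<beta> \<in> fibre ?x" for \<beta>
      using conv_fs_sum[OF k that] .
    have "conv m f (conv m g k) \<gamma> = (\<Sum>\<beta>\<in>S. f (gdiv \<gamma> \<beta>) * conv m g k \<beta>)"
      by (rule conv_sum[OF \<gamma> S]) (auto simp: gk S_def intro!: sum.neutral)
    also have "\<dots> = (\<Sum>\<beta>\<in>S. \<Sum>\<alpha>\<in>?K. f (gdiv \<gamma> \<beta>) * g (gdiv \<beta> \<alpha>) * k \<alpha>)"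
      using S(2) by (intro sum.cong refl) (auto simp: gk sum_distrib_left mult.assoc subset_iff)
    also have "\<dots> = (\<Sum>\<alpha>\<in>?K. \<Sum>\<beta>\<in>S. f (gdiv \<gamma> \<beta>) * g (gdiv \<beta> \<alpha>) * k \<alpha>)" by (rule sum.swap)
    also have "\<dots> = (\<Sum>\<alpha>\<in>?K. conv m f g (gdiv \<gamma> \<alpha>) * k \<alpha>)"
    proof (rule sum.cong[OF refl])
      fix \<alpha> assume \<alpha>: "\<alpha> \<in> ?K"
      have "conv m f g (gdiv \<gamma> \<alpha>) = (\<Sum>\<beta>\<in>S. f (gdiv \<gamma> \<beta>) * g (gdiv \<beta> \<alpha>))"
        by (rule conv_dv_sum[OF \<gamma> _ S]) (use \<alpha> in \<open>auto simp: S_def\<close>)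
      then show "(\<Sum>\<beta>\<in>S. f (gdiv \<gamma> \<beta>) * g (gdiv \<beta> \<alpha>) * k \<alpha>) = conv m f g (gdiv \<gamma> \<alpha>) * k \<alpha>"
        by (simp add: sum_distrib_right)
    qed
    also have "\<dots> = conv m (conv m f g) k \<gamma>" using conv_fs_sum[OF k \<gamma>] by simp
    finally show ?thesis by simp
  qed (simp add: conv_off)
qed

lemma conv_fs_lin_right:
  assumes "fin_fibres g" "fin_fibres k"
  shows "conv m f (\<lambda>\<gamma>. c * g \<gamma> + k \<gamma>) = (\<lambda>\<gamma>. c * conv m f g \<gamma> + conv m f k \<gamma>)"
proof
  fix \<gamma> show "conv m f (\<lambda>\<gamma>. c * g \<gamma> + k \<gamma>) \<gamma> = c * conv m f g \<gamma> + conv m f k \<gamma>"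
  proof (cases "\<gamma> \<in> Gt m")
    case True
    let ?x = "gdom m \<gamma>"
    have \<gamma>: "\<gamma> \<in> fibre ?x" using Gt_fibre True by blast
    let ?S = "{\<alpha> \<in> fibre ?x. g \<alpha> \<noteq> 0} \<union> {\<alpha> \<in> fibre ?x. k \<alpha> \<noteq> 0}"
    have S: "finite ?S" "?S \<subseteq> fibre ?x" using fin_fibres_fin assms by auto
    have "conv m f (\<lambda>\<gamma>. c * g \<gamma> + k \<gamma>) \<gamma> = (\<Sum>\<alpha>\<in>?S. f (gdiv \<gamma> \<alpha>) * (c * g \<alpha> + k \<alpha>))"
      by (rule conv_sum[OF \<gamma> S]) auto
    moreover have "conv m f g \<gamma> = (\<Sum>\<alpha>\<in>?S. f (gdiv \<gamma> \<alpha>) * g \<alpha>)" by (rule conv_sum[OF \<gamma> S]) auto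
    moreover have "conv m f k \<gamma> = (\<Sum>\<alpha>\<in>?S. f (gdiv \<gamma> \<alpha>) * k \<alpha>)" by (rule conv_sum[OF \<gamma> S]) auto
    ultimately show ?thesis by (simp add: sum_distrib_left sum.distrib algebra_simps)
  qed (simp add: conv_off)
qed

lemma conv_fs_lin_left:
  assumes "fin_fibres k"
  shows "conv m (\<lambda>\<gamma>. c * f \<gamma> + g \<gamma>) k = (\<lambda>\<gamma>. c * conv m f k \<gamma> + conv m g k \<gamma>)"
proof
  fix \<gamma> show "conv m (\<lambda>\<gamma>. c * f \<gamma> + g \<gamma>) k \<gamma> = c * conv m f k \<gamma> + conv m g k \<gamma>"
  proof (cases "\<gamma> \<in> Gt m")
    case True
    then have \<gamma>: "\<gamma> \<in> fibre (gdom m \<gamma>)" using Gt_fibre by blast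
    show ?thesis unfolding conv_fs_sum[OF assms \<gamma>] by (simp add: sum_distrib_left sum.distrib algebra_simps)
  qed (simp add: conv_off)
qed

lemma conv_0_right: "conv m f (\<lambda>_. 0) = (\<lambda>_. 0)"
  by (auto simp: conv_def)

lemma conv_0_left: "conv m (\<lambda>_. 0) f = (\<lambda>_. 0)"
  by (auto simp: conv_def)

text \<open>The unit of the multiplier algebra; it need not belong to the reduced algebra.\<close>
definition one :: "'a germ \<Rightarrow> complex" where
  "one \<gamma> = (if \<exists>x\<in>tight m. \<gamma> = gunit m x then 1 else 0)"

lemma one_fibre: assumes "\<gamma> \<in> fibre x" shows "one \<gamma> = (if \<gamma> = gunit m x then 1 else 0)"
proof -
  have x: "x \<in> tight m" using fibre_tight assms by blast
  have "(\<exists>y\<in>tight m. \<gamma> = gunit m y) \<longleftrightarrow> \<gamma> = gunit m x"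
    using Gt_fibre(3)[OF gunit_fibre] Gt_fibre(3)[OF assms] x by metis
  then show ?thesis by (simp add: one_def)
qed

lemma fin_fibres_one: "fin_fibres one"
proof (rule fin_fibresI)
  show "one \<gamma> = 0" if "\<gamma> \<notin> Gt m" for \<gamma> using that Gt_fibre(2)[OF gunit_fibre] by (auto simp: one_def)
  fix x
  have "{\<gamma> \<in> fibre x. one \<gamma> \<noteq> 0} \<subseteq> {gunit m x}" using one_fibre[of _ x] by (auto split: if_splits)
  then show "finite {\<gamma> \<in> fibre x. one \<gamma> \<noteq> 0}" by (rule finite_subset) simp
qed

lemma conv_one: assumes "\<And>\<gamma>. \<gamma> \<notin> Gt m \<Longrightarrow> f \<gamma> = 0" shows "conv m f one = f"
proof
  fix \<gamma> show "conv m f one \<gamma> = f \<gamma>"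
  proof (cases "\<gamma> \<in> Gt m")
    case True
    let ?x = "gdom m \<gamma>"
    have \<gamma>: "\<gamma> \<in> fibre ?x" using Gt_fibre True by blast
    have u: "gunit m ?x \<in> fibre ?x" using gunit_fibre fibre_tight \<gamma> by blast
    have "conv m f one \<gamma> = (\<Sum>\<alpha>\<in>{gunit m ?x}. f (gdiv \<gamma> \<alpha>) * one \<alpha>)"
      by (rule conv_sum[OF \<gamma>]) (use u one_fibre[of _ ?x] in simp_all)
    then show ?thesis using one_fibre[OF u] gdiv_gunit[OF \<gamma>] by simp
  qed (simp add: conv_off assms)
qed

lemma one_conv: assumes "fin_fibres v" shows "conv m one v = v"
proof
  fix \<gamma> show "conv m one v \<gamma> = v \<gamma>"
  proof (cases "\<gamma> \<in> Gt m")
    case True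
    let ?x = "gdom m \<gamma>"
    have \<gamma>: "\<gamma> \<in> fibre ?x" using Gt_fibre True by blast
    have e: "one (gdiv \<gamma> \<alpha>) = (if \<alpha> = \<gamma> then 1 else 0)" if "\<alpha> \<in> fibre ?x" for \<alpha>
      using one_fibre[OF gdiv_fibre[OF \<gamma> that]] gdiv_self[OF that] gdiv_inj[OF \<gamma> that that] by auto
    let ?S = "insert \<gamma> {\<alpha> \<in> fibre ?x. v \<alpha> \<noteq> 0}"
    have S: "finite ?S" "?S \<subseteq> fibre ?x" using fin_fibres_fin[OF assms] \<gamma> by auto
    have "conv m one v \<gamma> = (\<Sum>\<alpha>\<in>?S. one (gdiv \<gamma> \<alpha>) * v \<alpha>)" by (rule conv_sum[OF \<gamma> S]) simp
    also have "\<dots> = (\<Sum>\<alpha>\<in>?S. if \<alpha> = \<gamma> then v \<alpha> else 0)" 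
    proof (rule sum.cong[OF refl])
      fix \<alpha> assume "\<alpha> \<in> ?S"
      then have "\<alpha> \<in> fibre ?x" using S(2) by (rule rev_subsetD)
      then show "one (gdiv \<gamma> \<alpha>) * v \<alpha> = (if \<alpha> = \<gamma> then v \<alpha> else 0)" by (simp add: e)
    qed
    also have "\<dots> = v \<gamma>" using S(1) by (subst sum.delta) simp_all
    finally show ?thesis .
  qed (simp add: conv_off fin_fibres_off[OF assms])
qed

text \<open>The inner product of l2 of the fibre, conjugate linear in the first argument. Summing
  over the common support makes it a finite sum as soon as one of the two arguments is fibrewise
  finite.\<close>

definition ip :: "'a set \<Rightarrow> ('a germ \<Rightarrow> complex) \<Rightarrow> ('a germ \<Rightarrow> complex) \<Rightarrow> complex" where
  "ip x f g = (\<Sum>\<alpha>\<in>{\<alpha> \<in> fibre x. f \<alpha> \<noteq> 0 \<and> g \<alpha> \<noteq> 0}. cnj (f \<alpha>) * g \<alpha>)"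

lemma ip_eq:
  assumes "finite S" "S \<subseteq> fibre x" "\<And>\<alpha>. \<alpha> \<in> fibre x \<Longrightarrow> \<alpha> \<notin> S \<Longrightarrow> f \<alpha> = 0 \<or> g \<alpha> = 0"
  shows "ip x f g = (\<Sum>\<alpha>\<in>S. cnj (f \<alpha>) * g \<alpha>)"
  unfolding ip_def using assms by (intro sum.mono_neutral_left) auto

lemma ip_cnj: "cnj (ip x f g) = ip x g f"
  unfolding ip_def cnj_sum by (intro sum.cong) auto

lemma ip_lin_right:
  assumes "fin_fibres f" shows "ip x f (\<lambda>\<gamma>. c * g \<gamma> + h \<gamma>) = c * ip x f g + ip x f h"
proof -
  let ?S = "{\<alpha> \<in> fibre x. f \<alpha> \<noteq> 0}"
  have S: "finite ?S" "?S \<subseteq> fibre x" using fin_fibres_fin[OF assms] by auto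
  have "ip x f k = (\<Sum>\<alpha>\<in>?S. cnj (f \<alpha>) * k \<alpha>)" for k by (rule ip_eq[OF S]) auto
  then show ?thesis by (simp add: sum_distrib_left sum.distrib algebra_simps)
qed

lemma ip_adj_left:
  assumes f: "fin_fibres f" and g: "fin_fibres g"
  shows "ip x (conv m b f) g = ip x f (conv m (adj m b) g)"
proof -
  let ?A = "{\<alpha> \<in> fibre x. f \<alpha> \<noteq> 0}" and ?C = "{\<alpha> \<in> fibre x. g \<alpha> \<noteq> 0}"
  have fin: "finite ?A" "finite ?C" "?A \<subseteq> fibre x" "?C \<subseteq> fibre x" using fin_fibres_fin f g by auto
  have "ip x (conv m b f) g = (\<Sum>\<gamma>\<in>?C. cnj (conv m b f \<gamma>) * g \<gamma>)" by (rule ip_eq[OF fin(2,4)]) auto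
  also have "\<dots> = (\<Sum>\<gamma>\<in>?C. \<Sum>\<alpha>\<in>?A. cnj (b (gdiv \<gamma> \<alpha>)) * cnj (f \<alpha>) * g \<gamma>)"
    by (intro sum.cong refl) (simp add: conv_fs_sum[OF f, of _ x] sum_distrib_right)
  also have "\<dots> = (\<Sum>\<alpha>\<in>?A. \<Sum>\<gamma>\<in>?C. cnj (b (gdiv \<gamma> \<alpha>)) * cnj (f \<alpha>) * g \<gamma>)" by (rule sum.swap)
  also have "\<dots> = (\<Sum>\<alpha>\<in>?A. cnj (f \<alpha>) * conv m (adj m b) g \<alpha>)"
    by (intro sum.cong refl) (simp add: conv_fs_sum[OF g, of _ x] sum_distrib_left adj_dv[of _ x] mult_ac)
  also have "\<dots> = ip x f (conv m (adj m b) g)" by (rule ip_eq[OF fin(1,3), symmetric]) auto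
  finally show ?thesis .
qed

lemma ip_self:
  assumes "finite S" "S \<subseteq> fibre x" "\<And>\<alpha>. \<alpha> \<in> fibre x \<Longrightarrow> \<alpha> \<notin> S \<Longrightarrow> f \<alpha> = 0"
  shows "ip x f f = of_real ((l2 f S)\<^sup>2)"
proof -
  have "ip x f f = (\<Sum>\<alpha>\<in>S. cnj (f \<alpha>) * f \<alpha>)" using assms by (intro ip_eq) auto
  also have "\<dots> = of_real ((l2 f S)\<^sup>2)"
    unfolding L2_set_sq of_real_sum by (intro sum.cong refl) (simp only: complex_norm_square mult.commute)
  finally show ?thesis .
qed

lemma ip_self_L2: "fin_fibres f \<Longrightarrow> ip x f f = of_real ((l2 f {\<alpha> \<in> fibre x. f \<alpha> \<noteq> 0})\<^sup>2)"
  using fin_fibres_fin by (intro ip_self) auto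

lemma ip_self_nonneg: "fin_fibres f \<Longrightarrow> 0 \<le> Re (ip x f f)"
  by (simp only: ip_self_L2 Re_complex_of_real zero_le_power2)

lemma L2_le_ip: assumes "fin_fibres f" "finite A" "A \<subseteq> fibre x"
  shows "(l2 f A)\<^sup>2 \<le> Re (ip x f f)"
proof -
  let ?S = "A \<union> {\<alpha> \<in> fibre x. f \<alpha> \<noteq> 0}"
  have S: "finite ?S" using assms fin_fibres_fin by simp
  have "Re (ip x f f) = (\<Sum>\<alpha>\<in>?S. (cmod (f \<alpha>))\<^sup>2)"
    using ip_self[OF S, of x f] assms(3) by (simp only: L2_set_sq) auto
  moreover have "(\<Sum>\<alpha>\<in>A. (cmod (f \<alpha>))\<^sup>2) \<le> (\<Sum>\<alpha>\<in>?S. (cmod (f \<alpha>))\<^sup>2)"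
    using S by (intro sum_mono2) auto
  ultimately show ?thesis by (simp add: L2_set_sq)
qed

lemma ip_conv_le:
  assumes b: "op_bound b r" "fin_fibres b" and f: "fin_fibres f"
  shows "Re (ip x (conv m b f) (conv m b f)) \<le> r\<^sup>2 * Re (ip x f f)"
proof -
  let ?F = "{\<alpha> \<in> fibre x. f \<alpha> \<noteq> 0}" and ?A = "{\<alpha> \<in> fibre x. conv m b f \<alpha> \<noteq> 0}"
  have fin: "finite ?A" "finite ?F" "?A \<subseteq> fibre x" "?F \<subseteq> fibre x" using fin_fibres_fin f fin_fibres_conv[OF b(2) f] by auto
  have "L2_set (\<lambda>\<gamma>. cmod (conv m b f \<gamma>)) ?A = L2_set (\<lambda>\<gamma>. cmod (\<Sum>\<alpha>\<in>?F. b (gdiv \<gamma> \<alpha>) * f \<alpha>)) ?A"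
    by (rule L2_set_cong) (simp_all add: conv_fs_sum[OF f, of _ x])
  also have "\<dots> \<le> r * l2 f ?F" by (rule op_bound_col[OF b(1) fin])
  finally have "(L2_set (\<lambda>\<gamma>. cmod (conv m b f \<gamma>)) ?A)\<^sup>2 \<le> (r * l2 f ?F)\<^sup>2"
    by (intro power_mono) (auto simp: L2_set_nonneg)
  then show ?thesis unfolding ip_self_L2[OF f] ip_self_L2[OF fin_fibres_conv[OF b(2) f]] Re_complex_of_real by (simp only: power_mult_distrib)
qed

text \<open>On each fibre \<open>one\<close> is the delta vector at the unit. Evaluation at a unit
  is thus a vector state, and positivity of a form yields an inequality between values at
  units.\<close>

lemma ip_one: assumes "x \<in> tight m" shows "ip x one g = g (gunit m x)"
proof -
  have u: "gunit m x \<in> fibre x" using gunit_fibre assms .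
  have "ip x one g = (\<Sum>\<alpha>\<in>{gunit m x}. cnj (one \<alpha>) * g \<alpha>)"
    by (rule ip_eq) (use u one_fibre[of _ x] in simp_all)
  then show ?thesis using one_fibre[OF u] by simp
qed

lemma op_bound_sum: "finite J \<Longrightarrow> (\<And>j. j \<in> J \<Longrightarrow> op_bound (f j) (r j)) \<Longrightarrow> op_bound (\<lambda>\<gamma>. \<Sum>j\<in>J. f j \<gamma>) (\<Sum>j\<in>J. r j)"
  by (induction J rule: finite_induct) (simp_all add: op_bound_0 op_bound_add)

end

section \<open>Polynomial calculus for a positive contraction\<close>

text \<open>The constant of \<open>bernp_Cauchy\<close> for the degrees \<open>(Suc N)^2\<close> and
  \<open>(Suc l)^2\<close> with \<open>\<theta> = 1 / Suc N\<close>; squared degrees make both terms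
  of order \<open>1 / Suc N\<close>.\<close>

lemma inverse_square_rate:
  fixes N l :: nat assumes "N \<le> l"
  shows "1 / real (Suc N) + (1 / real ((Suc N)\<^sup>2) + 1 / real ((Suc l)\<^sup>2)) / (1 / real (Suc N)) \<le> 3 / real (Suc N)"
proof -
  let ?a = "real (Suc N)" and ?c = "real (Suc l)"
  have a: "0 < ?a" "?a \<le> ?c" using assms by simp_all
  have "1 / ?c\<^sup>2 \<le> 1 / ?a\<^sup>2" using a by (intro divide_left_mono power_mono mult_pos_pos zero_less_power) linarith+
  then have "(1 / ?a\<^sup>2 + 1 / ?c\<^sup>2) * ?a \<le> (2 / ?a\<^sup>2) * ?a"
    using a by (intro mult_right_mono) linarith+
  also have "\<dots> = 2 / ?a" using a by (simp add: power2_eq_square del: of_nat_Suc)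
  finally have "1 / ?a + (1 / ?a\<^sup>2 + 1 / ?c\<^sup>2) * ?a \<le> 1 / ?a + 2 / ?a" by (rule add_left_mono)
  also have "\<dots> = 3 / ?a" unfolding add_divide_distrib[symmetric] by simp
  finally have "1 / ?a + (1 / ?a\<^sup>2 + 1 / ?c\<^sup>2) * ?a \<le> 3 / ?a" .
  then show ?thesis by (simp only: of_nat_power divide_divide_eq_right div_by_1)
qed

text \<open>To be instantiated with the compression of an approximant, scaled to a contraction, so
  that \<open>h\<close> below lies between 0 and 1.\<close>

locale compressed = inverse_semigroup_zero m for m :: "'a \<Rightarrow> 'a \<Rightarrow> 'a" +
  fixes b :: "'a germ \<Rightarrow> complex"
  assumes b_tspan: "b \<in> tspan Iso" and b_contr: "op_bound b 1"
begin

lemma fin_fibres_b: "fin_fibres b" using fin_fibres_tspan b_tspan .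

lemma adj_b_tspan: "adj m b \<in> tspan Iso" using tspan_adj[OF b_tspan] iso_star by blast

lemma fin_fibres_adj_b: "fin_fibres (adj m b)" using fin_fibres_tspan adj_b_tspan .

definition H :: "('a germ \<Rightarrow> complex) \<Rightarrow> 'a germ \<Rightarrow> complex" where
  "H v = conv m (adj m b) (conv m b v)"

lemma fin_fibres_H: "fin_fibres v \<Longrightarrow> fin_fibres (H v)"
  unfolding H_def by (intro fin_fibres_conv fin_fibres_b fin_fibres_adj_b)

lemma H_lin: "fin_fibres f \<Longrightarrow> fin_fibres g \<Longrightarrow> H (\<lambda>\<gamma>. c * f \<gamma> + g \<gamma>) = (\<lambda>\<gamma>. c * H f \<gamma> + H g \<gamma>)"
  unfolding H_def by (simp add: conv_fs_lin_right fin_fibres_conv fin_fibres_b)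

lemma H_0: "H (\<lambda>_. 0) = (\<lambda>_. 0)"
  by (simp add: H_def conv_0_right)

lemma ip_H: "fin_fibres f \<Longrightarrow> fin_fibres g \<Longrightarrow> ip x f (H g) = ip x (conv m b f) (conv m b g)"
  unfolding H_def by (rule ip_adj_left[symmetric]) (simp_all add: fin_fibres_conv fin_fibres_b)

lemma H_sym: assumes "fin_fibres f" "fin_fibres g" shows "ip x (H f) g = ip x f (H g)"
  using ip_H[OF assms, of x] ip_H[OF assms(2,1), of x] ip_cnj by metis

definition h :: "'a germ \<Rightarrow> complex" where "h = conv m (adj m b) b"

lemma H_one: "H one = h"
  unfolding H_def h_def using conv_one fin_fibres_off[OF fin_fibres_b] by simp

lemma H_conv: "fin_fibres v \<Longrightarrow> H v = conv m h v"
  unfolding H_def h_def using conv_assoc[OF fin_fibres_b] by simp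

lemma H_conv_assoc: "fin_fibres w \<Longrightarrow> fin_fibres v \<Longrightarrow> conv m (H w) v = H (conv m w v)"
  unfolding H_def by (simp add: conv_assoc fin_fibres_conv fin_fibres_b)

lemma h_tspan: "h \<in> tspan Iso"
  unfolding h_def by (rule tspan_conv[OF adj_b_tspan b_tspan iso_mult])

lemma op_bound_h: "op_bound h 1"
  using op_bound_conv[OF op_bound_adj[OF b_contr] b_contr] by (simp add: h_def)

lemma H_tspan: "v \<in> tspan Iso \<Longrightarrow> H v \<in> tspan Iso"
  using tspan_conv[OF h_tspan _ iso_mult] H_conv[OF fin_fibres_tspan] by metis

text \<open>Horner's scheme for the polynomial in the operator \<open>H\<close>, applied to the
  vector \<open>v\<close>. Acting on vectors gives constant terms a meaning even though the algebra
  may have no unit.\<close>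

definition poly_op :: "real poly \<Rightarrow> ('a germ \<Rightarrow> complex) \<Rightarrow> 'a germ \<Rightarrow> complex" where
  "poly_op p v = fold_coeffs (\<lambda>a w \<gamma>. of_real a * v \<gamma> + H w \<gamma>) p (\<lambda>_. 0)"

lemma poly_op_0: "poly_op 0 v = (\<lambda>_. 0)"
  by (simp add: poly_op_def)

lemma poly_op_pCons: "poly_op (pCons a p) v = (\<lambda>\<gamma>. of_real a * v \<gamma> + H (poly_op p v) \<gamma>)"
  by (cases "a = 0 \<and> p = 0") (auto simp: poly_op_def H_0)

lemma fin_fibres_PH: assumes "fin_fibres v" shows "fin_fibres (poly_op p v)"
  by (induction p) (simp_all add: poly_op_0 poly_op_pCons fin_fibres_0 fin_fibres_add fin_fibres_scale fin_fibres_H assms)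

lemma poly_op_add: assumes v: "fin_fibres v" shows "poly_op (p + q) v = (\<lambda>\<gamma>. poly_op p v \<gamma> + poly_op q v \<gamma>)"
proof (induction p q rule: poly_induct2)
  case (pCons a p b q)
  have "H (\<lambda>\<gamma>. poly_op p v \<gamma> + poly_op q v \<gamma>) = (\<lambda>\<gamma>. H (poly_op p v) \<gamma> + H (poly_op q v) \<gamma>)"
    using H_lin[OF fin_fibres_PH[OF v] fin_fibres_PH[OF v], of 1 p q] by simp
  then show ?case using pCons by (simp add: poly_op_pCons algebra_simps)
qed (simp add: poly_op_0)

lemma poly_op_smult: assumes v: "fin_fibres v" shows "poly_op (smult c p) v = (\<lambda>\<gamma>. of_real c * poly_op p v \<gamma>)"
proof (induction p)
  case (pCons a p)
  have "H (\<lambda>\<gamma>. of_real c * poly_op p v \<gamma>) = (\<lambda>\<gamma>. of_real c * H (poly_op p v) \<gamma>)"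
    using H_lin[OF fin_fibres_PH[OF v] fin_fibres_0, of "of_real c" p] by (simp add: H_0)
  then show ?case using pCons by (simp add: poly_op_pCons algebra_simps)
qed (simp add: poly_op_0)

lemma poly_op_diff: assumes v: "fin_fibres v" shows "poly_op (p - q) v = (\<lambda>\<gamma>. poly_op p v \<gamma> - poly_op q v \<gamma>)"
  using poly_op_add[OF v, of p "smult (-1) q"] poly_op_smult[OF v, of "-1" q] by simp

lemma poly_op_mult: assumes v: "fin_fibres v" shows "poly_op (p * q) v = poly_op p (poly_op q v)"
proof (induction p)
  case (pCons a p)
  have "poly_op (pCons a p * q) v = poly_op (smult a q + pCons 0 (p * q)) v" by (simp add: mult_pCons_left)
  also have "\<dots> = (\<lambda>\<gamma>. of_real a * poly_op q v \<gamma> + H (poly_op p (poly_op q v)) \<gamma>)"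
    by (simp add: poly_op_add[OF v] poly_op_smult[OF v] poly_op_pCons pCons)
  finally show ?case by (simp add: poly_op_pCons)
qed (simp add: poly_op_0)

lemma poly_op_X: "poly_op [:0, 1:] v = H v"
  by (simp add: poly_op_pCons poly_op_0 H_0)

lemma poly_op_H: assumes "fin_fibres v" shows "poly_op p (H v) = H (poly_op p v)"
  using poly_op_mult[OF assms, of p "[:0, 1:]"] poly_op_mult[OF assms, of "[:0, 1:]" p] by (simp only: poly_op_X mult.commute)

lemma poly_op_sym: assumes "fin_fibres f" "fin_fibres g" shows "ip x (poly_op p f) g = ip x f (poly_op p g)"
  using assms(2)
proof (induction p arbitrary: g)
  case 0
  show ?case by (simp add: poly_op_0 ip_def)
next
  case (pCons a p)
  have "ip x (poly_op (pCons a p) f) g = cnj (ip x g (\<lambda>\<gamma>. of_real a * f \<gamma> + H (poly_op p f) \<gamma>))"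
    by (simp only: poly_op_pCons ip_cnj)
  also have "\<dots> = of_real a * ip x f g + ip x (H (poly_op p f)) g"
    by (simp add: ip_lin_right[OF pCons.prems] ip_cnj)
  also have "ip x (H (poly_op p f)) g = ip x (poly_op p f) (H g)" using H_sym[OF fin_fibres_PH[OF assms(1)] pCons.prems] .
  also have "\<dots> = ip x f (H (poly_op p g))" using pCons.IH[OF fin_fibres_H[OF pCons.prems]] poly_op_H[OF pCons.prems] by simp
  finally show ?case by (simp add: poly_op_pCons ip_lin_right[OF assms(1)])
qed

section \<open>Positivity of polynomials in \<open>h\<close>\<close>

definition form_nonneg :: "real poly \<Rightarrow> bool" where
  "form_nonneg p \<longleftrightarrow> (\<forall>x v. fin_fibres v \<longrightarrow> 0 \<le> Re (ip x v (poly_op p v)))"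

lemma form_nonneg_conj: assumes "form_nonneg p" shows "form_nonneg (q * (p * q))"
  unfolding form_nonneg_def
proof (intro allI impI)
  fix x v assume v: "fin_fibres v"
  have "ip x v (poly_op (q * (p * q)) v) = ip x (poly_op q v) (poly_op p (poly_op q v))"
    using poly_op_sym[OF v fin_fibres_PH[OF fin_fibres_PH[OF v]]] by (simp add: poly_op_mult[OF v])
  then show "0 \<le> Re (ip x v (poly_op (q * (p * q)) v))" using assms fin_fibres_PH[OF v] by (simp add: form_nonneg_def)
qed

lemma form_nonneg_lin: assumes "form_nonneg p" "form_nonneg q" "c \<ge> 0" shows "form_nonneg (smult c p + q)"
  unfolding form_nonneg_def
proof (intro allI impI)
  fix x v assume v: "fin_fibres v"
  have "ip x v (poly_op (smult c p + q) v) = of_real c * ip x v (poly_op p v) + ip x v (poly_op q v)"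
    by (simp add: poly_op_add[OF v] poly_op_smult[OF v] ip_lin_right[OF v])
  then show "0 \<le> Re (ip x v (poly_op (smult c p + q) v))" using assms v by (simp add: form_nonneg_def)
qed

lemma form_nonneg_0: "form_nonneg 0"
  by (simp add: form_nonneg_def poly_op_0 ip_def)

lemma poly_op_1: "poly_op 1 v = v"
  unfolding one_pCons by (simp add: poly_op_pCons poly_op_0 H_0)

lemma form_nonneg_1: "form_nonneg 1"
  by (simp add: form_nonneg_def poly_op_1 ip_self_nonneg)

lemma form_nonneg_X: "form_nonneg [:0, 1:]"
  by (simp add: form_nonneg_def poly_op_X ip_H ip_self_nonneg fin_fibres_conv fin_fibres_b)

lemma form_nonneg_1_minus_X: "form_nonneg [:1, -1:]"
  unfolding form_nonneg_def
proof (intro allI impI)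
  fix x v assume v: "fin_fibres v"
  have "poly_op [:1, -1:] v = poly_op (1 - [:0, 1:]) v" by (simp add: one_pCons)
  also have "\<dots> = (\<lambda>\<gamma>. (-1) * H v \<gamma> + v \<gamma>)" by (simp only: poly_op_diff[OF v] poly_op_1 poly_op_X) simp
  finally have "ip x v (poly_op [:1, -1:] v) = - ip x v (H v) + ip x v v" by (simp only: ip_lin_right[OF v]) simp
  moreover have "Re (ip x v (H v)) \<le> Re (ip x v v)"
    using ip_conv_le[OF b_contr fin_fibres_b v, of x] by (simp add: ip_H[OF v v])
  ultimately show "0 \<le> Re (ip x v (poly_op [:1, -1:] v))" by simp
qed

text \<open>The even parts of both exponents are absorbed into conjugation by \<open>?q\<close>,
  leaving exponents 0 or 1. The only remaining case that is not immediate is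
  \<open>X(1-X) = (1-X)X(1-X) + X(1-X)X\<close>, a sum of two conjugates. No square roots of
  operators occur.\<close>

lemma form_nonneg_bmon: "form_nonneg (bmon i j)"
proof -
  let ?X = "[:0, 1:] :: real poly" and ?Y = "[:1, -1:] :: real poly"
  have XY: "form_nonneg (?X * ?Y)"
  proof -
    have "?X * ?Y = smult 1 (?Y * (?X * ?Y)) + ?X * (?Y * ?X)"
      by (subst poly_eq_poly_eq_iff[symmetric]) (simp add: fun_eq_iff algebra_simps)
    then show ?thesis using form_nonneg_lin[OF form_nonneg_conj[OF form_nonneg_X, of ?Y] form_nonneg_conj[OF form_nonneg_1_minus_X, of ?X], of 1] by simp
  qed
  have base: "form_nonneg (?X ^ (i mod 2) * ?Y ^ (j mod 2))"
    using form_nonneg_1 form_nonneg_X form_nonneg_1_minus_X XY by (cases "i mod 2 = 0"; cases "j mod 2 = 0") (simp_all add: not_mod_2_eq_0_eq_1 del: mult_pCons_left mult_pCons_right)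
  let ?q = "?X ^ (i div 2) * ?Y ^ (j div 2)"
  have "?X ^ i = ?X ^ (i div 2) * ?X ^ (i mod 2) * ?X ^ (i div 2)"
    unfolding power_add[symmetric] by (rule arg_cong[of _ _ "\<lambda>n. ?X ^ n"]) presburger
  moreover have "?Y ^ j = ?Y ^ (j div 2) * ?Y ^ (j mod 2) * ?Y ^ (j div 2)"
    unfolding power_add[symmetric] by (rule arg_cong[of _ _ "\<lambda>n. ?Y ^ n"]) presburger
  ultimately have "bmon i j = ?q * (?X ^ (i mod 2) * ?Y ^ (j mod 2) * ?q)"
    unfolding bmon_def by (simp only: mult_ac)
  then show ?thesis using form_nonneg_conj[OF base, of ?q] by simp
qed

lemma form_nonneg_cone: assumes "p \<in> cone" shows "form_nonneg p"
  using assms by induction (auto intro: form_nonneg_0 form_nonneg_lin form_nonneg_bmon)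

lemma conv_PH: assumes "fin_fibres v" shows "conv m (poly_op p one) v = poly_op p v"
proof (induction p)
  case (pCons a p)
  have "conv m (poly_op (pCons a p) one) v = (\<lambda>\<gamma>. of_real a * conv m one v \<gamma> + conv m (H (poly_op p one)) v \<gamma>)"
    by (simp only: poly_op_pCons conv_fs_lin_left[OF assms])
  then show ?case
    by (simp add: poly_op_pCons one_conv[OF assms] H_conv_assoc[OF fin_fibres_PH[OF fin_fibres_one] assms] pCons)
qed (simp add: poly_op_0 conv_0_left)

text \<open>Positivity of \<open>C^2 - p^2\<close> at the vector \<open>v'\<close>, which is
  \<open>v\<close> cut off outside \<open>F\<close>, bounds the squared norm of
  \<open>poly_op p v'\<close> because \<open>p\<close> acts selfadjointly. Cauchy-Schwarz with
  \<open>w\<close> then gives the bound on the form.\<close>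

lemma op_bound_PH:
  assumes C: "C \<ge> 0" and cone: "[:C:] - p \<in> cone" "[:C:] + p \<in> cone"
  shows "op_bound (poly_op p one) C"
proof (rule op_boundI)
  show "0 \<le> C" using C .
  fix x A F and v w :: "'a germ \<Rightarrow> complex"
  assume a: "finite A" "finite F" "A \<subseteq> fibre x" "F \<subseteq> fibre x"
  define v' where "v' \<alpha> = (if \<alpha> \<in> F then v \<alpha> else 0)" for \<alpha>
  have v': "fin_fibres v'"
  proof (rule fin_fibresI)
    show "v' \<gamma> = 0" if "\<gamma> \<notin> Gt m" for \<gamma> using that a(4) Gt_fibre(2) by (auto simp: v'_def)
    show "finite {\<gamma> \<in> fibre y. v' \<gamma> \<noteq> 0}" for y
      by (rule finite_subset[OF _ a(2)]) (auto simp: v'_def split: if_splits)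
  qed
  have u: "(\<Sum>\<alpha>\<in>F. poly_op p one (gdiv \<gamma> \<alpha>) * v \<alpha>) = poly_op p v' \<gamma>" if "\<gamma> \<in> A" for \<gamma>
  proof -
    have "conv m (poly_op p one) v' \<gamma> = (\<Sum>\<alpha>\<in>F. poly_op p one (gdiv \<gamma> \<alpha>) * v' \<alpha>)"
      using that a by (intro conv_sum) (auto simp: v'_def)
    then show ?thesis unfolding conv_PH[OF v'] by (simp add: v'_def)
  qed
  let ?N = "l2 v F"
  have N: "Re (ip x v' v') = ?N\<^sup>2"
  proof -
    have "ip x v' v' = of_real ((l2 v' F)\<^sup>2)" using a by (intro ip_self) (auto simp: v'_def)
    also have "l2 v' F = ?N" by (rule L2_set_cong) (simp_all add: v'_def)
    finally show ?thesis by (simp only: Re_complex_of_real)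
  qed
  have "form_nonneg ([:C\<^sup>2:] - p * p)" using form_nonneg_cone cone_square_bound cone by blast
  then have "0 \<le> Re (ip x v' (poly_op ([:C\<^sup>2:] - p * p) v'))" using v' by (simp add: form_nonneg_def)
  also have "poly_op ([:C\<^sup>2:] - p * p) v' = (\<lambda>\<gamma>. of_real (C\<^sup>2) * v' \<gamma> + (-1) * poly_op p (poly_op p v') \<gamma>)"
    by (simp add: poly_op_diff[OF v'] poly_op_mult[OF v'] poly_op_pCons poly_op_0 H_0)
  also have "ip x v' \<dots> = of_real (C\<^sup>2) * ip x v' v' + (-1) * ip x v' (poly_op p (poly_op p v'))"
  proof -
    have z: "ip x v' (\<lambda>_. 0) = 0" by (simp add: ip_def)
    have "ip x v' (\<lambda>\<gamma>. (-1) * g \<gamma>) = (-1) * ip x v' g" for g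
      using ip_lin_right[OF v', of x "-1" g "\<lambda>_. 0"] z by simp
    then show ?thesis by (simp only: ip_lin_right[OF v'])
  qed
  also have "ip x v' (poly_op p (poly_op p v')) = ip x (poly_op p v') (poly_op p v')" using poly_op_sym[OF v' fin_fibres_PH[OF v']] by simp
  finally have "Re (ip x (poly_op p v') (poly_op p v')) \<le> (C * ?N)\<^sup>2" using N by (simp add: power_mult_distrib)
  then have "(L2_set (\<lambda>\<alpha>. cmod (poly_op p v' \<alpha>)) A)\<^sup>2 \<le> (C * ?N)\<^sup>2"
    using L2_le_ip[OF fin_fibres_PH[OF v'] a(1,3), of p] by linarith
  then have L: "L2_set (\<lambda>\<alpha>. cmod (poly_op p v' \<alpha>)) A \<le> C * ?N"
    by (rule power2_le_imp_le) (simp add: C L2_set_nonneg)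
  have "(bform (poly_op p one) w v A F) = (\<Sum>\<gamma>\<in>A. w \<gamma> * poly_op p v' \<gamma>)"
    by (intro sum.cong refl) (simp add: sum_distrib_left mult.assoc flip: u)
  then have "cmod (bform (poly_op p one) w v A F) \<le> l2 w A * L2_set (\<lambda>\<gamma>. cmod (poly_op p v' \<gamma>)) A"
    using norm_sum_mult_le_L2 by simp
  also have "\<dots> \<le> l2 w A * (C * ?N)" using L by (intro mult_left_mono) (simp_all add: L2_set_nonneg)
  finally show "cmod (bform (poly_op p one) w v A F) \<le> C * l2 w A * ?N"
    by (simp add: mult_ac)
qed

text \<open>Without a constant term a factor \<open>H\<close> can be split off, and
  \<open>H one = h\<close> already lies in the span.\<close>

lemma poly_op_tspan: assumes "coeff p 0 = 0" shows "poly_op p one \<in> tspan Iso"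
proof -
  have "H (poly_op q one) \<in> tspan Iso" for q
  proof (induction q)
    case 0
    show ?case by (simp add: poly_op_0 H_0 tspan_0)
  next
    case (pCons a q)
    have "H (poly_op (pCons a q) one) = (\<lambda>\<gamma>. of_real a * h \<gamma> + H (H (poly_op q one)) \<gamma>)"
      by (simp only: poly_op_pCons H_lin[OF fin_fibres_one fin_fibres_H[OF fin_fibres_PH[OF fin_fibres_one]]] H_one)
    then show ?case using tspan_add[OF tspan_scale[OF h_tspan] H_tspan[OF pCons(2)]] by simp
  qed
  moreover obtain q where "p = pCons 0 q" using assms by (cases p) auto
  ultimately show ?thesis by (simp add: poly_op_pCons)
qed

text \<open>The value of \<open>h\<close> at the unit is the squared norm of \<open>b\<close> on the
  fibre, and the unit contributes one of its terms.\<close>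

lemma h_unit_ge: assumes "x \<in> tight m" shows "(cmod (b (gunit m x)))\<^sup>2 \<le> Re (h (gunit m x))"
proof -
  have "h (gunit m x) = ip x one (H one)" using ip_one[OF assms] H_one by simp
  also have "\<dots> = ip x b b" using ip_H[OF fin_fibres_one fin_fibres_one] conv_one fin_fibres_off[OF fin_fibres_b] by simp
  finally have e: "h (gunit m x) = ip x b b" .
  show ?thesis using L2_le_ip[OF fin_fibres_b, of "{gunit m x}" x] gunit_fibre[OF assms] by (simp add: e)
qed

end

section \<open>Approximation in an ideal\<close>

context inverse_semigroup_zero
begin

lemma tspan_Cred: assumes "f \<in> tspan P" shows "f \<in> Cred m (\<lambda>_. True)"
  unfolding Cred_UNIV using norm_closure_superset[OF tspan_mono[OF assms subset_UNIV]] .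

lemma ideal_Cred: "closed_ideal m I \<Longrightarrow> f \<in> I \<Longrightarrow> f \<in> Cred m (\<lambda>_. True)"
  unfolding closed_ideal_def by blast

lemma ideal_0: "closed_ideal m I \<Longrightarrow> (\<lambda>_. 0) \<in> I"
  unfolding closed_ideal_def by blast

lemma ideal_add: "closed_ideal m I \<Longrightarrow> f \<in> I \<Longrightarrow> g \<in> I \<Longrightarrow> (\<lambda>\<gamma>. f \<gamma> + g \<gamma>) \<in> I"
  unfolding closed_ideal_def by blast

lemma ideal_scale: "closed_ideal m I \<Longrightarrow> f \<in> I \<Longrightarrow> (\<lambda>\<gamma>. c * f \<gamma>) \<in> I"
  unfolding closed_ideal_def by blast

lemma ideal_diff: assumes "closed_ideal m I" "f \<in> I" "g \<in> I" shows "(\<lambda>\<gamma>. f \<gamma> - g \<gamma>) \<in> I"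
  using ideal_add[OF assms(1,2) ideal_scale[OF assms(1,3), of "-1"]] by simp

lemma ideal_conv:
  assumes "closed_ideal m I" "f \<in> I" "a \<in> Cred m (\<lambda>_. True)"
  shows "conv m a f \<in> I" "conv m f a \<in> I"
  using assms unfolding closed_ideal_def by blast+

lemma ideal_closed: "closed_ideal m I \<Longrightarrow> norm_closure m I \<subseteq> I"
  unfolding closed_ideal_def by blast

lemma ideal_sum:
  assumes "closed_ideal m I" "finite J" "\<And>j. j \<in> J \<Longrightarrow> f j \<in> I"
  shows "(\<lambda>\<gamma>. \<Sum>j\<in>J. f j \<gamma>) \<in> I"
  using assms(2,3) by (induction J rule: finite_induct) (simp_all add: ideal_0 ideal_add assms(1))

end

definition clip :: "nat \<Rightarrow> real \<Rightarrow> real" where "clip K t = max 0 (t - 1 / real K)"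

lemma clip_lipschitz: "\<bar>clip K s - clip K t\<bar> \<le> \<bar>s - t\<bar>"
  unfolding clip_def by linarith

context compressed
begin

text \<open>Distance to the ideal is submultiplicative: the product of \<open>h - i0\<close> and
  \<open>w - i\<close> differs from \<open>h w\<close> by an element of the ideal. Exponents start
  at 1 because the zeroth power is \<open>one\<close>, which need not lie in the algebra.\<close>

lemma ideal_X_power:
  assumes I: "closed_ideal m I" and i0: "i0 \<in> I" "op_bound (\<lambda>\<gamma>. h \<gamma> - i0 \<gamma>) \<eta>"
  shows "\<exists>i\<in>I. op_bound (\<lambda>\<gamma>. poly_op (bmon (Suc k) 0) one \<gamma> - i \<gamma>) (\<eta> ^ Suc k)"
proof (induction k)
  case 0
  have "poly_op (bmon (Suc 0) 0) one = h" by (simp add: bmon_def poly_op_X H_one)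
  then show ?case using i0 by auto
next
  case (Suc k)
  then obtain i where i: "i \<in> I" "op_bound (\<lambda>\<gamma>. poly_op (bmon (Suc k) 0) one \<gamma> - i \<gamma>) (\<eta> ^ Suc k)" by blast
  let ?w = "poly_op (bmon (Suc k) 0) one"
  have w: "?w \<in> tspan Iso" by (rule poly_op_tspan) (simp flip: poly_0_coeff_0)
  obtain rw where rw: "op_bound ?w rw" using tspan_opb[OF w] by blast
  obtain ri where ri: "op_bound i ri" using Cred_opb ideal_Cred[OF I i(1)] by blast
  obtain r0 where r0: "op_bound i0 r0" using Cred_opb ideal_Cred[OF I i0(1)] by blast
  have hC: "h \<in> Cred m (\<lambda>_. True)" and wC: "?w \<in> Cred m (\<lambda>_. True)" using tspan_Cred h_tspan w by auto
  have "bmon (Suc (Suc k)) 0 = [:0, 1:] * bmon (Suc k) 0" by (simp add: bmon_def)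
  then have e: "poly_op (bmon (Suc (Suc k)) 0) one = conv m h ?w"
    using poly_op_mult[OF fin_fibres_one] poly_op_X H_conv[OF fin_fibres_PH[OF fin_fibres_one]] by metis
  let ?j = "\<lambda>\<gamma>. (conv m i0 ?w \<gamma> + conv m h i \<gamma>) - conv m i0 i \<gamma>"
  have "?j \<in> I" using ideal_conv[OF I] i(1) i0(1) hC wC ideal_Cred[OF I i(1)] by (intro ideal_diff ideal_add I) blast+
  moreover have "conv m (\<lambda>\<gamma>. h \<gamma> - i0 \<gamma>) (\<lambda>\<gamma>. ?w \<gamma> - i \<gamma>) = (\<lambda>\<gamma>. conv m h ?w \<gamma> - ?j \<gamma>)"
    by (simp add: conv_diff_left[OF op_bound_h r0 i(2)] conv_diff_right[OF op_bound_h rw ri] conv_diff_right[OF r0 rw ri] algebra_simps)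
  ultimately show ?case using op_bound_conv[OF i0(2) i(2)] unfolding e by auto
qed

text \<open>A factor \<open>1 - h\<close> sends \<open>w - i\<close> to \<open>w - i\<close> minus
  \<open>h\<close> times it, and so at most doubles the distance to the ideal.\<close>

lemma ideal_bmon:
  assumes I: "closed_ideal m I" and i0: "i0 \<in> I" "op_bound (\<lambda>\<gamma>. h \<gamma> - i0 \<gamma>) \<eta>"
  shows "\<exists>i\<in>I. op_bound (\<lambda>\<gamma>. poly_op (bmon (Suc k) j) one \<gamma> - i \<gamma>) (\<eta> ^ Suc k * 2 ^ j)"
proof (induction j)
  case 0
  show ?case using ideal_X_power[OF assms] by simp
next
  case (Suc j)
  then obtain i where i: "i \<in> I" "op_bound (\<lambda>\<gamma>. poly_op (bmon (Suc k) j) one \<gamma> - i \<gamma>) (\<eta> ^ Suc k * 2 ^ j)" by blast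
  let ?w = "poly_op (bmon (Suc k) j) one"
  have w: "?w \<in> tspan Iso" by (rule poly_op_tspan) (simp flip: poly_0_coeff_0)
  obtain rw where rw: "op_bound ?w rw" using tspan_opb[OF w] by blast
  obtain ri where ri: "op_bound i ri" using Cred_opb ideal_Cred[OF I i(1)] by blast
  have hC: "h \<in> Cred m (\<lambda>_. True)" using tspan_Cred h_tspan by auto
  have "bmon (Suc k) (Suc j) = (1 - [:0, 1:]) * bmon (Suc k) j" by (simp add: bmon_def one_pCons mult_ac del: mult_pCons_left mult_pCons_right)
  then have e: "poly_op (bmon (Suc k) (Suc j)) one = (\<lambda>\<gamma>. ?w \<gamma> - conv m h ?w \<gamma>)"
    by (simp only: poly_op_mult[OF fin_fibres_one] poly_op_diff[OF fin_fibres_PH[OF fin_fibres_one]] poly_op_1 poly_op_X H_conv[OF fin_fibres_PH[OF fin_fibres_one]])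
  let ?j = "\<lambda>\<gamma>. i \<gamma> - conv m h i \<gamma>"
  have j: "?j \<in> I" using ideal_conv[OF I i(1) hC] i(1) by (intro ideal_diff I)
  have eq: "(\<lambda>\<gamma>. (?w \<gamma> - i \<gamma>) - conv m h (\<lambda>\<gamma>. ?w \<gamma> - i \<gamma>) \<gamma>) = (\<lambda>\<gamma>. (?w \<gamma> - conv m h ?w \<gamma>) - ?j \<gamma>)"
    by (simp add: conv_diff_right[OF op_bound_h rw ri] algebra_simps)
  have r: "\<eta> ^ Suc k * 2 ^ j + 1 * (\<eta> ^ Suc k * 2 ^ j) = \<eta> ^ Suc k * 2 ^ Suc j" by simp
  have "op_bound (\<lambda>\<gamma>. poly_op (bmon (Suc k) (Suc j)) one \<gamma> - ?j \<gamma>) (\<eta> ^ Suc k * 2 ^ Suc j)"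
    using op_bound_diff[OF i(2) op_bound_conv[OF op_bound_h i(2)]] unfolding e eq r .
  then show ?case using j by (rule bexI[of _ ?j])
qed

lemma poly_op_sum: "finite J \<Longrightarrow> poly_op (\<Sum>j\<in>J. p j) one = (\<lambda>\<gamma>. \<Sum>j\<in>J. poly_op (p j) one \<gamma>)"
  by (induction J rule: finite_induct) (simp_all add: poly_op_0 poly_op_add[OF fin_fibres_one])

text \<open>Origin of the constant \<open>(1/8)^K\<close>: a nonzero coefficient forces
  \<open>k > n/K\<close>, so the \<open>k\<close>-th power of \<open>(1/8)^K\<close> is at most
  \<open>(1/8)^n\<close>. The factors \<open>1 - h\<close> cost at most \<open>2^n\<close>, which
  leaves \<open>(1/4)^n\<close>, and the binomial coefficients sum to \<open>2^n\<close>.\<close>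

lemma ideal_bernp:
  assumes I: "closed_ideal m I" and i0: "i0 \<in> I" "op_bound (\<lambda>\<gamma>. h \<gamma> - i0 \<gamma>) ((1/8) ^ K)"
    and K: "K > 0" and n: "n > 0"
  shows "\<exists>i\<in>I. op_bound (\<lambda>\<gamma>. poly_op (bernp (clip K) n) one \<gamma> - i \<gamma>) ((1/2) ^ n)"
proof -
  let ?c = "\<lambda>k. clip K (real k / real n)"
  let ?q = "\<lambda>k. smult (?c k) (bern n k)"
  have "\<exists>i\<in>I. op_bound (\<lambda>\<gamma>. poly_op (?q k) one \<gamma> - i \<gamma>) (real (n choose k) * (1/4) ^ n)" if k: "k \<le> n" for k
  proof (cases "?c k = 0")
    case True
    then have "op_bound (\<lambda>\<gamma>. poly_op (?q k) one \<gamma> - 0) 0" using op_bound_0 by (simp add: poly_op_0)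
    then have "op_bound (\<lambda>\<gamma>. poly_op (?q k) one \<gamma> - 0) (real (n choose k) * (1/4) ^ n)" by (rule op_bound_mono) simp
    then show ?thesis using ideal_0[OF I] by (rule bexI[of _ "\<lambda>_. 0"])
  next
    case False
    then have c: "1 / real K < real k / real n" "0 \<le> ?c k" by (auto simp: clip_def max_def split: if_splits)
    have "real k / real n \<le> 1" using k n by simp
    then have c1: "?c k \<le> 1" by (simp add: clip_def) (smt (verit) divide_nonneg_nonneg of_nat_0_le_iff)
    have "real n < real k * real K" using c(1) K n by (simp add: divide_simps mult_ac split: if_splits)
    then have nk: "n \<le> K * k" by (metis less_imp_le mult.commute of_nat_less_iff of_nat_mult)
    then have "k \<noteq> 0" using n by (cases k) auto
    then obtain l where l: "k = Suc l" using not0_implies_Suc by blast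
    obtain i where i: "i \<in> I" "op_bound (\<lambda>\<gamma>. poly_op (bmon k (n - k)) one \<gamma> - i \<gamma>) (((1/8) ^ K) ^ k * 2 ^ (n - k))"
      using ideal_bmon[OF I i0, of l "n - k"] l by blast
    let ?d = "complex_of_real (?c k * real (n choose k))"
    have "(\<lambda>\<gamma>. ?d * (poly_op (bmon k (n - k)) one \<gamma> - i \<gamma>)) = (\<lambda>\<gamma>. poly_op (?q k) one \<gamma> - ?d * i \<gamma>)"
      by (simp add: bern_def poly_op_smult[OF fin_fibres_one] algebra_simps)
    then have "op_bound (\<lambda>\<gamma>. poly_op (?q k) one \<gamma> - ?d * i \<gamma>) (cmod ?d * (((1/8) ^ K) ^ k * 2 ^ (n - k)))"
      using op_bound_scale[OF i(2), of ?d] by simp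
    then have "op_bound (\<lambda>\<gamma>. poly_op (?q k) one \<gamma> - ?d * i \<gamma>) (real (n choose k) * (1/4) ^ n)"
    proof (rule op_bound_mono)
      have "cmod ?d \<le> real (n choose k)" using c(2) c1 by (simp add: norm_mult mult_left_le_one_le)
      moreover have "((1/8::real) ^ K) ^ k * 2 ^ (n - k) \<le> (1/8) ^ n * 2 ^ n"
      proof (rule mult_mono)
        show "((1/8::real) ^ K) ^ k \<le> (1/8) ^ n" unfolding power_mult[symmetric] by (rule power_decreasing[OF nk]) auto
        show "(2::real) ^ (n - k) \<le> 2 ^ n" by (rule power_increasing) auto
      qed auto
      moreover have "(1/8::real) ^ n * 2 ^ n = (1/4) ^ n" by (simp flip: power_mult_distrib)
      ultimately show "cmod ?d * (((1/8) ^ K) ^ k * 2 ^ (n - k)) \<le> real (n choose k) * (1/4) ^ n"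
        by (intro mult_mono) auto
    qed
    then show ?thesis using ideal_scale[OF I i(1)] by (rule bexI[of _ "\<lambda>\<gamma>. ?d * i \<gamma>"])
  qed
  then obtain i where i: "\<And>k. k \<le> n \<Longrightarrow> i k \<in> I" "\<And>k. k \<le> n \<Longrightarrow> op_bound (\<lambda>\<gamma>. poly_op (?q k) one \<gamma> - i k \<gamma>) (real (n choose k) * (1/4) ^ n)"
    by metis
  have "(\<lambda>\<gamma>. \<Sum>k\<le>n. i k \<gamma>) \<in> I" using i(1) by (intro ideal_sum I) auto
  moreover have "op_bound (\<lambda>\<gamma>. \<Sum>k\<le>n. poly_op (?q k) one \<gamma> - i k \<gamma>) (\<Sum>k\<le>n. real (n choose k) * (1/4) ^ n)"
    using i(2) by (intro op_bound_sum) auto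
  moreover have "(\<Sum>k\<le>n. real (n choose k) * (1/4) ^ n) = (1/2) ^ n"
  proof -
    have "(\<Sum>k\<le>n. real (n choose k) * (1/4) ^ n) = real (\<Sum>k\<le>n. n choose k) * (1/4) ^ n"
      by (simp add: sum_distrib_right)
    also have "\<dots> = 2 ^ n * (1/4) ^ n" by (simp add: choose_row_sum)
    finally show ?thesis by (simp flip: power_mult_distrib)
  qed
  ultimately show ?thesis
    by (intro bexI[of _ "\<lambda>\<gamma>. \<Sum>k\<le>n. i k \<gamma>"]) (simp_all add: bernp_def poly_op_sum sum_subtractf)
qed

text \<open>The Bernstein approximants \<open>g N\<close> lie in the span for \<open>Iso\<close> and
  approach the ideal. Their common limit \<open>c\<close>, which plays the part of the positive part
  of \<open>h - 1/K\<close>, therefore belongs to both closed sets.\<close>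

lemma exists_ideal_element:
  assumes I: "closed_ideal m I" and i0: "i0 \<in> I" "op_bound (\<lambda>\<gamma>. h \<gamma> - i0 \<gamma>) ((1/8) ^ K)" and K: "K > 0"
  shows "\<exists>c\<in>I. c \<in> norm_closure m (tspan Iso) \<and>
    (\<forall>x\<in>tight m. (cmod (b (gunit m x)))\<^sup>2 - 1 / real K \<le> Re (c (gunit m x)))"
proof -
  define g where "g N = poly_op (bernp (clip K) ((Suc N)\<^sup>2)) one" for N
  have gt: "g N \<in> tspan Iso" for N
  proof -
    \<comment> \<open>The constant term is \<open>clip K 0\<close>, which is zero, so no multiple of
      \<open>one\<close> enters \<open>g N\<close>.\<close>
    have "poly (bernp (clip K) ((Suc N)\<^sup>2)) 0 = 0"
      unfolding poly_bernp by (intro sum.neutral) (auto simp: Bernstein_def clip_def power_0_left)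
    then show ?thesis unfolding g_def by (intro poly_op_tspan) (simp only: poly_0_coeff_0)
  qed
  have cau: "op_bound (\<lambda>\<gamma>. g N \<gamma> - g l \<gamma>) (3 / real (Suc N))" if "N \<le> l" for N l
  proof -
    let ?n = "(Suc N)\<^sup>2" and ?l = "(Suc l)\<^sup>2" and ?t = "1 / real (Suc N)"
    let ?C = "?t + (1 / real ?n + 1 / real ?l) / ?t"
    have p: "0 < ?n" "0 < ?l" "0 < ?t" by simp_all
    have "[:?C:] - (bernp (clip K) ?n - bernp (clip K) ?l) \<in> cone"
      by (rule bernp_Cauchy[OF p clip_lipschitz])
    moreover have "[:?t + (1 / real ?l + 1 / real ?n) / ?t:] - (bernp (clip K) ?l - bernp (clip K) ?n) \<in> cone"
      by (rule bernp_Cauchy[OF p(2,1,3) clip_lipschitz])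
    then have "[:?C:] + (bernp (clip K) ?n - bernp (clip K) ?l) \<in> cone"
      by (simp only: add.commute[of "1 / real ?l"] diff_diff_eq2 add_diff_eq)
    moreover have "0 \<le> ?C" by (intro add_nonneg_nonneg divide_nonneg_nonneg) simp_all
    ultimately have "op_bound (poly_op (bernp (clip K) ?n - bernp (clip K) ?l) one) ?C" by (intro op_bound_PH)
    then have "op_bound (\<lambda>\<gamma>. g N \<gamma> - g l \<gamma>) ?C" unfolding g_def poly_op_diff[OF fin_fibres_one] .
    then show ?thesis using inverse_square_rate[OF that] by (rule op_bound_mono)
  qed
  have lim0: "(\<lambda>N. 3 / real (Suc N)) \<longlonglongrightarrow> 0" using LIMSEQ_Suc[OF lim_const_over_n[of 3]] by simp
  \<comment> \<open>The limit is first formed pointwise; the uniform Cauchy estimate then turns it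
    into a limit in norm, by letting \<open>l\<close> grow in \<open>g N - g (l + N)\<close> for
    fixed \<open>N\<close>.\<close>
  define c where "c \<gamma> = lim (\<lambda>N. g N \<gamma>)" for \<gamma>
  have conv: "(\<lambda>N. g N \<gamma>) \<longlonglongrightarrow> c \<gamma>" if \<gamma>: "\<gamma> \<in> Gt m" for \<gamma>
  proof -
    have "Cauchy (\<lambda>N. g N \<gamma>)"
    proof (rule CauchyI)
      fix e :: real assume e: "0 < e"
      obtain M where M: "\<And>N. N \<ge> M \<Longrightarrow> norm (3 / real (Suc N) - 0) < e / 2"
        using LIMSEQ_D[OF lim0, of "e / 2"] e by auto
      have d: "cmod (g M \<gamma> - g N \<gamma>) < e / 2" if "N \<ge> M" for N
        using op_bound_point[OF cau[OF that] \<gamma>] M[of M] by simp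
      have "cmod (g N \<gamma> - g l \<gamma>) < e" if "M \<le> N" "M \<le> l" for N l
        using norm_triangle_ineq4[of "g M \<gamma> - g l \<gamma>" "g M \<gamma> - g N \<gamma>"] d[OF that(1)] d[OF that(2)] by simp
      then show "\<exists>M. \<forall>m\<ge>M. \<forall>n\<ge>M. norm (g m \<gamma> - g n \<gamma>) < e" by blast
    qed
    then show ?thesis unfolding c_def by (simp add: Cauchy_convergent_iff convergent_LIMSEQ_iff)
  qed
  have off: "c \<gamma> = 0" if "\<gamma> \<notin> Gt m" for \<gamma>
    unfolding c_def using tspan_off[OF gt that] by (simp add: limI)
  have gc: "op_bound (\<lambda>\<gamma>. g N \<gamma> - c \<gamma>) (3 / real (Suc N))" for N
  proof (rule op_bound_lim)
    show "op_bound (\<lambda>\<gamma>. g N \<gamma> - g (l + N) \<gamma>) (3 / real (Suc N))" for l by (rule cau) simp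
    show "(\<lambda>l. g N \<gamma> - g (l + N) \<gamma>) \<longlonglongrightarrow> g N \<gamma> - c \<gamma>" if "\<gamma> \<in> Gt m" for \<gamma>
      by (intro tendsto_diff tendsto_const LIMSEQ_ignore_initial_segment conv that)
  qed simp
  have cB: "c \<in> norm_closure m (tspan Iso)" by (rule norm_closureI[OF off gt gc lim0])
  have "\<exists>i\<in>I. op_bound (\<lambda>\<gamma>. g N \<gamma> - i \<gamma>) ((1/2) ^ (Suc N)\<^sup>2)" for N
    unfolding g_def by (rule ideal_bernp[OF I i0 K]) simp
  then obtain i where i: "\<And>N. i N \<in> I" "\<And>N. op_bound (\<lambda>\<gamma>. g N \<gamma> - i N \<gamma>) ((1/2) ^ (Suc N)\<^sup>2)" by metis
  have ic: "op_bound (\<lambda>\<gamma>. i N \<gamma> - c \<gamma>) (3 / real (Suc N) + (1/2) ^ N)" for N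
  proof -
    have "op_bound (\<lambda>\<gamma>. (g N \<gamma> - c \<gamma>) - (g N \<gamma> - i N \<gamma>)) (3 / real (Suc N) + (1/2) ^ (Suc N)\<^sup>2)"
      by (rule op_bound_diff[OF gc i(2)])
    moreover have "(1/2::real) ^ (Suc N)\<^sup>2 \<le> (1/2) ^ N"
      by (rule power_decreasing) (simp_all add: power2_eq_square)
    ultimately show ?thesis by (simp add: op_bound_mono)
  qed
  have "(\<lambda>N. 3 / real (Suc N) + (1/2) ^ N) \<longlonglongrightarrow> 0 + 0" by (intro tendsto_add lim0 LIMSEQ_realpow_zero) simp_all
  then have "c \<in> norm_closure m I" using norm_closureI[OF off i(1) ic] by simp
  then have cI: "c \<in> I" using ideal_closed[OF I] by blast
  have "(cmod (b (gunit m x)))\<^sup>2 - 1 / real K \<le> Re (c (gunit m x))" if x: "x \<in> tight m" for x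
  proof -
    have u: "gunit m x \<in> Gt m" using gunit_fibre[OF x] Gt_fibre by blast
    have "(cmod (b (gunit m x)))\<^sup>2 - 1 / real K \<le> Re (g N (gunit m x))" for N
    proof -
      let ?p = "bernp (clip K) ((Suc N)\<^sup>2)"
      \<comment> \<open>\<open>clip K t\<close> dominates \<open>t - 1/K\<close>. The certificate is
        evaluated in the vector state of \<open>one\<close>, which gives the inequality at the unit
        for every \<open>N\<close> and hence in the limit.\<close>
      have "?p - [:- (1 / real K), 1:] \<in> cone" by (rule bernp_ge_linear) (simp_all add: clip_def)
      then have "0 \<le> Re (ip x one (poly_op (?p - [:- (1 / real K), 1:]) one))"
        using form_nonneg_cone fin_fibres_one by (simp add: form_nonneg_def)
      also have "\<dots> = Re (poly_op (?p - [:- (1 / real K), 1:]) one (gunit m x))" by (simp only: ip_one[OF x])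
      also have "\<dots> = Re (g N (gunit m x)) - (Re (h (gunit m x)) - 1 / real K)"
        using one_fibre[OF gunit_fibre[OF x]] by (simp add: poly_op_diff[OF fin_fibres_one] g_def poly_op_pCons poly_op_0 H_0 H_one)
      finally show ?thesis using h_unit_ge[OF x] by linarith
    qed
    then show ?thesis by (intro LIMSEQ_le_const[OF tendsto_Re[OF conv[OF u]]]) blast
  qed
  then show ?thesis using cI cB by blast
qed

end

section \<open>Detection of ideals\<close>

context inverse_semigroup_zero
begin

text \<open>The terms of \<open>f\<close> are treated one after the other, each time shrinking
  \<open>e\<close>. The claim for all \<open>g\<close> below \<open>e\<close> is what keeps the
  earlier terms under control: \<open>g \<odot> s \<odot> g\<close> is the compression of
  \<open>e \<odot> s \<odot> e\<close> by \<open>g\<close> and stays in \<open>Iso\<close>.\<close>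

lemma ex_compress_tspan:
  assumes "f \<in> tspan P" "e0 \<in> E" "e0 \<noteq> Z"
  shows "\<exists>e\<in>E. e \<noteq> Z \<and> e \<odot> e0 = e \<and> (\<forall>g\<in>E. g \<odot> e = g \<longrightarrow> conv m (T g) (conv m f (T g)) \<in> tspan Iso)"
  using assms(1)
proof induction
  case tspan_0
  then show ?case using assms(2,3) by (intro bexI[of _ e0]) (simp_all add: conv_0_left conv_0_right tspan.tspan_0 idem_dup)
next
  case (tspan_Cons s f c)
  then obtain e1 where e1: "e1 \<in> E" "e1 \<noteq> Z" "e1 \<odot> e0 = e1"
    and IH: "\<And>g. g \<in> E \<Longrightarrow> g \<odot> e1 = g \<Longrightarrow> conv m (T g) (conv m f (T g)) \<in> tspan Iso" by blast
  obtain e where e: "e \<in> E" "e \<noteq> Z" "e \<odot> e1 = e" "e \<odot> s \<odot> e \<in> Iso" using ex_compress_iso[OF e1(1,2)] by blast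
  have "conv m (T g) (conv m (\<lambda>\<gamma>. c * T s \<gamma> + f \<gamma>) (T g)) \<in> tspan Iso" if g: "g \<in> E" "g \<odot> e = g" for g
  proof -
    have eg: "e \<odot> g = g" using idem_comm[OF e(1) g(1)] g(2) by simp
    have "g \<odot> s \<odot> g = (g \<odot> e) \<odot> s \<odot> (e \<odot> g)" using g(2) eg by simp
    also have "\<dots> = g \<odot> (e \<odot> s \<odot> e) \<odot> g" by (simp add: assoc)
    finally have gsg: "g \<odot> s \<odot> g \<in> Iso" using iso_mult[OF iso_mult[OF idem_iso[OF g(1)] e(4)] idem_iso[OF g(1)]] by simp
    have "g \<odot> e1 = g" using g(2) e(3) assoc[of g e e1] by simp
    then have fg: "conv m (T g) (conv m f (T g)) \<in> tspan Iso" using IH g(1) by blast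
    have "conv m (\<lambda>\<gamma>. c * T s \<gamma> + f \<gamma>) (T g) = (\<lambda>\<gamma>. c * T (s \<odot> g) \<gamma> + conv m f (T g) \<gamma>)"
      using conv_fs_lin_left[OF fin_fibres_T] by (simp only: conv_T_T)
    then have "conv m (T g) (conv m (\<lambda>\<gamma>. c * T s \<gamma> + f \<gamma>) (T g)) = (\<lambda>\<gamma>. c * T (g \<odot> s \<odot> g) \<gamma> + conv m (T g) (conv m f (T g)) \<gamma>)"
      using conv_fs_lin_right[OF fin_fibres_T fin_fibres_conv[OF fin_fibres_tspan[OF tspan_Cons.hyps(2)] fin_fibres_T]] by (simp only: conv_T_T assoc)
    then show ?thesis using tspan.tspan_Cons[OF gsg fg] by simp
  qed
  moreover have "e \<odot> e0 = e" using e(3) e1(3) assoc[of e e1 e0] by simp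
  ultimately show ?case using e(1,2) by blast
qed

text \<open>Over \<open>Dset m e\<close> the compression does not change values at units, so lower
  bounds for \<open>f\<close> there pass to the compressed element.\<close>

lemma compress_unit:
  assumes x: "x \<in> tight m" and e: "e \<in> x"
  shows "conv m (T e) (conv m f (T e)) (gunit m x) = f (gunit m x)"
proof -
  have fl: "is_filter m x" using tight_filter x by blast
  have eE: "e \<in> E" using filter_idem fl e by blast
  have ee: "st e \<odot> e = e" "e \<odot> st e = e" "st e = e" using star_idem[OF eE] idem_dup(1)[OF eE] by simp_all
  have d: "st e \<odot> e \<in> x" using e ee by simp
  have u: "gunit m x = germ m e x" using gunit_eq[OF x e] .
  have th: "theta m e x = x" using theta_idem[OF fl e] .
  have "conv m (T e) (conv m f (T e)) (gunit m x) = conv m f (T e) (germ m (st e \<odot> e) x)"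
    unfolding u conv_T_left[OF x d] th using e ee by simp
  also have "\<dots> = conv m f (T e) (gunit m x)" using u ee by simp
  also have "\<dots> = f (gdiv (gunit m x) (germ m e x))" using conv_T_right[OF gunit_fibre[OF x]] d by simp
  also have "\<dots> = f (gunit m x)" unfolding u[symmetric] using gdiv_gunit[OF gunit_fibre[OF x]] by simp
  finally show ?thesis .
qed

text \<open>An element of the fibre over \<open>x\<close> is the germ of some \<open>s\<close>, and
  convolution with \<open>T (st s)\<close> moves its value to the unit \<open>x\<close>. Countably
  many pairs of a translate and a threshold \<open>1 / Suc n\<close> exhaust the nonmeagre set, so
  one of them gives a nonmeagre piece.\<close>

lemma ex_translate:
  assumes cnt: "countable (UNIV :: 'a set)" and a: "op_bound a r"
    and nm: "\<not> meagre_in (tight_top m) {x \<in> tight m. conv m (adj m a) a (gunit m x) \<noteq> 0}"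
  shows "\<exists>s \<epsilon>. 0 < \<epsilon> \<and> \<not> meagre_in (tight_top m) {x \<in> tight m. cmod (conv m (T s) a (gunit m x)) > \<epsilon>}"
proof (rule ccontr)
  assume "\<not> ?thesis"
  then have me: "meagre_in (tight_top m) {x \<in> tight m. cmod (conv m (T s) a (gunit m x)) > \<epsilon>}" if "0 < \<epsilon>" for s \<epsilon>
    using that by blast
  have "meagre_in (tight_top m) (\<Union>(s, n)\<in>UNIV \<times> (UNIV :: nat set). {x \<in> tight m. cmod (conv m (T s) a (gunit m x)) > 1 / real (Suc n)})"
    by (intro meagre_in_UN countable_SIGMA cnt countableI_type) (auto intro!: me)
  moreover have "{x \<in> tight m. conv m (adj m a) a (gunit m x) \<noteq> 0}
    \<subseteq> (\<Union>(s, n)\<in>UNIV \<times> (UNIV :: nat set). {x \<in> tight m. cmod (conv m (T s) a (gunit m x)) > 1 / real (Suc n)})"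
  proof
    fix x assume "x \<in> {x \<in> tight m. conv m (adj m a) a (gunit m x) \<noteq> 0}"
    then have x: "x \<in> tight m" and "\<exists>\<alpha>\<in>fibre x. a \<alpha> \<noteq> 0" using conv_adj_self_nonzero[OF a] by auto
    then obtain \<alpha> where al: "\<alpha> \<in> fibre x" "a \<alpha> \<noteq> 0" by blast
    obtain s where s: "st s \<odot> s \<in> x" "\<alpha> = germ m s x" using fibreE[OF al(1)] by blast
    let ?e = "st s \<odot> s"
    have eE: "?e \<in> E" by simp
    have d: "st ?e \<odot> ?e \<in> x" using s(1) star_idem[OF eE] idem_dup(1)[OF eE] by simp
    have "conv m (T (st s)) a (gunit m x) = a (germ m (s \<odot> ?e) x)"
      unfolding gunit_eq[OF x s(1)] conv_T_left[OF x d] theta_idem[OF tight_filter[OF x] s(1)] using s(1) by simp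
    also have "\<dots> = a \<alpha>" using s(2) by (simp add: star_inv')
    finally have "cmod (conv m (T (st s)) a (gunit m x)) > 0" using al(2) by simp
    then obtain n where "cmod (conv m (T (st s)) a (gunit m x)) > 1 / real (Suc n)"
      using reals_Archimedean by (metis inverse_eq_divide)
    then show "x \<in> (\<Union>(s, n)\<in>UNIV \<times> (UNIV :: nat set). {x \<in> tight m. cmod (conv m (T s) a (gunit m x)) > 1 / real (Suc n)})"
      using x by blast
  qed
  ultimately show False using nm meagre_in_subset by blast
qed

lemma ideal_subset_Jsing:
  assumes cnt: "countable (UNIV :: 'a set)" and I: "closed_ideal m I"
    and sub: "Cred m (\<lambda>s. s \<in> Iso) \<inter> I \<subseteq> Jsing m"
  shows "I \<subseteq> Jsing m"
proof
  fix a assume aI: "a \<in> I"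
  show "a \<in> Jsing m"
  proof (rule ccontr)
    assume "a \<notin> Jsing m"
    then have nm: "\<not> meagre_in (tight_top m) {x \<in> tight m. conv m (adj m a) a (gunit m x) \<noteq> 0}"
      using ideal_Cred[OF I aI] by (simp add: Jsing_def)
    obtain r0 where r0: "op_bound a r0" using Cred_opb ideal_Cred[OF I aI] by blast
    \<comment> \<open>Increased by 1 so that the division by \<open>r\<close> is legitimate even
      when \<open>r0 = 0\<close>.\<close>
    define r where "r = r0 + 1"
    have r: "op_bound a r" "0 < r" using op_bound_mono[OF r0] op_bound_nonneg[OF r0] by (auto simp: r_def)
    obtain s \<epsilon>0 where e0: "0 < \<epsilon>0" "\<not> meagre_in (tight_top m) {x \<in> tight m. cmod (conv m (T s) a (gunit m x)) > \<epsilon>0}"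
      using ex_translate[OF cnt r(1) nm] by blast
    \<comment> \<open>The factor brings \<open>a'\<close> to norm at most 1/2. An approximant with
      error at most 1/2 is then a contraction, as \<open>compressed\<close> requires.\<close>
    define d where "d = complex_of_real (1 / (2 * r))"
    define a' where "a' = (\<lambda>\<gamma>. d * conv m (T s) a \<gamma>)"
    define \<epsilon> where "\<epsilon> = \<epsilon>0 / (2 * r)"
    have cd: "cmod d = 1 / (2 * r)" using r(2) unfolding d_def norm_of_real by simp
    have eps: "0 < \<epsilon>" using e0 r by (simp add: \<epsilon>_def)
    let ?A = "{x \<in> tight m. cmod (a' (gunit m x)) > \<epsilon>}"
    have "?A = {x \<in> tight m. cmod (conv m (T s) a (gunit m x)) > \<epsilon>0}"
      using r(2) by (simp add: a'_def \<epsilon>_def norm_mult cd divide_less_cancel)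
    then have A: "\<not> meagre_in (tight_top m) ?A" using e0(2) by simp
    have a'I: "a' \<in> I" unfolding a'_def using ideal_scale[OF I ideal_conv(1)[OF I aI tspan_Cred[OF tspan_T[OF UNIV_I]]]] .
    have a'b: "op_bound a' (1/2)" using op_bound_scale[OF op_bound_conv[OF op_bound_T r(1)], of d] r(2) by (simp add: a'_def cd)
    obtain e0 where e0: "e0 \<in> E" "e0 \<noteq> Z"
      and loc: "\<And>f. f \<in> E \<Longrightarrow> f \<noteq> Z \<Longrightarrow> f \<odot> e0 = f \<Longrightarrow> \<not> meagre_in (tight_top m) (?A \<inter> Dset m f)"
      using nonmeagre_localize[OF countable_subset[OF subset_UNIV cnt] _ A] by blast
    have "0 < \<epsilon>\<^sup>2 / 4" using eps by simp
    \<comment> \<open>At the relevant units \<open>cmod b\<close> will be at least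
      \<open>\<epsilon> / 2\<close>, so this choice keeps its square minus \<open>1/K\<close>
      strictly positive.\<close>
    then obtain K0 where K0: "1 / real (Suc K0) < \<epsilon>\<^sup>2 / 4"
      using reals_Archimedean by (metis inverse_eq_divide)
    define K where "K = Suc K0"
    \<comment> \<open>The first bound preserves \<open>\<epsilon> / 2\<close> of the size of
      \<open>a'\<close> at units; the second is the distance from \<open>h\<close> to the ideal
      demanded by \<open>exists_ideal_element\<close>.\<close>
    define \<delta> where "\<delta> = min (\<epsilon> / 2) ((1/8) ^ K)"
    have del: "0 < \<delta>" "\<delta> \<le> \<epsilon> / 2" "\<delta> \<le> (1/8) ^ K" using eps by (auto simp: \<delta>_def)
    have "(1/8::real) ^ K \<le> (1/8) ^ 1" by (rule power_decreasing) (simp_all add: K_def)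
    then have del2: "\<delta> \<le> 1/2" using del by simp
    obtain f where f: "f \<in> tspan UNIV" "op_bound (\<lambda>\<gamma>. f \<gamma> - a' \<gamma>) \<delta>"
      using norm_closureD[OF _ del(1)] ideal_Cred[OF I a'I] unfolding Cred_UNIV by blast
    obtain e where e: "e \<in> E" "e \<noteq> Z" "e \<odot> e0 = e" and bt: "conv m (T e) (conv m f (T e)) \<in> tspan Iso"
      using ex_compress_tspan[OF f(1) e0] idem_dup(1) by blast
    define b where "b = conv m (T e) (conv m f (T e))"
    have "op_bound (\<lambda>\<gamma>. (f \<gamma> - a' \<gamma>) + a' \<gamma>) (\<delta> + 1/2)" by (rule op_bound_add[OF f(2) a'b])
    then have fb: "op_bound f 1" using del2 op_bound_mono by simp
    have bb: "op_bound b 1" using op_bound_conv[OF op_bound_T op_bound_conv[OF fb op_bound_T]] by (simp add: b_def)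
    interpret compressed m b by unfold_locales (use bt bb in \<open>simp_all add: b_def\<close>)
    let ?i1 = "conv m (T e) (conv m a' (T e))"
    have TC: "T e \<in> Cred m (\<lambda>_. True)" using tspan_Cred[OF tspan_T[OF UNIV_I]] .
    have i1: "?i1 \<in> I" using ideal_conv[OF I _ TC] a'I by blast
    have "(\<lambda>\<gamma>. b \<gamma> - ?i1 \<gamma>) = conv m (T e) (conv m (\<lambda>\<gamma>. f \<gamma> - a' \<gamma>) (T e))"
      by (simp only: b_def conv_diff_left[OF fb a'b op_bound_T] conv_diff_right[OF op_bound_T op_bound_conv[OF fb op_bound_T] op_bound_conv[OF a'b op_bound_T]])
    then have bi: "op_bound (\<lambda>\<gamma>. b \<gamma> - ?i1 \<gamma>) \<delta>" using op_bound_conv[OF op_bound_T op_bound_conv[OF f(2) op_bound_T]] by simp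
    \<comment> \<open>Left multiplication by the contraction \<open>adj m b\<close> transfers the
      distance estimate from \<open>b\<close> to \<open>h\<close>.\<close>
    let ?i0 = "conv m (adj m b) ?i1"
    have i0: "?i0 \<in> I" using ideal_conv(1)[OF I i1 tspan_Cred[OF adj_b_tspan]] .
    have "(\<lambda>\<gamma>. h \<gamma> - ?i0 \<gamma>) = conv m (adj m b) (\<lambda>\<gamma>. b \<gamma> - ?i1 \<gamma>)"
      by (simp only: h_def conv_diff_right[OF op_bound_adj[OF bb] bb op_bound_conv[OF op_bound_T op_bound_conv[OF a'b op_bound_T]]])
    then have "op_bound (\<lambda>\<gamma>. h \<gamma> - ?i0 \<gamma>) \<delta>" using op_bound_conv[OF op_bound_adj[OF bb] bi] by simp
    then have hi: "op_bound (\<lambda>\<gamma>. h \<gamma> - ?i0 \<gamma>) ((1/8) ^ K)" using del(3) by (rule op_bound_mono)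
    obtain c where c: "c \<in> I" "c \<in> norm_closure m (tspan Iso)"
      "\<And>x. x \<in> tight m \<Longrightarrow> (cmod (b (gunit m x)))\<^sup>2 - 1 / real K \<le> Re (c (gunit m x))"
      using exists_ideal_element[OF I i0 hi] by (auto simp: K_def)
    obtain rc where rc: "op_bound c rc" using Cred_opb ideal_Cred[OF I c(1)] by blast
    have "c \<in> Jsing m" using sub c(1,2) unfolding Cred_Iso by blast
    then have mc: "meagre_in (tight_top m) {x \<in> tight m. conv m (adj m c) c (gunit m x) \<noteq> 0}" by (simp add: Jsing_def)
    \<comment> \<open>Here the contradiction arises: the left side is nonmeagre by the choice of
      \<open>e0\<close>, the right side is meagre since \<open>c\<close> lies in the intersection of
      the ideal with the smaller algebra.\<close>
    have "?A \<inter> Dset m e \<subseteq> {x \<in> tight m. conv m (adj m c) c (gunit m x) \<noteq> 0}"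
    proof
      fix x assume "x \<in> ?A \<inter> Dset m e"
      then have x: "x \<in> tight m" "e \<in> x" "cmod (a' (gunit m x)) > \<epsilon>" by (auto simp: Dset_def)
      have u: "gunit m x \<in> fibre x" "gunit m x \<in> Gt m" using gunit_fibre[OF x(1)] Gt_fibre by blast+
      have bf: "b (gunit m x) = f (gunit m x)" unfolding b_def by (rule compress_unit[OF x(1,2)])
      have "cmod (f (gunit m x) - a' (gunit m x)) \<le> \<epsilon> / 2" using op_bound_point[OF f(2) u(2)] del(2) by linarith
      then have "\<epsilon> / 2 \<le> cmod (b (gunit m x))"
        using x(3) norm_triangle_ineq2[of "a' (gunit m x)" "f (gunit m x)"] by (simp add: bf norm_minus_commute)
      then have "(\<epsilon> / 2)\<^sup>2 \<le> (cmod (b (gunit m x)))\<^sup>2" using eps by (intro power_mono) auto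
      then have "0 < Re (c (gunit m x))" using c(3)[OF x(1)] K0 by (simp add: K_def power_divide)
      then have "c (gunit m x) \<noteq> 0" by auto
      then show "x \<in> {x \<in> tight m. conv m (adj m c) c (gunit m x) \<noteq> 0}"
        using conv_adj_self_nonzero[OF rc x(1)] u(1) x(1) by blast
    qed
    then show False using loc[OF e] meagre_in_subset[OF mc] by blast
  qed
qed

lemma Cred_Iso_subset: "Cred m (\<lambda>s. s \<in> Iso) \<subseteq> Cred m (\<lambda>_. True)"
  unfolding Cred_Iso Cred_UNIV by (intro norm_closure_mono subsetI tspan_mono[OF _ subset_UNIV])

lemma zero_Jsing: "(\<lambda>_. 0) \<in> Jsing m"
proof -
  have "meagre_in (tight_top m) {}" using meagre_in_UN[of "{} :: nat set"] by simp
  then show ?thesis using tspan_Cred[OF tspan_0] by (simp add: Jsing_def conv_0_right)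
qed

text \<open>A closed subalgebra containing the generators contains the closure of their span.
  Consequently an ideal meeting the generated algebra only in 0 meets
  \<open>Cred m (\<lambda>s. s \<in> Iso)\<close> at most in 0.\<close>

lemma Cred_Iso_gen: "Cred m (\<lambda>s. s \<in> Iso) \<subseteq> gen_cstar m {T s | s. s \<in> Iso}"
  unfolding gen_cstar_def
proof (rule Inter_greatest)
  fix B assume "B \<in> {B. {T s | s. s \<in> Iso} \<subseteq> B \<and> B \<subseteq> Cred m (\<lambda>_. True) \<and>
     (\<forall>f\<in>B. \<forall>g\<in>B. (\<lambda>\<gamma>. f \<gamma> + g \<gamma>) \<in> B \<and> conv m f g \<in> B) \<and>
     (\<forall>c. \<forall>f\<in>B. (\<lambda>\<gamma>. c * f \<gamma>) \<in> B) \<and> (\<forall>f\<in>B. adj m f \<in> B) \<and> norm_closure m B \<subseteq> B}"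
  then have B: "\<And>s. s \<in> Iso \<Longrightarrow> T s \<in> B" "\<And>f g. f \<in> B \<Longrightarrow> g \<in> B \<Longrightarrow> (\<lambda>\<gamma>. f \<gamma> + g \<gamma>) \<in> B"
    "\<And>c f. f \<in> B \<Longrightarrow> (\<lambda>\<gamma>. c * f \<gamma>) \<in> B" "norm_closure m B \<subseteq> B" by blast+
  have "f \<in> B" if "f \<in> tspan Iso" for f
    using that
  proof induction
    case tspan_0
    \<comment> \<open>The zero function is obtained as \<open>0\<close> times the generator
      \<open>T Z\<close>, which is available since \<open>Z\<close> lies in
      \<open>Iso\<close>.\<close>
    show ?case using B(3)[OF B(1)[OF Z_iso], of 0] by simp
  next
    case (tspan_Cons s f c)
    show ?case using B(2)[OF B(3)[OF B(1)[OF tspan_Cons(1)]] tspan_Cons(3)] .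
  qed
  then have "norm_closure m (tspan Iso) \<subseteq> norm_closure m B" by (intro norm_closure_mono) blast
  then show "Cred m (\<lambda>s. s \<in> Iso) \<subseteq> B" unfolding Cred_Iso using B(4) by blast
qed

end

theorem theorem3p4:
  fixes m :: "'a::countable \<Rightarrow> 'a \<Rightarrow> 'a"
  assumes "inverse_semigroup m" and "has_zero m"
  shows "(\<forall>I. closed_ideal m I \<longrightarrow>
            ((Cred m (\<lambda>s. s \<in> iso_part m) \<inter> I \<subseteq> Jsing m) \<longleftrightarrow>
             (Cred m (\<lambda>_. True) \<inter> I \<subseteq> Jsing m)))
       \<and> ess_ideal_detecting m (gen_cstar m {Tgen m s | s. s \<in> iso_part m})"
proof -
  interpret inverse_semigroup_zero m using assms by unfold_locales
  have cnt: "countable (UNIV :: 'a set)" by simp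
  show ?thesis
  proof (intro conjI allI impI)
    fix I assume I: "closed_ideal m I"
    show "(Cred m (\<lambda>s. s \<in> iso_part m) \<inter> I \<subseteq> Jsing m) \<longleftrightarrow> (Cred m (\<lambda>_. True) \<inter> I \<subseteq> Jsing m)"
      using ideal_subset_Jsing[OF cnt I] Cred_Iso_subset by blast
  next
    show "ess_ideal_detecting m (gen_cstar m {Tgen m s | s. s \<in> iso_part m})"
      unfolding ess_ideal_detecting_def
    proof (intro allI impI)
      fix I assume a: "closed_ideal m I \<and> I \<inter> gen_cstar m {Tgen m s | s. s \<in> iso_part m} = {\<lambda>_. 0}"
      then have "Cred m (\<lambda>s. s \<in> Iso) \<inter> I \<subseteq> {\<lambda>_. 0}" using Cred_Iso_gen by blast
      then have "Cred m (\<lambda>s. s \<in> Iso) \<inter> I \<subseteq> Jsing m" using zero_Jsing by blast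
      then show "I \<subseteq> Jsing m" using ideal_subset_Jsing[OF cnt] a by blast
    qed
  qed
qed

end
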